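(* Let $d\geq 3$ and let $P\subset\mathbb R^d$ be a full-dimensional polytope. Then $P$ is equiprojective if and only if the set of edge-2-faces of $P$ can be partitioned into pairs of edge-2-faces that compensate each other.
   Context: For a $2$-face $F$ of $P$, $\mathrm{Span}[F]$ denotes the unique $2$-dimensional linear subspace parallel to $F$; two $2$-faces are parallel if they have the same $\mathrm{Span}[\cdot]$; a class of 2-faces is an equivalence class for parallelism. For a $2$-dimensional linear subspace $W$, $\pi_W$ is the orthogonal projection onto $W$. A $2$-face $F$ is degenerating for $W$ if $\pi_W(F)$ is contained in a line (equivalently $W^\perp\cap \mathrm{Span}[F]\neq\{0\}$); a class is degenerating for $W$ if one (equivalently every) representative is. $W$ is admissible if no class of 2-faces of $P$ is degenerating for $W$. $P$ is $k$-equiprojective if $\pi_W(P)$ is a $k$-gon for every admissible plane $W$, and equiprojective if it is $k$-equiprojective for some $k$. Two parallel 2-faces $F\neq F'$ are simultaneously visible if there is a $2$-dimensional subspace $W$ such that the class of $F$ is the only class of 2-faces degenerating for $W$ and both $\pi_W(F)$ and $\pi_W(F')$ lie in the boundary of $\pi_W(P)$; the pair $(F,\varnothing)$ is also called simultaneously visible if there is such a $W$ for which $\pi_W(F)$ lies in the boundary of $\pi_W(P)$ and no other 2-face parallel to $F$ does. An edge-2-faces is a triple $(e,F,F')$ where $F,F'$ are simultaneously visible ($F'$ possibly $\varnothing$) and $e$ is an edge of $F$. Each edge-2-faces carries an orientation of $e$: if $F'\neq\varnothing$, let $A$ be the smallest affine subspace containing $F\cup F'$; then $Q=P\cap A$ is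 a $3$-polytope having $F$ and $F'$ as facets, and (fixing an orientation of the direction space of $A$) the boundary cycle of each of $F$ and $F'$ is oriented counterclockwise as seen from outside $Q$ (i.e. for an edge traversed along $u$, a vector $w\in\mathrm{Span}[G]$ pointing from the edge into the facet $G$, and the outward normal $n_G$ of $G$ in $Q$, $(u,w,n_G)$ is positively oriented); every edge-2-faces $(e,F,F')$ or $(e,F',F)$ gets the orientation of $e$ thus defined. If $F'=\varnothing$, one fixes arbitrarily one of the two cyclic orientations of the boundary of $F$ and orients its edges accordingly. Two distinct edge-2-faces $(e,F,F')$ and $(\tilde e,\tilde F,\tilde F')$ compensate each other if $e$ and $\tilde e$ are parallel with opposite orientations and either ($F=\tilde F'$ and $F'=\tilde F$) or ($F=\tilde F$ and $F'=\tilde F'$, possibly empty). *)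

theory Defs
  imports "HOL-Analysis.Analysis" "HOL-Library.Disjoint_Sets"
begin

subsection \<open>Projections onto planes\<close>

definition orth_proj :: "'a::euclidean_space set \<Rightarrow> 'a \<Rightarrow> 'a" where
  "orth_proj W x = (THE y. y \<in> W \<and> (\<forall>w\<in>W. orthogonal (x - y) w))"

lemma orth_proj:
  assumes "subspace W"
  shows "orth_proj W x \<in> W" and "\<And>w. w \<in> W \<Longrightarrow> orthogonal (x - orth_proj W x) w"
proof -
  let ?Q = "\<lambda>y. y \<in> W \<and> (\<forall>w\<in>W. orthogonal (x - y) w)"
  have span: "span W = W"
    using assms by (simp add: span_eq_iff)
  obtain y z where yz: "y \<in> span W" "\<And>w. w \<in> span W \<Longrightarrow> orthogonal z w" "x = y + z"
    using orthogonal_subspace_decomp_exists by blast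
  have "?Q (THE y. ?Q y)"
  proof (rule theI)
    show "?Q y" using yz span by simp
  next
    fix y' assume y': "?Q y'"
    have "y' - y \<in> W" using y' yz(1) span assms by (simp add: subspace_diff)
    then have "orthogonal (x - y) (y' - y)" "orthogonal (x - y') (y' - y)"
      using yz span y' by auto
    then have "(y' - y) \<bullet> (y' - y) = 0"
      by (simp add: orthogonal_def inner_diff_left inner_diff_right)
    then show "y' = y" by simp
  qed
  then show "orth_proj W x \<in> W" "\<And>w. w \<in> W \<Longrightarrow> orthogonal (x - orth_proj W x) w"
    unfolding orth_proj_def by auto
qed

definition linear_plane :: "'a::euclidean_space set \<Rightarrow> bool" where
  "linear_plane W \<longleftrightarrow> subspace W \<and> dim W = 2"

definition k_gon :: "nat \<Rightarrow> 'a::euclidean_space set \<Rightarrow> bool" where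
  "k_gon k S \<longleftrightarrow> polytope S \<and> aff_dim S = 2 \<and> card {v. v extreme_point_of S} = k"


subsection \<open>Parallelism classes of 2-faces and equiprojectivity\<close>

definition two_face :: "'a::euclidean_space set \<Rightarrow> 'a set \<Rightarrow> bool" where
  "two_face P F \<longleftrightarrow> F face_of P \<and> aff_dim F = 2"

text \<open>The linear subspace parallel to the affine hull of \<open>S\<close>; for a 2-face \<open>F\<close> this is
  \<open>Span[F]\<close>.\<close>

definition direction_space :: "'a::euclidean_space set \<Rightarrow> 'a set" where
  "direction_space S = span {x - y | x y. x \<in> S \<and> y \<in> S}"

definition parallel_faces :: "'a::euclidean_space set \<Rightarrow> 'a set \<Rightarrow> bool" where
  "parallel_faces F G \<longleftrightarrow> direction_space F = direction_space G"

definition face_class :: "'a::euclidean_space set \<Rightarrow> 'a set \<Rightarrow> 'a set set" where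
  "face_class P F = {G. two_face P G \<and> parallel_faces G F}"

definition face_classes :: "'a::euclidean_space set \<Rightarrow> 'a set set set" where
  "face_classes P = face_class P ` {F. two_face P F}"

definition degenerating :: "'a::euclidean_space set \<Rightarrow> 'a set \<Rightarrow> bool" where
  "degenerating W F \<longleftrightarrow> collinear (orth_proj W ` F)"

definition degenerating_class :: "'a::euclidean_space set \<Rightarrow> 'a set set \<Rightarrow> bool" where
  "degenerating_class W C \<longleftrightarrow> (\<exists>F\<in>C. degenerating W F)"

definition admissible :: "'a::euclidean_space set \<Rightarrow> 'a set \<Rightarrow> bool" where
  "admissible P W \<longleftrightarrow> linear_plane W \<and> (\<forall>C\<in>face_classes P. \<not> degenerating_class W C)"

definition k_equiprojective :: "nat \<Rightarrow> 'a::euclidean_space set \<Rightarrow> bool" where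
  "k_equiprojective k P \<longleftrightarrow> (\<forall>W. admissible P W \<longrightarrow> k_gon k (orth_proj W ` P))"

definition equiprojective :: "'a::euclidean_space set \<Rightarrow> bool" where
  "equiprojective P \<longleftrightarrow> (\<exists>k. k_equiprojective k P)"


subsection \<open>Simultaneously visible 2-faces and edge-2-faces\<close>

definition only_degenerating ::
    "'a::euclidean_space set \<Rightarrow> 'a set \<Rightarrow> 'a set \<Rightarrow> bool" where
  "only_degenerating P W F \<longleftrightarrow>
     (\<forall>C\<in>face_classes P. degenerating_class W C \<longleftrightarrow> C = face_class P F)"

text \<open>The boundary of the polygon \<open>orth_proj W ` P\<close> is taken relative to its plane \<open>W\<close>.\<close>

definition projects_to_boundary ::
    "'a::euclidean_space set \<Rightarrow> 'a set \<Rightarrow> 'a set \<Rightarrow> bool" where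
  "projects_to_boundary P W F \<longleftrightarrow> orth_proj W ` F \<subseteq> rel_frontier (orth_proj W ` P)"

text \<open>The second face may be the empty set, with its own clause.\<close>

definition simultaneously_visible ::
    "'a::euclidean_space set \<Rightarrow> 'a set \<Rightarrow> 'a set \<Rightarrow> bool" where
  "simultaneously_visible P F F' \<longleftrightarrow>
     (if F' = {} then
        two_face P F \<and>
        (\<exists>W. linear_plane W \<and> only_degenerating P W F \<and> projects_to_boundary P W F \<and>
             (\<forall>G. two_face P G \<and> parallel_faces G F \<and> G \<noteq> F \<longrightarrow> \<not> projects_to_boundary P W G))
      else
        two_face P F \<and> two_face P F' \<and> parallel_faces F F' \<and> F \<noteq> F' \<and>
        (\<exists>W. linear_plane W \<and> only_degenerating P W F \<and>
             projects_to_boundary P W F \<and> projects_to_boundary P W F'))"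

definition edge_2_faces :: "'a::euclidean_space set \<Rightarrow> ('a set \<times> 'a set \<times> 'a set) set" where
  "edge_2_faces P = {(e, F, F'). simultaneously_visible P F F' \<and> e edge_of F}"


subsection \<open>Orientations\<close>

text \<open>An orientation of a 3-dimensional subspace is given by an ordered basis of it, stored as a
  vector of three vectors. A triple is positively oriented if the matrix expressing it in that
  basis has positive determinant.\<close>

definition ordered_basis :: "'a::euclidean_space set \<Rightarrow> 'a^3 \<Rightarrow> bool" where
  "ordered_basis V b \<longleftrightarrow> inj (($) b) \<and> independent (range (($) b)) \<and> span (range (($) b)) = V"

definition positively_oriented :: "'a::euclidean_space^3 \<Rightarrow> 'a^3 \<Rightarrow> bool" where
  "positively_oriented b x \<longleftrightarrow>
     (\<exists>M::real^3^3. det M > 0 \<and> (\<forall>i. x $ i = (\<Sum>j\<in>UNIV. M $ i $ j *\<^sub>R b $ j)))"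

definition points_into :: "'a::euclidean_space \<Rightarrow> 'a set \<Rightarrow> 'a set \<Rightarrow> bool" where
  "points_into w e G \<longleftrightarrow> (\<exists>x\<in>e. \<exists>t>0. x + t *\<^sub>R w \<in> G - e)"

text \<open>Normals are taken inside the direction space of \<open>Q\<close>.\<close>

definition outward_normal :: "'a::euclidean_space \<Rightarrow> 'a set \<Rightarrow> 'a set \<Rightarrow> bool" where
  "outward_normal n Q G \<longleftrightarrow>
     n \<in> direction_space Q \<and> n \<noteq> 0 \<and> (\<forall>v\<in>direction_space G. orthogonal n v) \<and>
     (\<forall>y\<in>G. \<forall>x\<in>Q. n \<bullet> x \<le> n \<bullet> y)"

text \<open>The vector \<open>u\<close> traverses the edge \<open>e\<close> of the facet \<open>G\<close> of the 3-polytope \<open>Q\<close>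
  counterclockwise, as seen from outside \<open>Q\<close>, for the orientation given by the basis \<open>b\<close>.\<close>

definition traverses_ccw ::
    "'a::euclidean_space^3 \<Rightarrow> 'a set \<Rightarrow> 'a set \<Rightarrow> 'a set \<Rightarrow> 'a \<Rightarrow> bool" where
  "traverses_ccw b Q G e u \<longleftrightarrow>
     (\<exists>p q. e = closed_segment p q \<and> u = q - p) \<and>
     (\<exists>w n. points_into w e G \<and> outward_normal n Q G \<and>
            positively_oriented b (vector [u, w, n]))"

text \<open>A cyclic orientation of the boundary of a polygon \<open>F\<close> is a listing of its vertices in which
  the cyclically consecutive pairs are exactly the edges.\<close>

definition boundary_cycle :: "'a::euclidean_space set \<Rightarrow> 'a list \<Rightarrow> bool" where
  "boundary_cycle F vs \<longleftrightarrow>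
     distinct vs \<and> set vs = {v. v extreme_point_of F} \<and>
     {e. e edge_of F} = {closed_segment (vs ! i) (vs ! (Suc i mod length vs)) | i. i < length vs}"

definition traverses_cyclically :: "'a::euclidean_space list \<Rightarrow> 'a set \<Rightarrow> 'a \<Rightarrow> bool" where
  "traverses_cyclically vs e u \<longleftrightarrow>
     (\<exists>i<length vs. e = closed_segment (vs ! i) (vs ! (Suc i mod length vs)) \<and>
                    u = vs ! (Suc i mod length vs) - vs ! i)"

text \<open>The arbitrary choices entering the definition of the orientations: \<open>\<omega> A\<close> orients the direction
  space of the affine space \<open>A\<close> spanned by two simultaneously visible 2-faces, and \<open>\<gamma> F\<close> is a
  cyclic orientation of the boundary of a 2-face \<open>F\<close> that is visible on its own.\<close>

definition orientation_choice ::
    "'a::euclidean_space set \<Rightarrow> ('a set \<Rightarrow> 'a^3) \<Rightarrow> ('a set \<Rightarrow> 'a list) \<Rightarrow> bool" where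
  "orientation_choice P \<omega> \<gamma> \<longleftrightarrow>
     (\<forall>F F'. F' \<noteq> {} \<and> simultaneously_visible P F F' \<longrightarrow>
        ordered_basis (direction_space (affine hull (F \<union> F'))) (\<omega> (affine hull (F \<union> F')))) \<and>
     (\<forall>F. simultaneously_visible P F {} \<longrightarrow> boundary_cycle F (\<gamma> F))"

text \<open>\<open>u\<close> is the vector along which the edge of the given edge-2-faces is traversed.\<close>

fun oriented_along ::
    "'a::euclidean_space set \<Rightarrow> ('a set \<Rightarrow> 'a^3) \<Rightarrow> ('a set \<Rightarrow> 'a list) \<Rightarrow>
     'a set \<times> 'a set \<times> 'a set \<Rightarrow> 'a \<Rightarrow> bool" where
  "oriented_along P \<omega> \<gamma> (e, F, F') u \<longleftrightarrow>
     (if F' = {} then traverses_cyclically (\<gamma> F) e u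
      else let A = affine hull (F \<union> F') in traverses_ccw (\<omega> A) (P \<inter> A) F e u)"

definition opposite_orientations ::
    "'a::euclidean_space set \<Rightarrow> ('a set \<Rightarrow> 'a^3) \<Rightarrow> ('a set \<Rightarrow> 'a list) \<Rightarrow>
     'a set \<times> 'a set \<times> 'a set \<Rightarrow> 'a set \<times> 'a set \<times> 'a set \<Rightarrow> bool" where
  "opposite_orientations P \<omega> \<gamma> s t \<longleftrightarrow>
     (\<exists>u v r. oriented_along P \<omega> \<gamma> s u \<and> oriented_along P \<omega> \<gamma> t v \<and> r < 0 \<and> v = r *\<^sub>R u)"

fun compensate ::
    "'a::euclidean_space set \<Rightarrow> ('a set \<Rightarrow> 'a^3) \<Rightarrow> ('a set \<Rightarrow> 'a list) \<Rightarrow>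
     'a set \<times> 'a set \<times> 'a set \<Rightarrow> 'a set \<times> 'a set \<times> 'a set \<Rightarrow> bool" where
  "compensate P \<omega> \<gamma> (e, F, F') (f, G, G') \<longleftrightarrow>
     (e, F, F') \<noteq> (f, G, G') \<and>
     direction_space e = direction_space f \<and>
     opposite_orientations P \<omega> \<gamma> (e, F, F') (f, G, G') \<and>
     (F = G' \<and> F' = G \<or> F = G \<and> F' = G')"

end

theory Submission
  imports Defs
begin

text \<open>
  Write an admissible plane as \<open>W = span {n, m}\<close> and count the vertices of the projection of
  \<open>P\<close> parametrically: up to scaling, the functionals in \<open>W\<close> other than \<open>m\<close> and \<open>- m\<close> are the
  \<open>n + \<beta> m\<close> and the \<open>- n + \<beta> m\<close>, so the vertices correspond to the edges of \<open>P\<close> that maximize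
  one of these. If \<open>n\<close> moves with \<open>m\<close> fixed, the count only changes when \<open>W\<close> passes through a plane
  for which exactly one class of 2-faces degenerates, in a direction \<open>k\<close>. There the 2-faces \<open>F\<close> and
  \<open>F'\<close> of that class projecting to the boundary are exposed by functionals \<open>\<nu>\<close> and \<open>- \<nu>\<close>, and
  the two arcs into which \<open>k\<close> divides the boundary of \<open>F\<close> (respectively \<open>F'\<close>) replace each other.
  Hence the count jumps by the sum of the signs of \<open>det (u, k)\<close> over the oriented edges \<open>u\<close> of \<open>F\<close>
  and \<open>F'\<close>. A pairing of opposite edges makes all these sums vanish. Conversely, if the sum
  vanishes for almost all \<open>k\<close>, its jump as \<open>k\<close> crosses the line spanned by \<open>u\<close> shows that
  the directions \<open>u\<close> and \<open>- u\<close> occur equally often.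
\<close>

subsection \<open>Faces of polytopes\<close>

text \<open>Fixing \<open>m\<close> makes single edges trackable: an edge not orthogonal to
  \<open>m\<close> is constant for exactly one functional \<open>n + \<beta> m\<close>, so its
  contribution is governed by finitely many inequalities in \<open>n\<close>, and a jump is computed
  edge by edge. The opposite faces \<open>F\<close> and \<open>F'\<close> enter the jump with
  opposite signs, because \<open>- \<nu>\<close> moves in the direction opposite to \<nu>; the
  opposite outward normals that orient their boundaries produce the same sign, and all other choices
  of orientation reduce to one sign per pair of faces, which cannot affect the vanishing of a sum.

  The obstacle is that nothing is known about planes for which several classes degenerate at once.
  Joining two admissible planes therefore requires an \<open>m\<close> off finitely many hyperplanes
  and a path of \<open>n\<close> that meets the walls of different classes at different times.
  Conversely, a plane for which only the class of \<open>F\<close> degenerates, in a prescribed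
  direction \<open>k\<close>, is constructed for \<open>k\<close> off finitely many lines; this is
  the origin of the exceptional directions.\<close>

lemma subspace_direction_space [simp]: "subspace (direction_space S)"
  by (simp add: direction_space_def)

lemma diff_in_direction_space: "x \<in> S \<Longrightarrow> y \<in> S \<Longrightarrow> x - y \<in> direction_space S"
  unfolding direction_space_def by (rule span_base) blast

lemma direction_space_mono: "S \<subseteq> T \<Longrightarrow> direction_space S \<subseteq> direction_space T"
  unfolding direction_space_def by (rule span_mono) blast

lemma direction_space_least:
  assumes "subspace V" "\<And>x y. x \<in> S \<Longrightarrow> y \<in> S \<Longrightarrow> x - y \<in> V"
  shows "direction_space S \<subseteq> V"
  unfolding direction_space_def using assms by (intro span_minimal) auto

lemma direction_space_basepoint:
  assumes "a \<in> S"
  shows "direction_space S = span ((\<lambda>x. x - a) ` S)"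
proof
  show "direction_space S \<subseteq> span ((\<lambda>x. x - a) ` S)"
  proof (rule direction_space_least)
    fix x y assume "x \<in> S" "y \<in> S"
    then have "(x - a) - (y - a) \<in> span ((\<lambda>x. x - a) ` S)"
      by (intro span_diff span_base) auto
    then show "x - y \<in> span ((\<lambda>x. x - a) ` S)" by simp
  qed simp
  show "span ((\<lambda>x. x - a) ` S) \<subseteq> direction_space S"
    using assms by (intro span_minimal) (auto intro: diff_in_direction_space)
qed

lemma dim_direction_space:
  assumes "S \<noteq> {}"
  shows "int (dim (direction_space S)) = aff_dim S"
proof -
  obtain a where a: "a \<in> S" using assms by auto
  have "aff_dim S = int (dim ((\<lambda>x. - a + x) ` S))"
    by (rule aff_dim_eq_dim) (use a hull_inc in fast)
  moreover have "(\<lambda>x. - a + x) ` S = (\<lambda>x. x - a) ` S"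
    by (auto simp: image_def)
  ultimately show ?thesis
    using direction_space_basepoint[OF a] by (simp add: dim_span)
qed

lemma direction_space_affine_hull: "direction_space (affine hull S) = direction_space S"
proof
  show "direction_space S \<subseteq> direction_space (affine hull S)"
    by (rule direction_space_mono) (simp add: hull_subset)
  show "direction_space (affine hull S) \<subseteq> direction_space S"
  proof (cases "S = {}")
    case True then show ?thesis by simp
  next
    case False
    then obtain a where a: "a \<in> S" by auto
    show ?thesis
    proof (rule direction_space_least)
      fix x y assume xy: "x \<in> affine hull S" "y \<in> affine hull S"
      have "affine hull S = (+) a ` span ((\<lambda>x. - a + x) ` S)"
        using affine_hull_span_gen[of a S] hull_inc[OF a] by (simp add: image_def)
      moreover have "(\<lambda>x. - a + x) ` S = (\<lambda>x. x - a) ` S"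
        by (auto simp: image_def)
      ultimately have "x - a \<in> direction_space S" "y - a \<in> direction_space S"
        using xy direction_space_basepoint[OF a] by auto
      then have "(x - a) - (y - a) \<in> direction_space S"
        by (rule subspace_diff[OF subspace_direction_space])
      then show "x - y \<in> direction_space S" by simp
    qed simp
  qed
qed

lemma affine_hull_direction_space:
  assumes "a \<in> S" "x - a \<in> direction_space S"
  shows "x \<in> affine hull S"
proof -
  have "affine hull S = (+) a ` span ((\<lambda>x. - a + x) ` S)"
    using affine_hull_span_gen[of a S] hull_inc[OF assms(1)] by (simp add: image_def)
  moreover have "(\<lambda>x. - a + x) ` S = (\<lambda>x. x - a) ` S"
    by (auto simp: image_def)
  ultimately show ?thesis
    using assms direction_space_basepoint[OF assms(1)] by (auto intro!: image_eqI[of _ _ "x - a"])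
qed

section \<open>Faces as maximizers of linear functionals\<close>

definition max_face :: "'a::euclidean_space set \<Rightarrow> 'a \<Rightarrow> 'a set" where
  "max_face P w = {y\<in>P. \<forall>z\<in>P. w \<bullet> z \<le> w \<bullet> y}"

lemma max_face_subset: "max_face P w \<subseteq> P"
  by (auto simp: max_face_def)

lemma max_face_ne:
  assumes "polytope P" "P \<noteq> {}"
  shows "max_face P w \<noteq> {}"
proof -
  have "compact P" using assms by (simp add: polytope_imp_compact)
  moreover have "continuous_on P (\<lambda>x. w \<bullet> x)" by (intro continuous_intros)
  ultimately obtain y where "y \<in> P" "\<forall>z\<in>P. w \<bullet> z \<le> w \<bullet> y"
    using continuous_attains_sup[of P "\<lambda>x. w \<bullet> x"] assms by auto
  then show ?thesis by (auto simp: max_face_def)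
qed

lemma max_face_inner: "x \<in> max_face P w \<Longrightarrow> y \<in> max_face P w \<Longrightarrow> w \<bullet> x = w \<bullet> y"
  by (force simp: max_face_def)

lemma max_face_face_of:
  assumes "convex P"
  shows "max_face P w face_of P"
proof (cases "max_face P w = {}")
  case False
  then obtain y where y: "y \<in> max_face P w" by auto
  then have "max_face P w = P \<inter> {x. w \<bullet> x = w \<bullet> y}"
    by (force simp: max_face_def)
  moreover have "\<dots> face_of P"
    by (rule face_of_Int_supporting_hyperplane_le) (use assms y in \<open>auto simp: max_face_def\<close>)
  ultimately show ?thesis by simp
qed auto

lemma max_face_direction_orth:
  assumes "v \<in> direction_space (max_face P w)"
  shows "w \<bullet> v = 0"
proof -
  have "direction_space (max_face P w) \<subseteq> {v. w \<bullet> v = 0}"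
  proof (rule direction_space_least)
    show "x - y \<in> {v. w \<bullet> v = 0}" if "x \<in> max_face P w" "y \<in> max_face P w" for x y
      using max_face_inner[OF that] by (simp add: inner_diff_right)
  qed (rule subspace_hyperplane)
  then show ?thesis using assms by blast
qed

lemma exposed_as_max_face:
  assumes "polytope P" "F face_of P" "F \<noteq> {}"
  obtains w where "F = max_face P w"
proof -
  have "F exposed_face_of P"
    using assms exposed_face_of_polyhedron polytope_imp_polyhedron by blast
  then obtain a b where ab: "P \<subseteq> {x. a \<bullet> x \<le> b}" "F = P \<inter> {x. a \<bullet> x = b}"
    by (auto simp: exposed_face_of_def)
  obtain f where "f \<in> F" using assms by auto
  then have "F = max_face P a"
    using ab by (fastforce simp: max_face_def)
  then show ?thesis by (rule that)
qed

text \<open>Each passage to a facet lowers the dimension by exactly one; the induction is on the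
  difference \<open>n\<close> of the dimensions.\<close>

lemma polytope_face_of_dim:
  fixes P :: "'a::euclidean_space set"
  assumes "polytope P" "0 \<le> i" "i \<le> aff_dim P"
  obtains F where "F face_of P" "aff_dim F = i"
proof -
  have "\<exists>F. F face_of P \<and> aff_dim F = i" if "aff_dim P = i + int n" "polytope P" for n and P :: "'a set"
    using that
  proof (induction n arbitrary: P)
    case 0
    then show ?case by (intro exI[of _ P]) (auto simp: face_of_refl polytope_imp_convex)
  next
    case (Suc n)
    then have "0 < aff_dim P" using assms by simp
    then obtain F where F: "F facet_of P" using polytope_facet_exists Suc by blast
    then have "polytope F" "aff_dim F = i + int n" "F face_of P"
      using Suc face_of_polytope_polytope by (auto simp: facet_of_def)
    then show ?case using Suc.IH face_of_trans by blast
  qed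
  moreover have "aff_dim P = i + int (nat (aff_dim P - i))" using assms by simp
  ultimately show ?thesis using assms that by blast
qed

text \<open>The same descent through facets, choosing at each stage a facet that still contains
  \<open>e\<close>; there is one as long as \<open>e\<close> is a proper face, which the dimensions
  guarantee.\<close>

lemma face_between_dim:
  fixes P :: "'a::euclidean_space set"
  assumes "polytope P" "e face_of P" "e \<noteq> {}" "aff_dim e \<le> i" "i \<le> aff_dim P"
  obtains F where "F face_of P" "aff_dim F = i" "e \<subseteq> F"
proof -
  have "\<exists>F. F face_of P \<and> aff_dim F = i \<and> e \<subseteq> F"
    if "aff_dim P = i + int n" "polytope P" "e face_of P" for n and P :: "'a set"
    using that
  proof (induction n arbitrary: P)
    case 0
    then show ?case
      by (intro exI[of _ P]) (auto simp: face_of_refl polytope_imp_convex face_of_imp_subset)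
  next
    case (Suc n)
    then have "e \<noteq> P" using assms by auto
    then obtain F where F: "F facet_of P" "e \<subseteq> F"
      using face_of_polyhedron_subset_facet polytope_imp_polyhedron Suc assms by metis
    then have F': "F face_of P" "aff_dim F = i + int n"
      using Suc.prems(1) by (auto simp: facet_of_def)
    moreover have "polytope F" "e face_of F"
      using F' F(2) Suc.prems face_of_polytope_polytope face_of_face by blast+
    ultimately show ?case using Suc.IH face_of_trans by blast
  qed
  moreover have "aff_dim P = i + int (nat (aff_dim P - i))" using assms by simp
  ultimately show ?thesis using assms that by blast
qed

lemma two_face_polytope: "polytope P \<Longrightarrow> two_face P F \<Longrightarrow> polytope F"
  using face_of_polytope_polytope by (auto simp: two_face_def)

lemma two_face_nonempty: "two_face P F \<Longrightarrow> F \<noteq> {}"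
  by (auto simp: two_face_def)

lemma two_face_dim: "two_face P F \<Longrightarrow> dim (direction_space F) = 2"
  using dim_direction_space[of F] two_face_nonempty[of P F] by (simp add: two_face_def)

lemma two_face_of_face: "two_face Q F \<Longrightarrow> Q face_of P \<Longrightarrow> two_face P F"
  using face_of_trans by (auto simp: two_face_def)

lemma two_face_exists:
  assumes "polytope P" "2 \<le> aff_dim P"
  obtains F where "two_face P F"
  using polytope_face_of_dim[of P 2] assms by (auto simp: two_face_def)

lemma edge_in_two_face:
  assumes "polytope P" "2 \<le> aff_dim P" "e edge_of P"
  obtains F where "two_face P F" "e \<subseteq> F"
proof (rule face_between_dim[of P e 2])
  show "e \<noteq> {}" using assms by (auto simp: edge_of_def)
qed (use assms that in \<open>auto simp: edge_of_def two_face_def\<close>)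

text \<open>Induction on the dimension. By the induction hypothesis every facet has its directions
  in \<open>V\<close>, so a functional \<open>w\<close> orthogonal to \<open>V\<close> is constant
  on each facet and takes only finitely many values on the relative boundary. If \<open>w\<close>
  were not constant on \<open>P\<close>, lines inside its level sets would carry a continuum of
  values from the interior out to the boundary.\<close>

lemma direction_space_polytope_2_faces:
  fixes P :: "'a::euclidean_space set"
  assumes "polytope P" "2 \<le> aff_dim P" "subspace V"
    and "\<And>F. two_face P F \<Longrightarrow> direction_space F \<subseteq> V"
  shows "direction_space P \<subseteq> V"
proof -
  have "direction_space P \<subseteq> V"
    if "aff_dim P = 2 + int n" "polytope P" "\<And>F. two_face P F \<Longrightarrow> direction_space F \<subseteq> V" for n and P :: "'a set"
    using that
  proof (induction n arbitrary: P)
    case 0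
    then have "two_face P P" by (simp add: two_face_def face_of_refl polytope_imp_convex)
    then show ?case using 0 by simp
  next
    case (Suc n)
    have facet: "direction_space F \<subseteq> V" if "F facet_of P" for F
    proof (rule Suc.IH)
      show "aff_dim F = 2 + int n"
        using that Suc by (simp add: facet_of_def)
      show "polytope F"
        using that Suc.prems(2) face_of_polytope_polytope facet_of_imp_face_of by blast
      fix G assume "two_face F G"
      then show "direction_space G \<subseteq> V"
        using Suc(4) two_face_of_face that facet_of_def by metis
    qed
    have orth: "direction_space P \<subseteq> {x. w \<bullet> x = 0}" if w: "\<And>v. v \<in> V \<Longrightarrow> w \<bullet> v = 0" for w
    proof (rule ccontr)
      assume "\<not> direction_space P \<subseteq> {x. w \<bullet> x = 0}"
      then obtain x y where xy: "x \<in> P" "y \<in> P" "w \<bullet> (x - y) \<noteq> 0"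
        using direction_space_least[of "{x. w \<bullet> x = 0}" P] by (auto simp: subspace_hyperplane)
      \<comment> \<open>A direction inside the level sets of \<open>w\<close> exists because
        \<open>direction_space P\<close> has dimension at least 3 and one linear equation lowers it
        by at most 1.\<close>
      let ?H = "direction_space P \<inter> {x. w \<bullet> x = 0}"
      have "subspace ?H" by (simp add: subspace_inter subspace_hyperplane)
      have Pne: "P \<noteq> {}" using xy by auto
      then have dP: "int (dim (direction_space P)) = 3 + int n"
        using dim_direction_space[OF Pne] Suc.prems(1) by simp
      have "dim (direction_space P) + dim {x. w \<bullet> x = 0} =
          dim {x + y |x y. x \<in> direction_space P \<and> y \<in> {x. w \<bullet> x = 0}} + dim ?H"
        using dim_sums_Int[of "direction_space P" "{x. w \<bullet> x = 0}"] by (simp add: subspace_hyperplane)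
      moreover have "dim {x. w \<bullet> x = 0} = DIM('a) - 1"
        using xy by (intro dim_hyperplane) auto
      moreover have "dim {x + y |x y. x \<in> direction_space P \<and> y \<in> {x. w \<bullet> x = 0}} \<le> DIM('a)"
        by (rule dim_subset_UNIV)
      ultimately have "dim ?H \<ge> 1" using dP by linarith
      then have "\<not> ?H \<subseteq> {0}"
        by (metis dim_eq_0 not_one_le_zero)
      then obtain d where d: "d \<in> direction_space P" "w \<bullet> d = 0" "d \<noteq> 0"
        by auto
      have fin: "finite ((\<lambda>x. w \<bullet> x) ` rel_frontier P)"
      proof -
        have "(\<lambda>x. w \<bullet> x) ` F \<subseteq> {w \<bullet> (SOME x. x \<in> F)}" if "F facet_of P" for F
        proof
          fix r assume "r \<in> (\<lambda>x. w \<bullet> x) ` F"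
          then obtain x where x: "x \<in> F" "r = w \<bullet> x" by auto
          then have "(SOME x. x \<in> F) \<in> F" by (metis someI)
          then have "x - (SOME x. x \<in> F) \<in> V"
            using x facet[OF that] diff_in_direction_space by blast
          then show "r \<in> {w \<bullet> (SOME x. x \<in> F)}"
            using w[of "x - (SOME x. x \<in> F)"] x by (simp add: inner_diff_right)
        qed
        then have "(\<lambda>x. w \<bullet> x) ` rel_frontier P \<subseteq> (\<lambda>F. w \<bullet> (SOME x. x \<in> F)) ` {F. F facet_of P}"
          using rel_frontier_of_polyhedron[of P] polytope_imp_polyhedron[OF Suc(3)] by fastforce
        then show ?thesis
          using finite_polytope_facets[OF Suc(3)] finite_surj by blast
      qed
      obtain c where c: "c \<in> rel_interior P"
        using Pne rel_interior_eq_empty[OF polytope_imp_convex[OF Suc(3)]] by blast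
      have "w \<bullet> (x - c) \<noteq> 0 \<or> w \<bullet> (y - c) \<noteq> 0"
        using xy(3) by (auto simp: inner_diff_right)
      then obtain z where z: "z \<in> P" "w \<bullet> (z - c) \<noteq> 0"
        using xy by blast
      \<comment> \<open>The points of the segment from \<open>c\<close> to \<open>z\<close>, without
        \<open>z\<close>, are relatively interior; moving from there along \<open>d\<close> keeps
        the value of \<open>w\<close> and ends on the relative boundary.\<close>
      have "w \<bullet> c + t * (w \<bullet> (z - c)) \<in> (\<lambda>x. w \<bullet> x) ` rel_frontier P" if t: "0 \<le> t" "t < 1" for t
      proof -
        define y where "y = c + t *\<^sub>R (z - c)"
        have "y = z - (1 - t) *\<^sub>R (z - c)" by (simp add: y_def algebra_simps)
        moreover have "z \<in> closure P" using z closure_subset by auto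
        ultimately have y: "y \<in> rel_interior P"
          using rel_interior_closure_convex_shrink[of P c z "1 - t"] polytope_imp_convex Suc(3) c t by auto
        have "y \<in> P" using y rel_interior_subset by auto
        have "y + d \<in> affine hull P"
          by (rule affine_hull_direction_space[OF \<open>y \<in> P\<close>]) (use d in simp)
        then obtain s where "0 < s" "y + s *\<^sub>R d \<in> rel_frontier P"
          by (rule ray_to_rel_frontier[OF polytope_imp_bounded[OF Suc(3)] y _ d(3)])
        moreover have "w \<bullet> (y + s *\<^sub>R d) = w \<bullet> c + t * (w \<bullet> (z - c))"
          by (simp add: y_def inner_add_right d)
        ultimately show ?thesis by (metis image_eqI)
      qed
      then have "(\<lambda>t. w \<bullet> c + t * (w \<bullet> (z - c))) ` {0..<1} \<subseteq> (\<lambda>x. w \<bullet> x) ` rel_frontier P"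
        by auto
      then have "finite ((\<lambda>t. w \<bullet> c + t * (w \<bullet> (z - c))) ` {0..<1::real})"
        using fin finite_subset by blast
      moreover have "inj_on (\<lambda>t. w \<bullet> c + t * (w \<bullet> (z - c))) {0..<1::real}"
        using z by (auto simp: inj_on_def)
      ultimately have "finite {0..<1::real}" using finite_imageD by blast
      then show False by (simp add: infinite_Ico)
    qed
    show ?case
    proof
      fix x assume x: "x \<in> direction_space P"
      obtain y z where yz: "y \<in> span V" "\<And>v. v \<in> span V \<Longrightarrow> orthogonal z v" "x = y + z"
        using orthogonal_subspace_decomp_exists by blast
      have "z \<bullet> x = 0"
        using orth[of z] x yz(2) by (auto simp: orthogonal_def span_base)
      then have "z = 0" using yz by (auto simp: inner_add_right orthogonal_def)
      moreover have "span V = V" using assms(3) by (simp add: span_eq_iff)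
      ultimately show "x \<in> V" using yz(1,3) by (metis add.right_neutral)
    qed
  qed
  moreover have "aff_dim P = 2 + int (nat (aff_dim P - 2))" using assms by simp
  ultimately show ?thesis using assms by blast
qed

text \<open>When only one class of 2-faces degenerates, this rules out exposed faces of dimension 3
  or more: their 2-faces would have to span more than the common plane \<open>V\<close>.\<close>

lemma two_face_if_2_faces_parallel:
  fixes P :: "'a::euclidean_space set"
  assumes "polytope P" "Q face_of P" "2 \<le> aff_dim Q" "dim V = 2" "subspace V"
    and "\<And>F. two_face P F \<Longrightarrow> F \<subseteq> Q \<Longrightarrow> direction_space F = V"
  shows "two_face P Q" "direction_space Q = V"
proof -
  have Q: "polytope Q" "Q \<noteq> {}" using assms face_of_polytope_polytope by auto
  have "direction_space Q \<subseteq> V"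
  proof (rule direction_space_polytope_2_faces[OF Q(1) assms(3,5)])
    fix F assume "two_face Q F"
    then show "direction_space F \<subseteq> V"
      using assms two_face_of_face face_of_imp_subset by (metis order_refl two_face_def)
  qed
  then have "dim (direction_space Q) \<le> 2"
    using assms(4) dim_subset by metis
  then have "aff_dim Q = 2" using dim_direction_space[OF Q(2)] assms by linarith
  then show "two_face P Q" using assms by (simp add: two_face_def)
  then show "direction_space Q = V" using assms by auto
qed

subsection \<open>Degenerating 2-faces\<close>

lemma plane_eq_span:
  fixes S :: "'a::euclidean_space set"
  assumes "subspace S" "dim S = 2" "g \<in> S" "g \<noteq> 0" "h \<in> S" "h \<notin> span {g}"
  shows "S = span {g, h}"
proof -
  have "independent {g, h}"
    using assms(4,6) independent_insert[of h "{g}"] by (simp add: insert_commute dependent_single)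
  moreover have "g \<noteq> h" using assms(6) by (auto intro: span_base)
  ultimately have "dim {g, h} = 2" by (simp add: dim_eq_card_independent)
  moreover have "span {g, h} \<subseteq> S" using assms by (intro span_minimal) auto
  ultimately show ?thesis
    using subspace_dim_equal[of "span {g, h}" S] assms by (simp add: dim_span)
qed

lemma plane_basis:
  fixes S :: "'a::euclidean_space set"
  assumes "subspace S" "dim S = 2" "g \<in> S" "g \<noteq> 0"
  obtains h where "h \<in> S" "h \<notin> span {g}" "S = span {g, h}"
proof -
  have "\<not> S \<subseteq> span {g}"
  proof
    assume "S \<subseteq> span {g}"
    then have "dim S \<le> dim {g}" using dim_subset[of S "span {g}"] by (simp only: dim_span)
    also have "\<dots> \<le> card {g}" by (rule dim_le_card) (auto intro: span_base)
    finally show False using assms by simp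
  qed
  then show ?thesis using that plane_eq_span[OF assms] by blast
qed

text \<open>A single linear equation has a nonzero solution in a plane. Applied to the second basis
  functional of a plane \<open>W\<close>, it yields a degenerating direction in every 2-face on
  which the first one is constant.\<close>

lemma plane_orth_vector:
  fixes S :: "'a::euclidean_space set"
  assumes "subspace S" "dim S = 2"
  obtains g where "g \<in> S" "g \<noteq> 0" "w \<bullet> g = 0"
proof -
  have "S \<noteq> {0}" using assms dim_eq_0[of S] by fastforce
  then obtain a where a: "a \<in> S" "a \<noteq> 0" using assms subspace_0 by blast
  then obtain b where b: "b \<in> S" "b \<notin> span {a}" using plane_basis assms by metis
  show ?thesis
  proof (cases "w \<bullet> a = 0")
    case True then show ?thesis using a that by blast
  next
    case False
    let ?g = "(w \<bullet> a) *\<^sub>R b - (w \<bullet> b) *\<^sub>R a"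
    have "?g \<noteq> 0"
    proof
      assume "?g = 0"
      then have "b = ((w \<bullet> b) / (w \<bullet> a)) *\<^sub>R a"
        using False by (simp add: eq_vector_fraction_iff)
      then show False using b by (metis span_base span_mul singletonI)
    qed
    moreover have "?g \<in> S" using a b assms by (simp add: subspace_diff subspace_scale)
    moreover have "w \<bullet> ?g = 0" by (simp add: inner_diff_right)
    ultimately show ?thesis using that by blast
  qed
qed

lemma orth_proj_eqI:
  assumes "subspace W" "y \<in> W" "\<And>w. w \<in> W \<Longrightarrow> orthogonal (x - y) w"
  shows "orth_proj W x = y"
proof -
  let ?d = "orth_proj W x - y"
  have "?d \<in> W" using assms(1,2) orth_proj(1) subspace_diff by blast
  then have "(x - y) \<bullet> ?d = 0" "(x - orth_proj W x) \<bullet> ?d = 0"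
    using assms(3) orth_proj(2)[OF assms(1)] by (auto simp: orthogonal_def)
  then have "?d \<bullet> ?d = 0" by (simp add: inner_diff_left)
  then show ?thesis by simp
qed

lemma inner_orth_proj:
  assumes "subspace W" "w \<in> W"
  shows "w \<bullet> orth_proj W x = w \<bullet> x"
  using orth_proj(2)[OF assms, of x] by (simp add: orthogonal_def inner_diff_left inner_diff_right inner_commute[of w])

lemma linear_orth_proj:
  assumes "subspace W"
  shows "linear (orth_proj W)"
proof
  fix x y :: 'a and r :: real
  note inner = inner_orth_proj[OF assms]
  show "orth_proj W (x + y) = orth_proj W x + orth_proj W y"
  proof (rule orth_proj_eqI[OF assms])
    show "orth_proj W x + orth_proj W y \<in> W"
      using orth_proj(1) assms subspace_add by blast
    show "orthogonal (x + y - (orth_proj W x + orth_proj W y)) w" if "w \<in> W" for w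
      using inner[OF that] unfolding orthogonal_def
      by (subst inner_commute) (simp add: inner_diff_right inner_add_right)
  qed
  show "orth_proj W (r *\<^sub>R x) = r *\<^sub>R orth_proj W x"
  proof (rule orth_proj_eqI[OF assms])
    show "r *\<^sub>R orth_proj W x \<in> W"
      using orth_proj(1) assms subspace_scale by blast
    show "orthogonal (r *\<^sub>R x - r *\<^sub>R orth_proj W x) w" if "w \<in> W" for w
      using inner[OF that] unfolding orthogonal_def
      by (subst inner_commute) (simp add: inner_diff_right)
  qed
qed

lemma orth_proj_eq_iff:
  assumes "subspace W"
  shows "orth_proj W x = orth_proj W y \<longleftrightarrow> (\<forall>w\<in>W. w \<bullet> x = w \<bullet> y)"
proof
  show "orth_proj W x = orth_proj W y \<Longrightarrow> \<forall>w\<in>W. w \<bullet> x = w \<bullet> y"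
    using inner_orth_proj[OF assms] by metis
  assume *: "\<forall>w\<in>W. w \<bullet> x = w \<bullet> y"
  show "orth_proj W x = orth_proj W y"
  proof (rule orth_proj_eqI[OF assms])
    show "orth_proj W y \<in> W" using orth_proj(1) assms by blast
    show "orthogonal (x - orth_proj W y) w" if "w \<in> W" for w
      using inner_orth_proj[OF assms that] * that unfolding orthogonal_def
      by (subst inner_commute) (simp add: inner_diff_right)
  qed
qed

text \<open>A collinear image means that the projection is not injective on the direction plane.
  Conversely, a kernel vector \<open>g\<close> leaves only multiples of the image of a complementary
  \<open>h\<close>. Degeneration is thereby reduced to inner products with functionals in
  \<open>W\<close>.\<close>

lemma degenerating_iff:
  assumes W: "subspace W" and F: "dim (direction_space F) = 2"
  shows "degenerating W F \<longleftrightarrow> (\<exists>g\<in>direction_space F. g \<noteq> 0 \<and> (\<forall>w\<in>W. w \<bullet> g = 0))"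
proof
  let ?p = "orth_proj W"
  interpret p: linear ?p using W by (rule linear_orth_proj)
  have zero: "?p g = 0 \<longleftrightarrow> (\<forall>w\<in>W. w \<bullet> g = 0)" for g
    using orth_proj_eq_iff[OF W, of g 0] p.zero by simp
  {
    assume "degenerating W F"
    then obtain u where u: "\<And>x y. x \<in> F \<Longrightarrow> y \<in> F \<Longrightarrow> \<exists>c. ?p x - ?p y = c *\<^sub>R u"
      by (auto simp: degenerating_def collinear_def)
    have sub: "?p ` direction_space F \<subseteq> span {u}"
    proof -
      have "direction_space F \<subseteq> {x. ?p x \<in> span {u}}"
      proof (rule direction_space_least)
        show "subspace {x. ?p x \<in> span {u}}"
          using linear_subspace_vimage[OF p.linear_axioms subspace_span[of "{u}"]] by (simp add: vimage_def)
      qed (use u in \<open>fastforce simp: p.diff span_singleton\<close>)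
      then show ?thesis by auto
    qed
    have "\<not> inj_on ?p (direction_space F)"
    proof
      assume "inj_on ?p (direction_space F)"
      then have "dim (?p ` direction_space F) = dim (direction_space F)"
        by (intro dim_image_eq p.linear_axioms) (simp add: span_eq_iff[THEN iffD2])
      moreover have "dim (?p ` direction_space F) \<le> dim (span {u})" using sub by (rule dim_subset)
      moreover have "dim (span {u}) \<le> card {u}" unfolding dim_span by (rule dim_le_card) (auto intro: span_base)
      ultimately show False using F by simp
    qed
    then show "\<exists>g\<in>direction_space F. g \<noteq> 0 \<and> (\<forall>w\<in>W. w \<bullet> g = 0)"
      using linear_injective_on_subspace_0[OF p.linear_axioms subspace_direction_space] zero by blast
  next
    assume "\<exists>g\<in>direction_space F. g \<noteq> 0 \<and> (\<forall>w\<in>W. w \<bullet> g = 0)"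
    then obtain g where g: "g \<in> direction_space F" "g \<noteq> 0" "?p g = 0" using zero by blast
    then obtain h where h: "direction_space F = span {g, h}"
      using plane_basis[OF subspace_direction_space F] by metis
    have "\<exists>c. ?p x - ?p y = c *\<^sub>R ?p h" if "x \<in> F" "y \<in> F" for x y
    proof -
      have "x - y \<in> span {g, h}" using diff_in_direction_space[OF that] h by simp
      then obtain a where "x - y - a *\<^sub>R g \<in> span {h}" by (auto simp: span_insert)
      then obtain b where "x - y - a *\<^sub>R g = b *\<^sub>R h" by (auto simp: span_singleton)
      then have "x - y = a *\<^sub>R g + b *\<^sub>R h" by (simp add: algebra_simps)
      then have "?p (x - y) = ?p (a *\<^sub>R g + b *\<^sub>R h)" by (rule arg_cong)
      then have "?p x - ?p y = b *\<^sub>R ?p h"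
        using g(3) by (simp add: p.diff p.add p.scale)
      then show ?thesis by blast
    qed
    then show "degenerating W F" by (auto simp: degenerating_def collinear_def)
  }
qed

lemma degenerating_class_iff:
  assumes W: "subspace W" and F: "two_face P F"
  shows "degenerating_class W (face_class P F) \<longleftrightarrow> degenerating W F"
proof -
  have "degenerating W G \<longleftrightarrow> degenerating W F" if "G \<in> face_class P F" for G
    using that F degenerating_iff[OF W two_face_dim, of P]
    by (auto simp: face_class_def parallel_faces_def)
  moreover have "F \<in> face_class P F" using F by (simp add: face_class_def parallel_faces_def)
  ultimately show ?thesis unfolding degenerating_class_def by blast
qed

lemma face_class_eq_iff:
  assumes "two_face P F" "two_face P G"
  shows "face_class P F = face_class P G \<longleftrightarrow> direction_space F = direction_space G"
  using assms by (auto simp: face_class_def parallel_faces_def)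

lemma admissible_iff:
  "admissible P W \<longleftrightarrow> linear_plane W \<and>
     (\<forall>F g. two_face P F \<longrightarrow> g \<in> direction_space F \<longrightarrow> g \<noteq> 0 \<longrightarrow> (\<exists>w\<in>W. w \<bullet> g \<noteq> 0))"
proof (cases "linear_plane W")
  case True
  then have W: "subspace W" by (simp add: linear_plane_def)
  have "(\<forall>C\<in>face_classes P. \<not> degenerating_class W C) \<longleftrightarrow> (\<forall>F. two_face P F \<longrightarrow> \<not> degenerating W F)"
    using degenerating_class_iff[OF W, of P] unfolding face_classes_def by blast
  also have "\<dots> \<longleftrightarrow> (\<forall>F g. two_face P F \<longrightarrow> g \<in> direction_space F \<longrightarrow> g \<noteq> 0 \<longrightarrow> (\<exists>w\<in>W. w \<bullet> g \<noteq> 0))"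
    using degenerating_iff[OF W two_face_dim, of P] by blast
  finally show ?thesis using True by (simp add: admissible_def)
qed (simp add: admissible_def)

lemma only_degenerating_iff:
  assumes W: "subspace W" and F: "two_face P F"
  shows "only_degenerating P W F \<longleftrightarrow>
    (\<forall>G. two_face P G \<longrightarrow> ((\<exists>g\<in>direction_space G. g \<noteq> 0 \<and> (\<forall>w\<in>W. w \<bullet> g = 0)) \<longleftrightarrow>
       direction_space G = direction_space F))"
proof -
  have "only_degenerating P W F \<longleftrightarrow>
    (\<forall>G. two_face P G \<longrightarrow> (degenerating_class W (face_class P G) \<longleftrightarrow> face_class P G = face_class P F))"
    by (auto simp: only_degenerating_def face_classes_def)
  also have "\<dots> \<longleftrightarrow> (\<forall>G. two_face P G \<longrightarrow> (degenerating W G \<longleftrightarrow> direction_space G = direction_space F))"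
    using degenerating_class_iff[OF W] face_class_eq_iff[OF _ F] by blast
  also have "\<dots> \<longleftrightarrow> (\<forall>G. two_face P G \<longrightarrow> ((\<exists>g\<in>direction_space G. g \<noteq> 0 \<and> (\<forall>w\<in>W. w \<bullet> g = 0)) \<longleftrightarrow>
       direction_space G = direction_space F))"
    using degenerating_iff[OF W two_face_dim] by blast
  finally show ?thesis .
qed

lemma span_pair: "x \<in> span {a, b} \<longleftrightarrow> (\<exists>s t. x = s *\<^sub>R a + t *\<^sub>R b)"
proof
  assume "x \<in> span {a, b}"
  then obtain s where "x - s *\<^sub>R a \<in> span {b}" by (auto simp: span_insert)
  then obtain t where "x - s *\<^sub>R a = t *\<^sub>R b" by (auto simp: span_singleton)
  then have "x = s *\<^sub>R a + t *\<^sub>R b" by (simp add: algebra_simps)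
  then show "\<exists>s t. x = s *\<^sub>R a + t *\<^sub>R b" by blast
qed (auto intro!: span_add span_mul intro: span_base)

section \<open>Vertices and edges of polytopes\<close>

lemma finite_extreme_points:
  fixes P :: "'a::euclidean_space set"
  shows "polytope P \<Longrightarrow> finite {v. v extreme_point_of P}"
  by (simp add: finite_polyhedron_extreme_points polytope_imp_polyhedron)

lemma polytope_eq_hull:
  fixes P :: "'a::euclidean_space set"
  shows "polytope P \<Longrightarrow> P = convex hull {v. v extreme_point_of P}"
  by (rule Krein_Milman_Minkowski) (auto simp: polytope_imp_compact polytope_imp_convex)

text \<open>The maximal face is the convex hull of its own vertices, and strictness leaves only
  those in \<open>T\<close>.\<close>

lemma polytope_strict_max:
  fixes w :: "'a::euclidean_space"
  assumes "polytope P" "P \<noteq> {}" "T \<subseteq> {v. v extreme_point_of P}" "T \<noteq> {}"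
    "\<And>t t'. t \<in> T \<Longrightarrow> t' \<in> T \<Longrightarrow> w \<bullet> t = w \<bullet> t'"
    "\<And>v t. v extreme_point_of P \<Longrightarrow> v \<notin> T \<Longrightarrow> t \<in> T \<Longrightarrow> w \<bullet> v < w \<bullet> t"
  shows "max_face P w = convex hull T"
proof -
  let ?F = "max_face P w"
  have face: "?F face_of P" using assms polytope_imp_convex max_face_face_of by blast
  have pF: "polytope ?F" using face assms face_of_polytope_polytope by blast
  have ext: "{v. v extreme_point_of ?F} = {v. v extreme_point_of P \<and> v \<in> ?F}"
    using extreme_point_of_face[OF face] by auto
  have ne: "?F \<noteq> {}" using assms max_face_ne by blast
  then obtain v where v: "v extreme_point_of ?F"
    using pF extreme_point_exists_convex polytope_imp_compact polytope_imp_convex by blast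
  then have v': "v extreme_point_of P" "v \<in> ?F" using ext by auto
  obtain t where t: "t \<in> T" using assms(4) by auto
  have tP: "t \<in> P" if "t \<in> T" for t using assms(3) that by (auto simp: extreme_point_of_def)
  have inT: "u \<in> T" if "u extreme_point_of P" "u \<in> ?F" for u
  proof (rule ccontr)
    assume "u \<notin> T"
    then have "w \<bullet> u < w \<bullet> t" using assms(6) that t by blast
    then show False using that(2) tP[OF t] by (auto simp: max_face_def)
  qed
  have "T \<subseteq> ?F"
  proof
    fix s assume s: "s \<in> T"
    have "w \<bullet> s = w \<bullet> v" using assms(5)[OF s] inT v' by blast
    then show "s \<in> ?F" using v'(2) tP[OF s] by (auto simp: max_face_def)
  qed
  then have "{v. v extreme_point_of ?F} = T" using inT ext assms(3) by auto
  then show ?thesis using polytope_eq_hull[OF pF] by simp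
qed

lemma edge_endpoints:
  assumes "polytope P" "e edge_of P"
  obtains p q where "p \<noteq> q" "e = closed_segment p q" "p extreme_point_of P" "q extreme_point_of P"
proof -
  have e: "e face_of P" "aff_dim e = 1" using assms by (auto simp: edge_of_def)
  then have "polytope e" "e \<noteq> {}" using assms face_of_polytope_polytope by auto
  moreover have "collinear e" using e by (simp add: collinear_aff_dim)
  ultimately obtain p q where pq: "e = closed_segment p q"
    using compact_convex_collinear_segment[of e] polytope_imp_compact polytope_imp_convex by metis
  moreover have "p \<noteq> q" using e pq by auto
  moreover have "p extreme_point_of e" "q extreme_point_of e"
    using pq by (auto simp: extreme_point_of_segment)
  ultimately show ?thesis using that extreme_point_of_face[OF e(1)] by blast
qed

lemma edge_segment:
  assumes "polytope P" "closed_segment p q edge_of P"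
  shows "p \<noteq> q" "p extreme_point_of P" "q extreme_point_of P" "p \<in> P" "q \<in> P"
proof -
  have e: "closed_segment p q face_of P" "aff_dim (closed_segment p q) = 1" using assms by (auto simp: edge_of_def)
  then show "p \<noteq> q" by auto
  show "p extreme_point_of P" "q extreme_point_of P"
    using extreme_point_of_face[OF e(1)] by (auto simp: extreme_point_of_segment)
  then show "p \<in> P" "q \<in> P" by (auto simp: extreme_point_of_def)
qed

lemma direction_space_segment: "direction_space (closed_segment p q) = span {q - p}"
proof -
  have "direction_space (closed_segment p q) = direction_space {p, q}"
    using direction_space_affine_hull[of "closed_segment p q"] direction_space_affine_hull[of "{p, q}"]
    by (simp add: segment_convex_hull affine_hull_convex_hull)
  also have "\<dots> = span ((\<lambda>x. x - p) ` {p, q})" by (rule direction_space_basepoint) simp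
  also have "(\<lambda>x. x - p) ` {p, q} = {0, q - p}" by auto
  finally show ?thesis by (simp add: span_insert_0)
qed

subsection \<open>Counting the vertices of a projection\<close>

locale full_polytope =
  fixes P :: "'a::euclidean_space set"
  assumes poly: "polytope P" and full: "aff_dim P = int DIM('a)" and dim3: "3 \<le> DIM('a)"
begin

lemma P_ne: "P \<noteq> {}"
  using full dim3 by auto

lemma convex_P: "convex P"
  using poly polytope_imp_convex by blast

definition generic :: "'a \<Rightarrow> bool" where
  "generic m \<longleftrightarrow> (\<forall>p q. closed_segment p q edge_of P \<longrightarrow> m \<bullet> (q - p) \<noteq> 0)"

text \<open>The functional \<open>n + \<beta> m\<close> that takes the same value at \<open>p\<close> and \<open>q\<close>.\<close>

definition lam :: "'a \<Rightarrow> 'a \<Rightarrow> 'a \<Rightarrow> 'a \<Rightarrow> 'a" where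
  "lam m n p q = n - ((n \<bullet> (q - p)) / (m \<bullet> (q - p))) *\<^sub>R m"

text \<open>The strict inequality selects one of the two ordered pairs that describe an edge, so
  counting pairs counts edges.\<close>

definition up_edges :: "'a \<Rightarrow> ('a \<times> 'a) set" where
  "up_edges m = {(p, q). closed_segment p q edge_of P \<and> m \<bullet> p < m \<bullet> q}"

text \<open>For an edge not orthogonal to \<open>m\<close> this says that the edge is the whole face
  maximizing \<open>lam m n p q\<close>. Written as finitely many strict inequalities, the condition
  is accessible to perturbation of \<open>n\<close>.\<close>

definition vis :: "'a \<Rightarrow> 'a \<Rightarrow> 'a \<Rightarrow> 'a \<Rightarrow> bool" where
  "vis m n p q \<longleftrightarrow>
    (\<forall>v. v extreme_point_of P \<longrightarrow> v \<noteq> p \<longrightarrow> v \<noteq> q \<longrightarrow> lam m n p q \<bullet> (v - p) < 0)"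

definition vis_edges :: "'a \<Rightarrow> 'a \<Rightarrow> ('a \<times> 'a) set" where
  "vis_edges m n = {(p, q) \<in> up_edges m. vis m n p q}"

definition smax :: "'a \<Rightarrow> 'a \<Rightarrow> bool" where
  "smax w v \<longleftrightarrow> v extreme_point_of P \<and>
    (\<forall>u. u extreme_point_of P \<longrightarrow> u \<noteq> v \<longrightarrow> w \<bullet> u < w \<bullet> v)"

lemma smax_unique: "smax w u \<Longrightarrow> smax w v \<Longrightarrow> u = v"
  unfolding smax_def by (metis less_asym)

lemma finite_verts: "finite {v. v extreme_point_of P}"
  using finite_extreme_points poly by blast

lemma finite_up_edges: "finite (up_edges m)"
proof -
  have "up_edges m \<subseteq> {v. v extreme_point_of P} \<times> {v. v extreme_point_of P}"
    using edge_segment[OF poly] by (auto simp: up_edges_def)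
  then show ?thesis using finite_verts finite_subset by blast
qed

lemma smax_max_face: "smax w v \<longleftrightarrow> max_face P w = {v}"
proof
  assume v: "smax w v"
  have "max_face P w = convex hull {v}"
    by (rule polytope_strict_max[OF poly P_ne]) (use v in \<open>auto simp: smax_def\<close>)
  then show "max_face P w = {v}" by simp
next
  assume *: "max_face P w = {v}"
  then have "{v} face_of P" using max_face_face_of[OF convex_P] by metis
  then have "v extreme_point_of P" by (simp add: face_of_singleton)
  moreover have "w \<bullet> u < w \<bullet> v" if "u extreme_point_of P" "u \<noteq> v" for u
  proof (rule ccontr)
    assume n: "\<not> w \<bullet> u < w \<bullet> v"
    have "u \<in> P" using that by (simp add: extreme_point_of_def)
    moreover have "v \<in> max_face P w" using * by simp
    ultimately have "u \<in> max_face P w" using n unfolding max_face_def by force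
    then show False using * that by simp
  qed
  ultimately show "smax w v" by (simp add: smax_def)
qed

lemma in_max_faceI:
  assumes "v \<in> P" "\<And>u. u extreme_point_of P \<Longrightarrow> w \<bullet> u \<le> w \<bullet> v"
  shows "v \<in> max_face P w"
proof -
  have "convex hull {u. u extreme_point_of P} \<subseteq> {x. w \<bullet> x \<le> w \<bullet> v}"
    using assms(2) by (intro hull_minimal) (auto simp: convex_halfspace_le)
  then have "P \<subseteq> {x. w \<bullet> x \<le> w \<bullet> v}" using polytope_eq_hull[OF poly] by simp
  then show ?thesis using assms(1) by (auto simp: max_face_def)
qed

lemma polytope_max_face: "polytope (max_face P w)"
  using max_face_face_of[OF convex_P] poly face_of_polytope_polytope by blast

lemma max_face_nonempty: "max_face P w \<noteq> {}"
  using max_face_ne poly P_ne by blast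

lemma max_face_cases:
  assumes "aff_dim (max_face P w) \<le> 1"
  obtains v where "smax w v"
  | p q where "max_face P w = closed_segment p q" "closed_segment p q edge_of P"
proof (cases "aff_dim (max_face P w) = 1")
  case True
  then have e: "max_face P w edge_of P"
    using max_face_face_of[OF convex_P] by (simp add: edge_of_def)
  then obtain p q where "max_face P w = closed_segment p q" using edge_endpoints[OF poly] by metis
  then show ?thesis using that e by metis
next
  case False
  then have "aff_dim (max_face P w) = 0"
    using assms max_face_nonempty[of w] False aff_dim_geq[of "max_face P w"] aff_dim_empty[of "max_face P w"]
    by linarith
  then obtain v where "max_face P w = {v}" by (auto simp: aff_dim_eq_0)
  then show ?thesis using that smax_max_face by blast
qed

text \<open>A maximal face of positive dimension would contain an edge of \<open>P\<close> on which
  \<open>m\<close> is constant.\<close>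

lemma generic_smax:
  assumes "generic m"
  obtains v where "smax m v"
proof -
  have "\<not> 1 \<le> aff_dim (max_face P m)"
  proof
    assume "1 \<le> aff_dim (max_face P m)"
    then obtain e where e: "e face_of max_face P m" "aff_dim e = 1"
      using polytope_face_of_dim[OF polytope_max_face, of 1 m] by auto
    then have "e edge_of P" using max_face_face_of[OF convex_P] face_of_trans by (auto simp: edge_of_def)
    then obtain p q where pq: "e = closed_segment p q" "closed_segment p q edge_of P"
      using edge_endpoints[OF poly] by metis
    then have "p \<in> max_face P m" "q \<in> max_face P m"
      using face_of_imp_subset[OF e(1)] by auto
    then have "m \<bullet> (q - p) = 0" using max_face_inner by (simp add: inner_diff_right) blast
    then show False using assms pq by (simp add: generic_def)
  qed
  then have le: "aff_dim (max_face P m) \<le> 0" by simp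
  show ?thesis
  proof (rule max_face_cases[of m])
    show "aff_dim (max_face P m) \<le> 1" using le by simp
    fix p q assume "max_face P m = closed_segment p q" "closed_segment p q edge_of P"
    then show thesis using le by (simp add: edge_of_def)
  qed (rule that)
qed

text \<open>A larger face would contain a 2-face on which \<open>w\<close> is constant; a vector in
  its direction plane that the other generator of \<open>W\<close> kills as well would make this
  2-face degenerate.\<close>

lemma admissible_max_face:
  assumes "admissible P W" "w \<in> W" "w \<noteq> 0"
  shows "aff_dim (max_face P w) \<le> 1"
proof (rule ccontr)
  assume "\<not> aff_dim (max_face P w) \<le> 1"
  then obtain G where G: "two_face (max_face P w) G"
    using two_face_exists[OF polytope_max_face, of w] by force
  then have G': "two_face P G" using two_face_of_face max_face_face_of[OF convex_P] by blast
  have W: "subspace W" "dim W = 2" using assms by (auto simp: admissible_iff linear_plane_def)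
  then obtain w' where w': "W = span {w, w'}" using plane_basis[of W w] assms by metis
  obtain g where g: "g \<in> direction_space G" "g \<noteq> 0" "w' \<bullet> g = 0"
    using plane_orth_vector[OF subspace_direction_space two_face_dim[OF G']] by metis
  have "direction_space G \<subseteq> direction_space (max_face P w)"
    using G by (intro direction_space_mono) (auto simp: two_face_def face_of_imp_subset)
  then have "w \<bullet> g = 0" using g max_face_direction_orth by blast
  then have "\<forall>u\<in>W. u \<bullet> g = 0"
    using g w' by (auto simp: span_pair inner_add_left)
  then show False using assms(1) G' g by (auto simp: admissible_iff)
qed

lemma plane_independent:
  fixes n m :: 'a
  assumes "linear_plane (span {n, m})" "a *\<^sub>R n + b *\<^sub>R m = 0"
  shows "a = 0 \<and> b = 0"
proof (rule ccontr)
  assume *: "\<not> ?thesis"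
  have "\<exists>u. span {n, m} \<subseteq> span {u}"
  proof (cases "a = 0")
    case True
    then have "m = 0" using * assms(2) by auto
    then show ?thesis by (intro exI[of _ n]) (simp add: insert_commute span_insert_0)
  next
    case False
    have "a *\<^sub>R n = (- b) *\<^sub>R m"
      using assms(2) eq_neg_iff_add_eq_0[of "a *\<^sub>R n" "b *\<^sub>R m"] by simp
    then have "n = (- b / a) *\<^sub>R m"
      using False by (simp only: eq_vector_fraction_iff if_False)
    then have "n \<in> span {m}" by (metis span_base span_mul singletonI)
    then show ?thesis by (intro exI[of _ m] span_minimal) (auto intro: span_base)
  qed
  then obtain u where "span {n, m} \<subseteq> span {u}" by blast
  then have "dim (span {n, m}) \<le> dim {u}" using dim_subset[of "span {n, m}" "span {u}"] by (simp only: dim_span)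
  also have "\<dots> \<le> card {u}" by (rule dim_le_card) (auto intro: span_base)
  finally show False using assms(1) by (simp add: linear_plane_def)
qed

lemma lam_orth:
  assumes "m \<bullet> (q - p) \<noteq> 0"
  shows "lam m n p q \<bullet> p = lam m n p q \<bullet> q"
proof -
  have "lam m n p q \<bullet> (q - p) = 0"
    using assms by (simp add: lam_def inner_diff_left)
  then show ?thesis by (simp add: inner_diff_right)
qed

text \<open>For large \<beta> the functional is dominated by \<open>m\<close>, and only finitely
  many vertices compete.\<close>

lemma smax_large:
  assumes "smax m v"
  obtains \<beta> where "smax (n + \<beta> *\<^sub>R m) v"
proof -
  have "eventually (\<lambda>\<beta>. (n + \<beta> *\<^sub>R m) \<bullet> u < (n + \<beta> *\<^sub>R m) \<bullet> v) at_top"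
    if "u \<in> {u. u extreme_point_of P} - {v}" for u
  proof -
    have "m \<bullet> u < m \<bullet> v" using that assms by (simp add: smax_def)
    then show ?thesis
      by (intro eventually_mono[OF eventually_gt_at_top[of "(n \<bullet> u - n \<bullet> v) / (m \<bullet> v - m \<bullet> u)"]])
        (simp add: field_simps inner_add_left)
  qed
  then have "eventually (\<lambda>\<beta>. \<forall>u\<in>{u. u extreme_point_of P} - {v}. (n + \<beta> *\<^sub>R m) \<bullet> u < (n + \<beta> *\<^sub>R m) \<bullet> v) at_top"
    using finite_verts by (intro eventually_ball_finite) auto
  then obtain \<beta> where "\<forall>u\<in>{u. u extreme_point_of P} - {v}. (n + \<beta> *\<^sub>R m) \<bullet> u < (n + \<beta> *\<^sub>R m) \<bullet> v"
    using eventually_happens[of _ at_top] trivial_limit_at_top_linorder by blast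
  then have "smax (n + \<beta> *\<^sub>R m) v" using assms by (auto simp: smax_def)
  then show ?thesis by (rule that)
qed

text \<open>For an admissible plane and a generic \<open>m\<close>, these vertices project to one of
  the two boundary arcs between the \<open>m\<close>-lowest and the \<open>m\<close>-highest vertex
  of the projection, both ends included.\<close>

definition upper :: "'a \<Rightarrow> 'a \<Rightarrow> 'a set" where
  "upper m n = {v. \<exists>\<beta>. smax (n + \<beta> *\<^sub>R m) v}"

lemma vis_edgesD:
  assumes "(p, q) \<in> vis_edges m n"
  obtains \<beta> where "lam m n p q = n + \<beta> *\<^sub>R m" "m \<bullet> p < m \<bullet> q"
    "(n + \<beta> *\<^sub>R m) \<bullet> p = (n + \<beta> *\<^sub>R m) \<bullet> q" "p extreme_point_of P" "q extreme_point_of P" "p \<noteq> q"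
    "\<And>v. v extreme_point_of P \<Longrightarrow> v \<noteq> p \<Longrightarrow> v \<noteq> q \<Longrightarrow> (n + \<beta> *\<^sub>R m) \<bullet> v < (n + \<beta> *\<^sub>R m) \<bullet> p"
proof -
  define \<beta> where "\<beta> = - ((n \<bullet> (q - p)) / (m \<bullet> (q - p)))"
  have l: "lam m n p q = n + \<beta> *\<^sub>R m" by (simp add: lam_def \<beta>_def)
  have e: "closed_segment p q edge_of P" "m \<bullet> p < m \<bullet> q" "vis m n p q"
    using assms by (auto simp: vis_edges_def up_edges_def)
  show ?thesis
  proof (rule that[OF l e(2)])
    show "(n + \<beta> *\<^sub>R m) \<bullet> p = (n + \<beta> *\<^sub>R m) \<bullet> q"
      using lam_orth[of m q p n] e(2) l by (simp add: inner_diff_right)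
    fix v assume "v extreme_point_of P" "v \<noteq> p" "v \<noteq> q"
    then show "(n + \<beta> *\<^sub>R m) \<bullet> v < (n + \<beta> *\<^sub>R m) \<bullet> p"
      using e(3) l by (simp add: vis_def inner_diff_right)
  qed (use edge_segment[OF poly e(1)] in auto)
qed

text \<open>As \<beta> increases, the maximizing vertex climbs along an arc that ends at
  \<open>tp\<close>. Every vertex of the arc except \<open>tp\<close> is left through exactly one
  visible edge, of which it is the lower end.\<close>

lemma upper_chain:
  assumes adm: "admissible P (span {n, m})" and tp: "smax m tp"
  shows "bij_betw fst (vis_edges m n) (upper m n - {tp})"
proof (rule bij_betw_imageI)
  show "inj_on fst (vis_edges m n)"
  proof (rule inj_onI, clarsimp)
    fix p q q' assume a: "(p, q) \<in> vis_edges m n" and b: "(p, q') \<in> vis_edges m n"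
    obtain \<beta> where \<beta>: "m \<bullet> p < m \<bullet> q" "(n + \<beta> *\<^sub>R m) \<bullet> p = (n + \<beta> *\<^sub>R m) \<bullet> q" "q extreme_point_of P" "p \<noteq> q"
      "\<And>v. v extreme_point_of P \<Longrightarrow> v \<noteq> p \<Longrightarrow> v \<noteq> q \<Longrightarrow> (n + \<beta> *\<^sub>R m) \<bullet> v < (n + \<beta> *\<^sub>R m) \<bullet> p"
      by (rule vis_edgesD[OF a]) blast
    obtain \<beta>' where \<beta>': "m \<bullet> p < m \<bullet> q'" "(n + \<beta>' *\<^sub>R m) \<bullet> p = (n + \<beta>' *\<^sub>R m) \<bullet> q'" "q' extreme_point_of P" "p \<noteq> q'"
      "\<And>v. v extreme_point_of P \<Longrightarrow> v \<noteq> p \<Longrightarrow> v \<noteq> q' \<Longrightarrow> (n + \<beta>' *\<^sub>R m) \<bullet> v < (n + \<beta>' *\<^sub>R m) \<bullet> p"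
      by (rule vis_edgesD[OF b]) blast
    show "q = q'"
    proof (rule ccontr)
      assume ne: "q \<noteq> q'"
      \<comment> \<open>Comparing each of the two edges with the far end of the other forces both
        \<beta> < \<beta>' and \<beta>' < \<beta>.\<close>
      have 1: "(n + \<beta> *\<^sub>R m) \<bullet> q' < (n + \<beta> *\<^sub>R m) \<bullet> p" using \<beta>(5)[OF \<beta>'(3)] \<beta>'(4) ne by auto
      have 2: "(n + \<beta>' *\<^sub>R m) \<bullet> q < (n + \<beta>' *\<^sub>R m) \<bullet> p" using \<beta>'(5)[OF \<beta>(3)] \<beta>(4) ne by auto
      have "0 < (\<beta>' - \<beta>) * (m \<bullet> q' - m \<bullet> p)"
        using 1 \<beta>'(2) by (simp add: inner_add_left algebra_simps)
      then have "\<beta>' > \<beta>" using \<beta>'(1) by (simp add: zero_less_mult_iff)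
      moreover have "0 < (\<beta> - \<beta>') * (m \<bullet> q - m \<bullet> p)"
        using 2 \<beta>(2) by (simp add: inner_add_left algebra_simps)
      then have "\<beta> > \<beta>'" using \<beta>(1) by (simp add: zero_less_mult_iff)
      ultimately show False by simp
    qed
  qed
  show "fst ` vis_edges m n = upper m n - {tp}"
  proof (intro equalityI subsetI)
    fix p assume "p \<in> fst ` vis_edges m n"
    then obtain q where a: "(p, q) \<in> vis_edges m n" by force
    obtain \<beta> where \<beta>: "m \<bullet> p < m \<bullet> q" "(n + \<beta> *\<^sub>R m) \<bullet> p = (n + \<beta> *\<^sub>R m) \<bullet> q" "p extreme_point_of P" "q extreme_point_of P" "p \<noteq> q"
      "\<And>v. v extreme_point_of P \<Longrightarrow> v \<noteq> p \<Longrightarrow> v \<noteq> q \<Longrightarrow> (n + \<beta> *\<^sub>R m) \<bullet> v < (n + \<beta> *\<^sub>R m) \<bullet> p"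
      by (rule vis_edgesD[OF a]) blast
    \<comment> \<open>Just below the value \<beta> at which \<open>p\<close> and \<open>q\<close>
      tie, the upper end \<open>q\<close> falls behind, while all other vertices stay behind by
      continuity; so \<open>p\<close> becomes the unique maximum.\<close>
    have "eventually (\<lambda>\<beta>'. (n + \<beta>' *\<^sub>R m) \<bullet> u < (n + \<beta>' *\<^sub>R m) \<bullet> p) (at_left \<beta>)"
      if u: "u \<in> {u. u extreme_point_of P} - {p}" for u
    proof (cases "u = q")
      case True
      have "eventually (\<lambda>\<beta>'. \<beta>' < \<beta>) (at_left \<beta>)" by (simp add: eventually_at_filter)
      then show ?thesis
      proof eventually_elim
        case (elim \<beta>')
        have "(\<beta>' - \<beta>) * (m \<bullet> q - m \<bullet> p) < 0" using elim \<beta>(1) by (simp add: mult_neg_pos)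
        then show ?case using \<beta>(2) True by (simp add: inner_add_left algebra_simps)
      qed
    next
      case False
      then have "(n + \<beta> *\<^sub>R m) \<bullet> u < (n + \<beta> *\<^sub>R m) \<bullet> p" using \<beta>(6) u by simp
      moreover have "((\<lambda>\<beta>'. (n + \<beta>' *\<^sub>R m) \<bullet> p - (n + \<beta>' *\<^sub>R m) \<bullet> u) \<longlongrightarrow>
          (n + \<beta> *\<^sub>R m) \<bullet> p - (n + \<beta> *\<^sub>R m) \<bullet> u) (at_left \<beta>)"
        by (intro tendsto_intros)
      ultimately have "eventually (\<lambda>\<beta>'. 0 < (n + \<beta>' *\<^sub>R m) \<bullet> p - (n + \<beta>' *\<^sub>R m) \<bullet> u) (at_left \<beta>)"
        by (intro order_tendstoD(1)) auto
      then show ?thesis by simp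
    qed
    then have "eventually (\<lambda>\<beta>'. \<forall>u\<in>{u. u extreme_point_of P} - {p}. (n + \<beta>' *\<^sub>R m) \<bullet> u < (n + \<beta>' *\<^sub>R m) \<bullet> p) (at_left \<beta>)"
      using finite_verts by (intro eventually_ball_finite) auto
    then obtain \<beta>' where "\<forall>u\<in>{u. u extreme_point_of P} - {p}. (n + \<beta>' *\<^sub>R m) \<bullet> u < (n + \<beta>' *\<^sub>R m) \<bullet> p"
      using eventually_happens'[OF trivial_limit_at_left_real] by blast
    then have "p \<in> upper m n" using \<beta>(3) by (auto simp: upper_def smax_def)
    moreover have "p \<noteq> tp" using tp \<beta>(1,4,5) unfolding smax_def by force
    ultimately show "p \<in> upper m n - {tp}" by simp
  next
    fix v assume v: "v \<in> upper m n - {tp}"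
    then obtain \<beta>1 where \<beta>1: "smax (n + \<beta>1 *\<^sub>R m) v" by (auto simp: upper_def)
    have vP: "v extreme_point_of P" "v \<in> P" using \<beta>1 by (auto simp: smax_def extreme_point_of_def)
    define Z where "Z = {u. u extreme_point_of P \<and> m \<bullet> v < m \<bullet> u}"
    \<comment> \<open>\<open>b u\<close> is the parameter at which \<open>u\<close> catches up with
      \<open>v\<close>. Only vertices with a larger \<open>m\<close>-value can overtake
      \<open>v\<close> as the parameter grows from \<open>\<beta>1\<close>, and the smallest
      \<open>b u\<close> belongs to the first of them.\<close>
    define b where "b u = (n \<bullet> v - n \<bullet> u) / (m \<bullet> u - m \<bullet> v)" for u
    have "finite Z" by (rule finite_subset[OF _ finite_verts]) (auto simp: Z_def)
    moreover have "tp \<in> Z" using v tp vP by (auto simp: Z_def smax_def)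
    ultimately obtain u0 where u0: "u0 \<in> Z" "\<And>u. u \<in> Z \<Longrightarrow> b u0 \<le> b u"
      using ex_is_arg_min_if_finite[of Z b] by (auto simp: is_arg_min_linorder)
    define w where "w = n + b u0 *\<^sub>R m"
    have lt: "\<beta>1 < b u" if "u \<in> Z" for u
    proof -
      have "(n + \<beta>1 *\<^sub>R m) \<bullet> u < (n + \<beta>1 *\<^sub>R m) \<bullet> v"
        using \<beta>1 that unfolding smax_def Z_def by blast
      moreover have "0 < m \<bullet> u - m \<bullet> v" using that by (simp add: Z_def)
      ultimately show ?thesis by (simp add: b_def field_simps inner_add_left)
    qed
    have vmax: "w \<bullet> u \<le> w \<bullet> v" if "u extreme_point_of P" for u
    proof (cases "m \<bullet> v < m \<bullet> u")
      case True
      then have "b u0 \<le> b u" using u0 that by (simp add: Z_def)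
      then show ?thesis using True by (simp add: w_def b_def[of u] field_simps inner_add_left)
    next
      case False
      have "(n + \<beta>1 *\<^sub>R m) \<bullet> u \<le> (n + \<beta>1 *\<^sub>R m) \<bullet> v"
        using \<beta>1 that unfolding smax_def by (cases "u = v") auto
      moreover have "(b u0 - \<beta>1) * (m \<bullet> u - m \<bullet> v) \<le> 0"
        using lt[OF u0(1)] False by (intro mult_nonneg_nonpos) auto
      ultimately show ?thesis by (simp add: w_def algebra_simps inner_add_left)
    qed
    have vin: "v \<in> max_face P w" using in_max_faceI vP vmax by blast
    have u0': "u0 extreme_point_of P" "m \<bullet> v < m \<bullet> u0" "v \<noteq> u0" using u0 by (auto simp: Z_def)
    then have bu0: "w \<bullet> u0 = w \<bullet> v" by (simp add: w_def b_def inner_add_left divide_simps algebra_simps)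
    moreover have "u0 \<in> P" using u0' by (simp add: extreme_point_of_def)
    ultimately have uin: "u0 \<in> max_face P w" using vin by (simp add: max_face_def)
    have "w \<noteq> 0"
      using plane_independent[of n m 1 "b u0"] adm by (auto simp: admissible_def w_def)
    moreover have "w \<in> span {n, m}" by (auto simp: w_def intro!: span_add span_mul intro: span_base)
    \<comment> \<open>Admissibility excludes a tie on a larger face, so the maximal face can only be
      the edge from \<open>v\<close> to \<open>u0\<close>.\<close>
    ultimately have "aff_dim (max_face P w) \<le> 1" using admissible_max_face[OF adm] by blast
    then obtain p q where pq: "max_face P w = closed_segment p q" "closed_segment p q edge_of P"
    proof (cases rule: max_face_cases)
      case (1 v')
      then show ?thesis using vin uin u0' by (auto simp: smax_max_face)
    qed
    have extpq: "u = p \<or> u = q" if "u extreme_point_of P" "u \<in> max_face P w" for u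
    proof -
      have "u extreme_point_of (closed_segment p q)"
        using extreme_point_of_face[OF max_face_face_of[OF convex_P], of u w] that pq by simp
      then show ?thesis by (simp add: extreme_point_of_segment)
    qed
    have "{p, q} = {v, u0}" using extpq[OF vP(1) vin] extpq[OF u0'(1) uin] u0'(3) by auto
    then have edge: "closed_segment v u0 edge_of P"
      using pq(2) by (auto simp: doubleton_eq_iff closed_segment_commute)
    have lamw: "lam m n v u0 = w"
      using u0'(2) by (simp add: lam_def w_def b_def inner_diff_right minus_divide_left[symmetric]
          flip: scaleR_minus_left) (simp add: minus_divide_left)
    have "w \<bullet> (u - v) < 0" if u: "u extreme_point_of P" "u \<noteq> v" "u \<noteq> u0" for u
    proof (rule ccontr)
      assume "\<not> w \<bullet> (u - v) < 0"
      then have "w \<bullet> u = w \<bullet> v" using vmax[OF u(1)] by (simp add: inner_diff_right)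
      moreover have "u \<in> P" using u by (simp add: extreme_point_of_def)
      ultimately have "u \<in> max_face P w" using vin by (simp add: max_face_def)
      then show False using extpq[OF u(1)] u \<open>{p, q} = {v, u0}\<close> by blast
    qed
    then have "(v, u0) \<in> vis_edges m n"
      using edge u0'(2) lamw by (simp add: vis_edges_def up_edges_def vis_def)
    then show "v \<in> fst ` vis_edges m n" by force
  qed
qed

lemma generic_minus: "generic m \<Longrightarrow> generic (- m)"
  by (simp add: generic_def)

text \<open>Replacing \<open>m\<close> by \<open>- m\<close> reverses every edge but does not change
  the functional attached to it.\<close>

lemma vis_edges_minus: "card (vis_edges (- m) n) = card (vis_edges m n)"
proof -
  have "prod.swap ` vis_edges m n = vis_edges (- m) n" for m
  proof -
    have "(q, p) \<in> vis_edges (- m) n" if "(p, q) \<in> vis_edges m n" for m p q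
    proof -
      from that obtain \<beta> where \<beta>: "lam m n p q = n + \<beta> *\<^sub>R m"
        "(n + \<beta> *\<^sub>R m) \<bullet> p = (n + \<beta> *\<^sub>R m) \<bullet> q"
        "\<And>v. v extreme_point_of P \<Longrightarrow> v \<noteq> p \<Longrightarrow> v \<noteq> q \<Longrightarrow> (n + \<beta> *\<^sub>R m) \<bullet> v < (n + \<beta> *\<^sub>R m) \<bullet> p"
        by (rule vis_edgesD) blast
      moreover have "lam (- m) n q p = lam m n p q"
      proof -
        have "n \<bullet> (p - q) = - (n \<bullet> (q - p))" "(- m) \<bullet> (p - q) = m \<bullet> (q - p)"
          by (auto simp: inner_diff_right)
        then show ?thesis unfolding lam_def by simp
      qed
      ultimately have "vis (- m) n q p" by (simp add: vis_def inner_diff_right)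
      then show ?thesis using that by (simp add: vis_edges_def up_edges_def closed_segment_commute)
    qed
    from this[of _ _ m] this[of _ _ "- m"] show ?thesis by force
  qed
  then show ?thesis by (metis card_image inj_swap)
qed

text \<open>The two arcs, for \<open>n\<close> and for \<open>- n\<close>, share exactly their ends
  \<open>tp\<close> and \<open>bt\<close>. Each arc omits the end at which it stops,
  \<open>tp\<close> on one and \<open>bt\<close> on the other, so that every vertex is counted
  once.\<close>

lemma card_vertices_projection:
  assumes adm: "admissible P (span {n, m})" and gen: "generic m"
  shows "card {v. v extreme_point_of (orth_proj (span {n, m}) ` P)} =
    card (vis_edges m n) + card (vis_edges m (- n))"
proof -
  let ?W = "span {n, m}"
  have sW: "subspace ?W" by simp
  interpret p: linear "orth_proj ?W" using linear_orth_proj[OF sW] .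
  define T where "T = {v. \<exists>w\<in>?W. smax w v}"
  have pw: "w \<bullet> orth_proj ?W x = w \<bullet> x" if "w \<in> ?W" for w x
    using inner_orth_proj[OF sW that] .
  have pP: "polytope (orth_proj ?W ` P)"
    using polytope_linear_image[OF p.linear_axioms poly] .
  have "bij_betw (orth_proj ?W) T {v. v extreme_point_of (orth_proj ?W ` P)}"
  proof (rule bij_betw_imageI)
    show "inj_on (orth_proj ?W) T"
    proof (rule inj_onI)
      fix u v assume uv: "u \<in> T" "v \<in> T" "orth_proj ?W u = orth_proj ?W v"
      then obtain w where w: "w \<in> ?W" "smax w v" by (auto simp: T_def)
      then have "w \<bullet> u = w \<bullet> v" using uv(3) pw by metis
      moreover have "u extreme_point_of P" using uv by (auto simp: T_def smax_def)
      ultimately show "u = v" using w(2) by (auto simp: smax_def)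
    qed
    show "orth_proj ?W ` T = {v. v extreme_point_of (orth_proj ?W ` P)}"
    proof (intro equalityI subsetI)
      fix z assume "z \<in> orth_proj ?W ` T"
      then obtain v w where v: "z = orth_proj ?W v" "w \<in> ?W" "max_face P w = {v}"
        by (auto simp: T_def smax_max_face)
      have "max_face (orth_proj ?W ` P) w = orth_proj ?W ` max_face P w"
        using pw[OF v(2)] by (auto simp: max_face_def)
      then have "max_face (orth_proj ?W ` P) w = {z}" using v by simp
      then have "{z} face_of (orth_proj ?W ` P)"
        using max_face_face_of[OF polytope_imp_convex[OF pP], of w] by simp
      then show "z \<in> {v. v extreme_point_of (orth_proj ?W ` P)}" by (simp add: face_of_singleton)
    next
      fix z assume "z \<in> {v. v extreme_point_of (orth_proj ?W ` P)}"
      then have "{z} face_of (orth_proj ?W ` P)" by (simp add: face_of_singleton)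
      then obtain a where a: "{z} = max_face (orth_proj ?W ` P) a"
        using exposed_as_max_face[OF pP, of "{z}"] by auto
      \<comment> \<open>The exposing functional may be replaced by its projection to the plane,
        which has the same values on the image of \<open>P\<close>.\<close>
      define w where "w = orth_proj ?W a"
      have w: "w \<in> ?W" unfolding w_def using orth_proj(1)[OF sW] .
      have "a \<bullet> orth_proj ?W x = w \<bullet> x" for x
        using inner_orth_proj[OF sW orth_proj(1)[OF sW], of x a] pw[OF w, of x]
        by (metis inner_commute inner_orth_proj orth_proj(1) sW w_def)
      then have img: "orth_proj ?W ` max_face P w = {z}"
        unfolding a by (auto simp: max_face_def)
      have fibre: "u \<bullet> x = u \<bullet> y" if "x \<in> max_face P w" "y \<in> max_face P w" "u \<in> ?W" for x y u
      proof -
        have "orth_proj ?W x = orth_proj ?W y" using img that by (metis imageI singletonD)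
        then show ?thesis using that(3) orth_proj_eq_iff[OF sW] by blast
      qed
      \<comment> \<open>All functionals in the plane are constant on the fibre over a vertex, so the
        direction of an edge in it would be a degenerating direction of a 2-face containing that
        edge.\<close>
      have noedge: "\<not> 1 \<le> aff_dim (max_face P w)"
      proof
        assume "1 \<le> aff_dim (max_face P w)"
        then obtain e where e: "e face_of max_face P w" "aff_dim e = 1"
          using polytope_face_of_dim[OF polytope_max_face, of 1 w] by auto
        then have eP: "e edge_of P" using max_face_face_of[OF convex_P] face_of_trans by (auto simp: edge_of_def)
        then obtain p q where pq: "e = closed_segment p q" "p \<noteq> q"
          using edge_endpoints[OF poly] by metis
        obtain F where F: "two_face P F" "e \<subseteq> F"
          using edge_in_two_face[OF poly _ eP] full dim3 by auto
        have "q - p \<in> direction_space F" using F pq by (intro diff_in_direction_space) auto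
        then obtain u where u: "u \<in> ?W" "u \<bullet> (q - p) \<noteq> 0"
          using adm F(1) pq(2) unfolding admissible_iff by (metis eq_iff_diff_eq_0)
        moreover have "p \<in> max_face P w" "q \<in> max_face P w"
          using face_of_imp_subset[OF e(1)] pq by auto
        ultimately show False using fibre[of p q u] u by (simp add: inner_diff_right)
      qed
      then have "aff_dim (max_face P w) \<le> 1" by simp
      then obtain v where "smax w v"
      proof (cases rule: max_face_cases)
        case (2 p q)
        then show ?thesis using noedge by (simp add: edge_of_def)
      qed
      then show "z \<in> orth_proj ?W ` T"
        using w img by (force simp: T_def smax_max_face)
    qed
  qed
  then have "card {v. v extreme_point_of (orth_proj ?W ` P)} = card T"
    by (simp add: bij_betw_same_card)
  also have "\<dots> = card (vis_edges m n) + card (vis_edges m (- n))"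
  proof -
    obtain tp where tp: "smax m tp" using generic_smax[OF gen] .
    obtain bt where bt: "smax (- m) bt" using generic_smax[OF generic_minus[OF gen]] .
    have span_eq: "span {- n, - m} = ?W"
      using span_image_scale[of "{n, m}" "\<lambda>_. - 1"] by simp
    have U1: "card (vis_edges m n) = card (upper m n - {tp})"
      using bij_betw_same_card upper_chain[OF adm tp] by blast
    have "card (vis_edges (- m) (- n)) = card (upper (- m) (- n) - {bt})"
      using bij_betw_same_card upper_chain[OF _ bt, of "- n"] adm span_eq by metis
    then have U2: "card (vis_edges m (- n)) = card (upper (- m) (- n) - {bt})"
      by (simp add: vis_edges_minus)
    have tb: "tp \<noteq> bt"
    proof
      assume "tp = bt"
      then have "{v. v extreme_point_of P} = {tp}"
        using tp bt unfolding smax_def by (auto simp: less_asym) (metis inner_minus_left less_asym neg_less_iff_less)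
      then have "P = {tp}" using polytope_eq_hull[OF poly] by simp
      then show False using full dim3 by simp
    qed
    have up: "upper m n \<subseteq> T" "upper (- m) (- n) \<subseteq> T"
    proof -
      show "upper m n \<subseteq> T"
        by (auto simp: upper_def T_def intro!: bexI[of _ "n + b *\<^sub>R m" for b] span_add span_mul intro: span_base)
      have "- n + b *\<^sub>R - m \<in> ?W" for b
      proof -
        have "(-1) *\<^sub>R n + (-b) *\<^sub>R m \<in> ?W" unfolding span_pair by blast
        then show ?thesis by simp
      qed
      then show "upper (- m) (- n) \<subseteq> T" by (auto simp: upper_def T_def)
    qed
    have topl: "tp \<in> upper (- m) (- n)"
    proof -
      obtain \<beta> where "smax (- n + \<beta> *\<^sub>R m) tp" using smax_large[OF tp] .
      then have "smax (- n + (- \<beta>) *\<^sub>R - m) tp" by simp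
      then show ?thesis unfolding upper_def by blast
    qed
    have botu: "bt \<in> upper m n"
    proof -
      obtain \<beta> where "smax (n + \<beta> *\<^sub>R - m) bt" using smax_large[OF bt] .
      then have "smax (n + (- \<beta>) *\<^sub>R m) bt" by simp
      then show ?thesis unfolding upper_def by blast
    qed
    have scale: "smax (r *\<^sub>R w) v \<longleftrightarrow> smax w v" if "r > 0" for r w v
      using that by (simp add: smax_def)
    have T: "T = (upper m n - {tp}) \<union> (upper (- m) (- n) - {bt})"
    proof (intro equalityI subsetI)
      fix v assume "v \<in> T"
      then obtain s t where st: "smax (s *\<^sub>R n + t *\<^sub>R m) v" by (auto simp: T_def span_pair)
      consider "s > 0" | "s < 0" | "s = 0" "t > 0" | "s = 0" "t < 0" | "s = 0" "t = 0" by linarith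
      then show "v \<in> (upper m n - {tp}) \<union> (upper (- m) (- n) - {bt})"
      proof cases
        case 1
        have "s *\<^sub>R n + t *\<^sub>R m = s *\<^sub>R (n + (t / s) *\<^sub>R m)" using 1 by (simp add: scaleR_add_right)
        then have "v \<in> upper m n" using st scale[OF 1] unfolding upper_def by auto
        then show ?thesis using topl tb by auto
      next
        case 2
        have "s *\<^sub>R n + t *\<^sub>R m = (- s) *\<^sub>R (- n + (t / s) *\<^sub>R - m)" using 2 by (simp add: scaleR_diff_right)
        then have "v \<in> upper (- m) (- n)" using st scale[of "- s"] 2 unfolding upper_def by auto
        then show ?thesis using botu tb by auto
      next
        case 3
        then have "v = tp" using st scale smax_unique[OF _ tp] by auto
        then show ?thesis using topl tb by auto
      next
        case 4
        have "t *\<^sub>R m = (- t) *\<^sub>R - m" by simp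
        then have "v = bt" using 4 st scale[of "- t" "- m"] smax_unique[OF _ bt] by auto
        then show ?thesis using botu tb by auto
      next
        case 5
        then show ?thesis using st tp bt tb by (auto simp: smax_def)
      qed
    qed (use up in auto)
    \<comment> \<open>A vertex \<open>v\<close> on both arcs, away from their ends, would satisfy
      \<open>(a - b) * (m \<bullet> v - m \<bullet> u) > 0\<close> for all other vertices
      \<open>u\<close>; taking \<open>tp\<close> and \<open>bt\<close> for \<open>u\<close> gives
      opposite signs of \<open>a - b\<close>.\<close>
    have disj: "(upper m n - {tp}) \<inter> (upper (- m) (- n) - {bt}) = {}"
    proof (rule ccontr)
      assume "\<not> ?thesis"
      then obtain v a b where v: "v \<noteq> tp" "v \<noteq> bt" "smax (n + a *\<^sub>R m) v" "smax (- n + b *\<^sub>R - m) v"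
        by (auto simp: upper_def)
      have vext: "v extreme_point_of P" using v by (simp add: smax_def)
      have less: "0 < (a - b) * (m \<bullet> v - m \<bullet> u)" if "u extreme_point_of P" "u \<noteq> v" for u
      proof -
        have "(n + a *\<^sub>R m) \<bullet> u < (n + a *\<^sub>R m) \<bullet> v" "(- n + b *\<^sub>R - m) \<bullet> u < (- n + b *\<^sub>R - m) \<bullet> v"
          using v(3,4) that by (auto simp: smax_def)
        then show ?thesis by (simp add: inner_add_left inner_diff_left algebra_simps)
      qed
      have "0 < (a - b) * (m \<bullet> v - m \<bullet> tp)" "0 < (a - b) * (m \<bullet> v - m \<bullet> bt)"
        using less[of tp] less[of bt] v tp bt by (auto simp: smax_def)
      moreover have "m \<bullet> v < m \<bullet> tp" "m \<bullet> bt < m \<bullet> v"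
        using tp bt v vext by (auto simp: smax_def)
      ultimately show False by (auto simp: zero_less_mult_iff)
    qed
    have fin: "finite T" by (rule finite_subset[OF _ finite_verts]) (auto simp: T_def smax_def)
    have "finite (upper m n - {tp})" and "finite (upper (- m) (- n) - {bt})"
      using fin up by (auto intro: finite_subset)
    then show ?thesis unfolding U1 U2 by (subst T) (rule card_Un_disjoint[OF _ _ disj])
  qed
  finally show ?thesis .
qed

end

subsection \<open>Jump of the vertex count across a degenerating plane\<close>

text \<open>For an orthonormal frame \<open>a\<close>, \<open>b\<close> of a plane this is the
  determinant of the coordinates of \<open>u\<close> and \<open>v\<close>, that is, the oriented
  area of their parallelogram.\<close>

definition area :: "'a::euclidean_space \<Rightarrow> 'a \<Rightarrow> 'a \<Rightarrow> 'a \<Rightarrow> real" where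
  "area a b u v = (u \<bullet> a) * (v \<bullet> b) - (u \<bullet> b) * (v \<bullet> a)"

definition frame :: "'a::euclidean_space \<Rightarrow> 'a \<Rightarrow> 'a set \<Rightarrow> bool" where
  "frame a b S \<longleftrightarrow> a \<bullet> a = 1 \<and> b \<bullet> b = 1 \<and> a \<bullet> b = 0 \<and> S = span {a, b}"

lemma frame_exists:
  fixes S :: "'a::euclidean_space set"
  assumes "subspace S" "dim S = 2"
  obtains a b where "frame a b S"
proof -
  obtain B where B: "B \<subseteq> S" "pairwise orthogonal B" "\<And>x. x \<in> B \<Longrightarrow> norm x = 1"
      "independent B" "card B = dim S" "span B = S"
    using orthonormal_basis_subspace[OF assms(1)] by metis
  then obtain a b where "B = {a, b}" "a \<noteq> b" using assms(2) by (auto simp: card_2_iff)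
  then have "frame a b S"
    using B by (auto simp: frame_def pairwise_def orthogonal_def norm_eq_1)
  then show ?thesis by (rule that)
qed

lemma frame_expand:
  assumes "frame a b S" "v \<in> S"
  shows "v = (v \<bullet> a) *\<^sub>R a + (v \<bullet> b) *\<^sub>R b"
proof -
  obtain s t where "v = s *\<^sub>R a + t *\<^sub>R b" using assms by (auto simp: frame_def span_pair)
  moreover have "b \<bullet> a = 0" "a \<bullet> b = 0" "a \<bullet> a = 1" "b \<bullet> b = 1"
    using assms(1) by (auto simp: frame_def inner_commute)
  ultimately show ?thesis by (simp add: inner_add_left)
qed

lemma frame_subspace: "frame a b S \<Longrightarrow> subspace S"
  by (auto simp: frame_def)

lemma area_diff_left: "area a b (u - u') v = area a b u v - area a b u' v"
  and area_add_right: "area a b u (v + v') = area a b u v + area a b u v'"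
  and area_scale_left: "area a b (r *\<^sub>R u) v = r * area a b u v"
  and area_scale_right: "area a b u (r *\<^sub>R v) = r * area a b u v"
  and area_minus_left: "area a b (- u) v = - area a b u v"
  and area_self: "area a b u u = 0"
  and area_zero: "area a b 0 v = 0" "area a b u 0 = 0"
  and area_swap: "area a b u v = - area a b v u"
  by (simp_all add: area_def inner_diff_left inner_add_left algebra_simps)

lemma area_eq_0:
  assumes "frame a b S" "g \<in> S" "h \<in> S" "g \<noteq> 0" "area a b g h = 0"
  obtains c where "h = c *\<^sub>R g"
proof -
  have g: "g = (g \<bullet> a) *\<^sub>R a + (g \<bullet> b) *\<^sub>R b" and h: "h = (h \<bullet> a) *\<^sub>R a + (h \<bullet> b) *\<^sub>R b"
    using frame_expand assms by metis+
  have z: "(g \<bullet> a) * (h \<bullet> b) = (g \<bullet> b) * (h \<bullet> a)" using assms(5) by (simp add: area_def)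
  show ?thesis
  proof (cases "g \<bullet> a = 0")
    case True
    then have gb: "g \<bullet> b \<noteq> 0" using g assms(4) by auto
    then have "h \<bullet> a = 0" using z True by simp
    then have "h = ((h \<bullet> b) / (g \<bullet> b)) *\<^sub>R g" using True g h gb by (metis add_0 nonzero_divide_eq_eq scaleR_scaleR scaleR_zero_left)
    then show ?thesis by (rule that)
  next
    case False
    let ?c = "(h \<bullet> a) / (g \<bullet> a)"
    have "?c *\<^sub>R g = (?c * (g \<bullet> a)) *\<^sub>R a + (?c * (g \<bullet> b)) *\<^sub>R b"
      using g by (metis scaleR_add_right scaleR_scaleR)
    also have "?c * (g \<bullet> a) = h \<bullet> a" using False by simp
    also have "?c * (g \<bullet> b) = h \<bullet> b" using z False by (simp add: field_simps)
    finally have "h = ?c *\<^sub>R g" using h by simp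
    then show ?thesis by (rule that)
  qed
qed

text \<open>On the plane \<open>S\<close>, a functional that kills a nonzero \<open>g\<close> is a
  multiple of the area form with \<open>g\<close>. This converts signs of functionals at vertices
  into orientations of edges.\<close>

lemma area_functional:
  assumes "frame a b S" "g \<in> S" "h \<in> S" "k \<in> S" "y \<bullet> g = 0"
  shows "area a b g h * (y \<bullet> k) = area a b g k * (y \<bullet> h)"
proof -
  have ex: "y \<bullet> v = (v \<bullet> a) * (y \<bullet> a) + (v \<bullet> b) * (y \<bullet> b)" if "v \<in> S" for v
    using arg_cong[OF frame_expand[OF assms(1) that], of "\<lambda>z. y \<bullet> z"] by (simp add: inner_add_right)
  have "(g \<bullet> a) * (y \<bullet> a) + (g \<bullet> b) * (y \<bullet> b) = 0" using ex[OF assms(2)] assms(5) by simp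
  then show ?thesis unfolding area_def ex[OF assms(3)] ex[OF assms(4)] by algebra
qed

text \<open>With respect to the frame, the polygon \<open>F\<close> lies to the left of its edge
  \<open>e\<close> traversed along \<open>u\<close>.\<close>

definition ccw :: "'a::euclidean_space \<Rightarrow> 'a \<Rightarrow> 'a set \<Rightarrow> 'a set \<Rightarrow> 'a \<Rightarrow> bool" where
  "ccw a b F e u \<longleftrightarrow> (\<exists>p q. e = closed_segment p q \<and> u = q - p) \<and>
     (\<exists>w. points_into w e F \<and> area a b u w > 0)"

definition ccw_dir :: "'a::euclidean_space \<Rightarrow> 'a \<Rightarrow> 'a set \<Rightarrow> 'a set \<Rightarrow> 'a" where
  "ccw_dir a b F e = (THE u. ccw a b F e u)"

text \<open>A face of a convex set contains all points of the set in its affine hull, so no point of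
  \<open>F\<close> off the edge lies on the line of the edge.\<close>

lemma edge_side:
  assumes F: "convex F" and fr: "frame a b (direction_space F)"
    and e: "closed_segment p q edge_of F" and z: "z \<in> F" "z \<notin> closed_segment p q"
  shows "area a b (q - p) (z - p) \<noteq> 0"
proof
  assume 0: "area a b (q - p) (z - p) = 0"
  have eF: "closed_segment p q face_of F" "aff_dim (closed_segment p q) = 1" using e by (auto simp: edge_of_def)
  then have pq: "p \<in> F" "q \<in> F" "p \<noteq> q" using face_of_imp_subset by fastforce+
  obtain c where "z - p = c *\<^sub>R (q - p)"
    by (rule area_eq_0[OF fr _ _ _ 0]) (use pq z diff_in_direction_space in auto)
  then have "z - p \<in> direction_space (closed_segment p q)"
    by (simp add: direction_space_segment span_mul span_base)
  then have "z \<in> affine hull (closed_segment p q)"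
    using affine_hull_direction_space[of p "closed_segment p q"] by simp
  then show False using face_of_imp_eq_affine_Int[OF F eF(1)] z by blast
qed

text \<open>If two points lay on different sides, the segment between them would cross the line of
  the edge, hence the edge itself; but a face that meets an open segment contains its end
  points.\<close>

lemma edge_same_side:
  assumes F: "convex F" and fr: "frame a b (direction_space F)"
    and e: "closed_segment p q edge_of F"
    and z: "z \<in> F" "z \<notin> closed_segment p q" and y: "y \<in> F" "y \<notin> closed_segment p q"
  shows "sgn (area a b (q - p) (z - p)) = sgn (area a b (q - p) (y - p))"
proof (rule ccontr)
  let ?f = "\<lambda>z. area a b (q - p) (z - p)"
  assume ne: "\<not> ?thesis"
  have nz: "?f z \<noteq> 0" "?f y \<noteq> 0" using edge_side[OF F fr e] z y by auto
  have eF: "closed_segment p q face_of F" using e by (simp add: edge_of_def)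
  \<comment> \<open>The affine function \<open>?f\<close> vanishes at this parameter of the segment
    from \<open>z\<close> to \<open>y\<close>.\<close>
  define t where "t = ?f z / (?f z - ?f y)"
  have neg: "?f z * ?f y < 0"
    using ne nz by (auto simp: sgn_if mult_less_0_iff split: if_splits)
  then have den: "?f z - ?f y \<noteq> 0" by (auto simp: mult_less_0_iff)
  have t: "0 < t" "t < 1"
    using neg by (auto simp: t_def mult_less_0_iff field_simps)
  define x where "x = (1 - t) *\<^sub>R z + t *\<^sub>R y"
  have "x - p = (1 - t) *\<^sub>R (z - p) + t *\<^sub>R (y - p)" by (simp add: x_def algebra_simps)
  then have "?f x = (1 - t) * ?f z + t * ?f y"
    by (simp add: area_add_right area_scale_right)
  also have "\<dots> = ?f z - t * (?f z - ?f y)" by (simp add: algebra_simps)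
  also have "\<dots> = 0" using den by (simp add: t_def)
  finally have fx: "?f x = 0" .
  have "z \<noteq> y" using ne by auto
  then have xo: "x \<in> open_segment z y" using t by (auto simp: in_segment x_def)
  moreover have "x \<in> F" using xo F z y convex_contains_open_segment by blast
  then have "x \<in> closed_segment p q" using edge_side[OF F fr e] fx by blast
  ultimately show False using face_ofD[OF eF _ z(1) y(1)] z(2) by blast
qed

text \<open>The base point \<open>x\<close> differs from \<open>p\<close> by a multiple of
  \<open>q - p\<close>, on which the area form with \<open>q - p\<close> vanishes.\<close>

lemma points_into_side:
  assumes F: "convex F" and fr: "frame a b (direction_space F)"
    and e: "closed_segment p q edge_of F"
    and z: "z \<in> F" "z \<notin> closed_segment p q" and w: "points_into w (closed_segment p q) F"
  shows "sgn (area a b (q - p) w) = sgn (area a b (q - p) (z - p))"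
proof -
  obtain x t where x: "x \<in> closed_segment p q" "t > 0" "x + t *\<^sub>R w \<in> F" "x + t *\<^sub>R w \<notin> closed_segment p q"
    using w by (auto simp: points_into_def)
  obtain s where s: "x = (1 - s) *\<^sub>R p + s *\<^sub>R q" using x(1) by (auto simp: in_segment)
  then have "x + t *\<^sub>R w - p = s *\<^sub>R (q - p) + t *\<^sub>R w" by (simp add: algebra_simps)
  then have "area a b (q - p) (x + t *\<^sub>R w - p) = area a b (q - p) (s *\<^sub>R (q - p) + t *\<^sub>R w)"
    by (rule arg_cong)
  then have "area a b (q - p) (x + t *\<^sub>R w - p) = t * area a b (q - p) w"
    by (simp only: area_add_right area_scale_right area_self mult_zero_right add_0)
  then have "sgn (area a b (q - p) (x + t *\<^sub>R w - p)) = sgn (area a b (q - p) w)"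
    using x(2) by (simp add: sgn_mult)
  then show ?thesis using edge_same_side[OF F fr e x(3,4) z] by simp
qed

lemma points_into_vertex:
  assumes "z \<in> F" "z \<notin> closed_segment p q"
  shows "points_into (z - p) (closed_segment p q) F"
  unfolding points_into_def using assms by (intro bexI[of _ p] exI[of _ 1]) auto

lemma segment_dirs:
  fixes p :: "'a::euclidean_space"
  assumes "closed_segment p q = closed_segment p' q'" "u = q' - p'"
  shows "u = q - p \<or> u = - (q - p)"
  using assms by (auto simp: closed_segment_eq doubleton_eq_iff)

text \<open>The sign of the area at any point \<open>z\<close> off the edge selects the one of the
  two directions that has the polygon on its left; in particular this direction is unique.\<close>

lemma ccw_iff:
  assumes F: "convex F" and fr: "frame a b (direction_space F)"
    and e: "closed_segment p q edge_of F" and z: "z \<in> F" "z \<notin> closed_segment p q"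
  shows "ccw a b F (closed_segment p q) u \<longleftrightarrow> u = sgn (area a b (q - p) (z - p)) *\<^sub>R (q - p)"
proof
  let ?s = "area a b (q - p) (z - p)"
  have nz: "?s \<noteq> 0" by (rule edge_side[OF F fr e z])
  {
    assume "ccw a b F (closed_segment p q) u"
    then obtain p' q' w where w: "closed_segment p q = closed_segment p' q'" "u = q' - p'"
      "points_into w (closed_segment p q) F" "area a b u w > 0" by (auto simp: ccw_def)
    have "sgn (area a b (q - p) w) = sgn ?s" by (rule points_into_side[OF F fr e z w(3)])
    then show "u = sgn ?s *\<^sub>R (q - p)"
      using segment_dirs[OF w(1,2)] w(4) nz
      by (auto simp: area_minus_left area_diff_left sgn_if split: if_splits)
  next
    assume u: "u = sgn ?s *\<^sub>R (q - p)"
    have "u = q - p \<or> u = p - q" using u nz by (auto simp: sgn_if)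
    then have "\<exists>p' q'. closed_segment p q = closed_segment p' q' \<and> u = q' - p'"
      by (metis closed_segment_commute)
    moreover have "area a b u (z - p) = sgn ?s * ?s" unfolding u by (simp add: area_scale_left)
    then have "area a b u (z - p) > 0" using nz by (simp add: sgn_if)
    ultimately show "ccw a b F (closed_segment p q) u"
      using points_into_vertex[OF z] unfolding ccw_def by blast
  }
qed

lemma polygon_vertex_off_edge:
  assumes "polytope F" "aff_dim F = 2" "closed_segment p q edge_of F"
  obtains z where "z extreme_point_of F" "z \<in> F" "z \<notin> closed_segment p q"
proof -
  have "\<not> {v. v extreme_point_of F} \<subseteq> closed_segment p q"
  proof
    assume "{v. v extreme_point_of F} \<subseteq> closed_segment p q"
    then have "convex hull {v. v extreme_point_of F} \<subseteq> closed_segment p q"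
      by (intro hull_minimal) auto
    then have "F \<subseteq> closed_segment p q" using polytope_eq_hull[OF assms(1)] by simp
    then have "aff_dim F \<le> aff_dim (closed_segment p q)" by (rule aff_dim_subset)
    then show False using assms by (simp add: edge_of_def)
  qed
  then show ?thesis using that by (auto simp: extreme_point_of_def)
qed

lemma ccw_dir_eq:
  assumes F: "convex F" and fr: "frame a b (direction_space F)"
    and e: "closed_segment p q edge_of F" and z: "z \<in> F" "z \<notin> closed_segment p q"
  shows "ccw_dir a b F (closed_segment p q) = sgn (area a b (q - p) (z - p)) *\<^sub>R (q - p)"
  unfolding ccw_dir_def by (rule the_equality) (use ccw_iff[OF assms] in blast)+

lemma eventually_less_perturb:
  fixes A B :: real
  assumes "A < 0"
  shows "eventually (\<lambda>s. A + s * B < 0) (at_right 0)" "eventually (\<lambda>s. A - s * B < 0) (at_right 0)"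
proof -
  have "((\<lambda>s. A + s * B) \<longlongrightarrow> A + 0 * B) (at_right 0)" "((\<lambda>s. A - s * B) \<longlongrightarrow> A - 0 * B) (at_right 0)"
    by (intro tendsto_intros)+
  then have l: "((\<lambda>s. A + s * B) \<longlongrightarrow> A) (at_right 0)" "((\<lambda>s. A - s * B) \<longlongrightarrow> A) (at_right 0)"
    by auto
  show "eventually (\<lambda>s. A + s * B < 0) (at_right 0)" "eventually (\<lambda>s. A - s * B < 0) (at_right 0)"
    using order_tendstoD(2)[OF l(1) assms] order_tendstoD(2)[OF l(2) assms] .
qed

section \<open>Visible edges under perturbation of the plane\<close>

context full_polytope begin

text \<open>Compares the numbers of edges on the two arcs into which the direction \<open>k\<close>
  divides the boundary; edges parallel to \<open>k\<close> contribute 0. The value 0 for sets that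
  are not 2-faces covers the empty second face and exposed faces of other dimensions.\<close>

definition edge_sum :: "'a \<Rightarrow> 'a \<Rightarrow> 'a set \<Rightarrow> 'a \<Rightarrow> real" where
  "edge_sum a b F k =
    (if two_face P F then \<Sum>e | e edge_of F. sgn (area a b (ccw_dir a b F e) k) else 0)"

lemma lam_add: "lam m (n + s *\<^sub>R x) p q = lam m n p q + s *\<^sub>R lam m x p q"
proof -
  have "((n + s *\<^sub>R x) \<bullet> (q - p)) / (m \<bullet> (q - p)) =
      (n \<bullet> (q - p)) / (m \<bullet> (q - p)) + s * ((x \<bullet> (q - p)) / (m \<bullet> (q - p)))"
    by (simp only: inner_add_left inner_scaleR_left add_divide_distrib times_divide_eq_right)
  then show ?thesis
    unfolding lam_def by (simp only: scaleR_add_left scaleR_diff_right scaleR_scaleR) simp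
qed

lemma card_vis_edges:
  "real (card (vis_edges m n)) = (\<Sum>(p, q)\<in>up_edges m. if vis m n p q then 1 else 0)"
proof -
  have "vis_edges m n = up_edges m \<inter> {(p, q). vis m n p q}" by (auto simp: vis_edges_def)
  moreover have "(\<Sum>(p, q)\<in>up_edges m. if vis m n p q then 1 else 0) =
      (\<Sum>e\<in>up_edges m. if e \<in> {(p, q). vis m n p q} then 1 else (0::real))"
    by (rule sum.cong) auto
  ultimately show ?thesis
    using finite_up_edges[of m] by (simp add: sum.If_cases)
qed

lemma edge_of_two_face:
  assumes "two_face P F"
  shows "closed_segment p q edge_of F \<longleftrightarrow> closed_segment p q edge_of P \<and> p \<in> F \<and> q \<in> F"
proof -
  have F: "F face_of P" "convex F" using assms face_of_imp_convex by (auto simp: two_face_def)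
  have "closed_segment p q \<subseteq> F \<longleftrightarrow> p \<in> F \<and> q \<in> F"
    using F(2) closed_segment_subset[of p F q] ends_in_segment[of p q] by blast
  then show ?thesis using face_of_face[OF F(1)] by (auto simp: edge_of_def)
qed

lemma vis_perturb:
  "vis m (n + s *\<^sub>R x) p q \<longleftrightarrow> (\<forall>v\<in>{v. v extreme_point_of P} - {p, q}.
    lam m n p q \<bullet> (v - p) + s * (lam m x p q \<bullet> (v - p)) < 0)"
  by (auto simp: vis_def lam_add inner_add_left)

text \<open>An edge is not maximal for the functional that is constant on it, or it is the whole
  maximal face, or it lies in a larger one. Only the last case leaves the outcome of a perturbation
  open.\<close>

lemma lam_face_cases:
  assumes pq: "(p, q) \<in> up_edges m"
  obtains (beaten) v where "v extreme_point_of P" "v \<noteq> p" "v \<noteq> q" "lam m n p q \<bullet> (v - p) > 0"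
  | (edge) "max_face P (lam m n p q) = closed_segment p q"
  | (large) "2 \<le> aff_dim (max_face P (lam m n p q))" "p \<in> max_face P (lam m n p q)" "q \<in> max_face P (lam m n p q)"
proof -
  define L where "L = lam m n p q"
  have ePq: "closed_segment p q edge_of P" and mg: "m \<bullet> p < m \<bullet> q" using pq by (auto simp: up_edges_def)
  note seg = edge_segment[OF poly ePq]
  have Lpq: "L \<bullet> p = L \<bullet> q"
    using lam_orth[of m q p n] mg by (auto simp: L_def inner_diff_right)
  show ?thesis
  proof (cases "\<exists>v. v extreme_point_of P \<and> L \<bullet> (v - p) > 0")
    case True
    then obtain v where v: "v extreme_point_of P" "L \<bullet> (v - p) > 0" by blast
    moreover have "v \<noteq> p" "v \<noteq> q" using v Lpq by (auto simp: inner_diff_right)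
    ultimately show ?thesis using beaten by (simp add: L_def)
  next
    case False
    then have "L \<bullet> v \<le> L \<bullet> p" if "v extreme_point_of P" for v
      using that by (force simp: inner_diff_right not_less)
    then have pM: "p \<in> max_face P L" "q \<in> max_face P L"
      using in_max_faceI[OF seg(4)] in_max_faceI[OF seg(5)] Lpq by auto
    have face: "max_face P L face_of P" by (rule max_face_face_of[OF convex_P])
    have sub: "closed_segment p q \<subseteq> max_face P L"
      using pM face_of_imp_convex[OF face] by (simp add: closed_segment_subset)
    show ?thesis
    proof (cases "max_face P L = closed_segment p q")
      case True then show ?thesis using edge by (simp add: L_def)
    next
      case False
      have "closed_segment p q face_of max_face P L"
        using face_of_face[OF face] ePq sub by (simp add: edge_of_def)
      then have "aff_dim (closed_segment p q) < aff_dim (max_face P L)"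
        using face_of_aff_dim_lt[OF face_of_imp_convex[OF face]] False by metis
      then have "2 \<le> aff_dim (max_face P L)" using ePq by (simp add: edge_of_def)
      then show ?thesis using large pM by (simp add: L_def)
    qed
  qed
qed

text \<open>Outside the case \<open>large\<close> of \<open>lam_face_cases\<close>, visibility is
  decided by strict inequalities at finitely many vertices, and these persist.\<close>

lemma vis_stable:
  assumes pq: "(p, q) \<in> up_edges m"
    and *: "aff_dim (max_face P (lam m n p q)) \<le> 1 \<or>
      (\<exists>v. v extreme_point_of P \<and> v \<noteq> p \<and> v \<noteq> q \<and> lam m n p q \<bullet> (v - p) > 0)"
  shows "eventually (\<lambda>s. vis m (n + s *\<^sub>R x) p q \<longleftrightarrow> vis m n p q) (nhds 0)"
proof -
  define L where "L = lam m n p q"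
  define y where "y = lam m x p q"
  let ?V = "{v. v extreme_point_of P} - {p, q}"
  have lim: "((\<lambda>s. L \<bullet> (v - p) + s * (y \<bullet> (v - p))) \<longlongrightarrow> L \<bullet> (v - p)) (nhds 0)" for v
  proof -
    have "((\<lambda>s. L \<bullet> (v - p) + s * (y \<bullet> (v - p))) \<longlongrightarrow> L \<bullet> (v - p) + 0 * (y \<bullet> (v - p))) (nhds 0)"
      by (intro tendsto_add tendsto_mult tendsto_const filterlim_ident)
    then show ?thesis by simp
  qed
  show ?thesis
    using pq
  proof (cases rule: lam_face_cases[where n = n])
    case (beaten v)
    then have v: "v \<in> ?V" "L \<bullet> (v - p) > 0" by (auto simp: L_def)
    have "\<not> vis m n p q"
      using v vis_perturb[of m n 0 0 p q] by (force simp: L_def)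
    moreover have "eventually (\<lambda>s. L \<bullet> (v - p) + s * (y \<bullet> (v - p)) > 0) (nhds 0)"
      using order_tendstoD(1)[OF lim v(2)] .
    then have "eventually (\<lambda>s. \<not> vis m (n + s *\<^sub>R x) p q) (nhds 0)"
      by (rule eventually_mono) (use v(1) in \<open>force simp: vis_perturb L_def y_def\<close>)
    ultimately show ?thesis by simp
  next
    case edge
    have seg: "p \<in> max_face P L" using edge by (simp add: L_def)
    have neg: "L \<bullet> (v - p) < 0" if "v \<in> ?V" for v
    proof (rule ccontr)
      assume n: "\<not> L \<bullet> (v - p) < 0"
      have vP: "v extreme_point_of P" "v \<in> P" using that by (auto simp: extreme_point_of_def)
      then have "v \<in> max_face P L" using seg n by (auto simp: max_face_def inner_diff_right)
      then have "v extreme_point_of closed_segment p q"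
        using extreme_point_of_face[OF max_face_face_of[OF convex_P], of v L] vP edge by (simp add: L_def)
      then show False using that by (auto simp: extreme_point_of_segment)
    qed
    then have "vis m n p q" using vis_perturb[of m n 0 0 p q] by (simp add: L_def)
    moreover have "eventually (\<lambda>s. \<forall>v\<in>?V. L \<bullet> (v - p) + s * (y \<bullet> (v - p)) < 0) (nhds 0)"
      using finite_verts neg by (intro eventually_ball_finite ballI order_tendstoD(2)[OF lim]) auto
    then have "eventually (\<lambda>s. vis m (n + s *\<^sub>R x) p q) (nhds 0)"
      by (rule eventually_mono) (simp add: vis_perturb L_def y_def)
    ultimately show ?thesis by simp
  next
    case large
    then show ?thesis
    proof -
      obtain v where v: "v extreme_point_of P" "lam m n p q \<bullet> (v - p) > 0" using large * by auto
      then have "v \<in> P" by (simp add: extreme_point_of_def)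
      then show ?thesis using large(2) v(2) by (auto simp: max_face_def inner_diff_right)
    qed
  qed
qed

lemma eventually_nhds_0_pm:
  fixes Q :: "real \<Rightarrow> bool"
  assumes "eventually Q (nhds 0)"
  shows "eventually (\<lambda>s. Q s \<and> Q (- s)) (at_right 0)"
proof -
  obtain d where "d > 0" "\<And>s. \<bar>s\<bar> < d \<Longrightarrow> Q s"
    using assms by (auto simp: eventually_nhds_metric)
  then show ?thesis
    unfolding eventually_at_right_field by (intro exI[of _ d]) auto
qed

lemma vis_locally_constant:
  assumes adm: "admissible P (span {n, m})"
  shows "eventually (\<lambda>s. vis_edges m (n + s *\<^sub>R x) = vis_edges m n) (nhds 0)"
proof -
  have "eventually (\<lambda>s. \<forall>pq\<in>up_edges m. vis m (n + s *\<^sub>R x) (fst pq) (snd pq) \<longleftrightarrow> vis m n (fst pq) (snd pq)) (nhds 0)"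
  proof (intro eventually_ball_finite finite_up_edges ballI vis_stable disjI1)
    fix pq assume "pq \<in> up_edges m"
    then show "(fst pq, snd pq) \<in> up_edges m" by simp
    let ?L = "lam m n (fst pq) (snd pq)"
    define \<beta> where "\<beta> = - ((n \<bullet> (snd pq - fst pq)) / (m \<bullet> (snd pq - fst pq)))"
    have L: "?L = n + \<beta> *\<^sub>R m" by (simp add: lam_def \<beta>_def)
    have "?L \<in> span {n, m}" unfolding span_pair L by (intro exI[of _ 1] exI[of _ \<beta>]) simp
    moreover have "?L \<noteq> 0"
      using plane_independent[of n m 1 \<beta>] adm L by (auto simp: admissible_def)
    ultimately show "aff_dim (max_face P ?L) \<le> 1" by (rule admissible_max_face[OF adm])
  qed
  then show ?thesis by (rule eventually_mono) (auto simp: vis_edges_def)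
qed

text \<open>For an edge of \<Phi>, the perturbing functional \<open>y\<close> kills
  \<open>q - p\<close>, so on \<open>S\<close> it is proportional to the area form with
  \<open>q - p\<close>, and \<open>y \<bullet> k = x \<bullet> k\<close> fixes the factor. The other
  vertices of \<Phi> lie on one side of the edge, hence \<open>y\<close> has one sign \<tau> on
  them: the edge is visible on one side of the crossing only, and \<tau> decides on which. All other
  edges keep their status.\<close>

lemma vis_jump:
  assumes fr: "frame a b S" and \<nu>S: "\<And>g. g \<in> S \<Longrightarrow> \<nu> \<bullet> g = 0"
    and mS: "h \<in> S" "m \<bullet> h \<noteq> 0"
    and nondeg: "\<And>G g. two_face P G \<Longrightarrow> g \<in> direction_space G \<Longrightarrow> g \<noteq> 0 \<Longrightarrow> \<nu> \<bullet> g = 0 \<Longrightarrow>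
      m \<bullet> g = 0 \<Longrightarrow> direction_space G = S"
    and k: "k \<in> S" "m \<bullet> k = 0" "x \<bullet> k \<noteq> 0"
    and pq: "(p, q) \<in> up_edges m" and \<Phi>: "\<Phi> = max_face P \<nu>"
  shows "eventually (\<lambda>s. (if vis m (\<nu> + s *\<^sub>R x) p q then 1 else 0) - (if vis m (\<nu> - s *\<^sub>R x) p q then 1 else 0) =
    (if two_face P \<Phi> \<and> closed_segment p q edge_of \<Phi>
     then - sgn (x \<bullet> k) * sgn (area a b (ccw_dir a b \<Phi> (closed_segment p q)) k) else (0::real))) (at_right 0)"
proof -
  define L where "L = lam m \<nu> p q"
  define y where "y = lam m x p q"
  let ?g = "q - p"
  let ?V = "{v. v extreme_point_of P} - {p, q}"
  have ePq: "closed_segment p q edge_of P" and mg: "m \<bullet> p < m \<bullet> q" using pq by (auto simp: up_edges_def)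
  have finV: "finite ?V" using finite_verts by simp
  have Lg: "L \<bullet> ?g = 0" "y \<bullet> ?g = 0"
    using lam_orth[of m q p \<nu>] lam_orth[of m q p x] mg by (auto simp: L_def y_def inner_diff_right)
  have vis_plus: "vis m (\<nu> + s *\<^sub>R x) p q \<longleftrightarrow> (\<forall>v\<in>?V. L \<bullet> (v - p) + s * (y \<bullet> (v - p)) < 0)" for s
    by (simp add: vis_perturb L_def y_def)
  have vis_minus: "vis m (\<nu> - s *\<^sub>R x) p q \<longleftrightarrow> (\<forall>v\<in>?V. L \<bullet> (v - p) - s * (y \<bullet> (v - p)) < 0)" for s
    using vis_perturb[of m \<nu> "- s" x p q] by (simp add: L_def y_def)
  show ?thesis
  proof (cases "two_face P \<Phi> \<and> closed_segment p q edge_of \<Phi>")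
    case True
    then have tf: "two_face P \<Phi>" and e\<Phi>: "closed_segment p q edge_of \<Phi>" by auto
    then have pq\<Phi>: "p \<in> \<Phi>" "q \<in> \<Phi>" using edge_of_two_face by auto
    have dirS: "direction_space \<Phi> = S"
    proof -
      obtain g where g: "g \<in> direction_space \<Phi>" "g \<noteq> 0" "m \<bullet> g = 0"
        using plane_orth_vector[OF subspace_direction_space two_face_dim[OF tf]] by metis
      then show ?thesis using nondeg[OF tf g(1,2) _ g(3)] max_face_direction_orth \<Phi> by blast
    qed
    have conv: "convex \<Phi>" "polytope \<Phi>" using tf two_face_polytope[OF poly] polytope_imp_convex by auto
    have fr': "frame a b (direction_space \<Phi>)" using fr dirS by simp
    have dim2: "aff_dim \<Phi> = 2" using tf by (simp add: two_face_def)
    obtain z where z: "z extreme_point_of \<Phi>" "z \<in> \<Phi>" "z \<notin> closed_segment p q"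
      using polygon_vertex_off_edge[OF conv(2) dim2 e\<Phi>] .
    have zV: "z \<in> ?V"
      using z extreme_point_of_face[OF max_face_face_of[OF convex_P], of z \<nu>] \<Phi> by auto
    have \<nu>g: "\<nu> \<bullet> ?g = 0" using diff_in_direction_space[OF pq\<Phi>(2,1)] dirS \<nu>S by simp
    then have L: "L = \<nu>" by (simp add: L_def lam_def)
    have gS: "?g \<in> S" using diff_in_direction_space[OF pq\<Phi>(2,1)] dirS by simp
    have yk: "y \<bullet> k = x \<bullet> k" using k by (simp add: y_def lam_def inner_diff_left)
    define \<tau> where "\<tau> = sgn (x \<bullet> k) * (sgn (area a b ?g (z - p)) * sgn (area a b ?g k))"
    have side: "sgn (y \<bullet> (v - p)) = \<tau> \<and> \<tau> \<noteq> 0" if v: "v \<in> ?V" "v \<in> \<Phi>" for v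
    proof -
      have vne: "v \<notin> closed_segment p q"
      proof
        assume "v \<in> closed_segment p q"
        moreover have "v extreme_point_of P" "v \<noteq> p" "v \<noteq> q" using v by auto
        ultimately have "v extreme_point_of closed_segment p q"
          using extreme_point_of_face[of "closed_segment p q" P v] ePq by (auto simp: edge_of_def)
        then show False using v by (auto simp: extreme_point_of_segment)
      qed
      have vS: "v - p \<in> S" using diff_in_direction_space[OF v(2) pq\<Phi>(1)] dirS by simp
      have eq: "area a b ?g (v - p) * (x \<bullet> k) = area a b ?g k * (y \<bullet> (v - p))"
        using area_functional[OF fr gS vS k(1) Lg(2)] yk by simp
      have nz: "area a b ?g (v - p) \<noteq> 0" by (rule edge_side[OF conv(1) fr' e\<Phi> v(2) vne])
      then have nz': "area a b ?g k \<noteq> 0" "y \<bullet> (v - p) \<noteq> 0" using eq k(3) by auto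
      have "sgn (area a b ?g (v - p)) * sgn (x \<bullet> k) = sgn (area a b ?g k) * sgn (y \<bullet> (v - p))"
        using eq by (metis sgn_mult)
      moreover have "sgn (area a b ?g (v - p)) = sgn (area a b ?g (z - p))"
        by (rule edge_same_side[OF conv(1) fr' e\<Phi> v(2) vne z(2,3)])
      ultimately have "sgn (area a b ?g (z - p)) * sgn (x \<bullet> k) = sgn (area a b ?g k) * sgn (y \<bullet> (v - p))" by simp
      moreover have "sgn (area a b ?g (z - p)) \<noteq> 0"
        using nz \<open>sgn (area a b ?g (v - p)) = sgn (area a b ?g (z - p))\<close> by (metis sgn_0_0)
      ultimately show ?thesis
        using nz' k(3) by (auto simp: \<tau>_def sgn_if split: if_splits)
    qed
    have off: "L \<bullet> (v - p) < 0" if "v \<in> ?V" "v \<notin> \<Phi>" for v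
    proof -
      have "v \<in> P" using that by (simp add: extreme_point_of_def)
      moreover have "\<forall>z\<in>P. \<nu> \<bullet> z \<le> \<nu> \<bullet> p" using pq\<Phi>(1) \<Phi> by (simp add: max_face_def)
      ultimately have "\<nu> \<bullet> v < \<nu> \<bullet> p"
        using that(2) \<Phi> unfolding max_face_def by force
      then show ?thesis by (simp add: L inner_diff_right)
    qed
    have on: "L \<bullet> (v - p) = 0" if "v \<in> \<Phi>" for v
      using diff_in_direction_space[OF that pq\<Phi>(1)] dirS \<nu>S by (simp add: L)
    have ev1: "eventually (\<lambda>s. \<forall>v\<in>?V. v \<notin> \<Phi> \<longrightarrow> L \<bullet> (v - p) + s * (y \<bullet> (v - p)) < 0 \<and>
        L \<bullet> (v - p) - s * (y \<bullet> (v - p)) < 0) (at_right 0)"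
      using finV off eventually_less_perturb by (intro eventually_ball_finite) (auto simp: eventually_conj_iff)
    have ccw: "sgn (area a b (ccw_dir a b \<Phi> (closed_segment p q)) k) = sgn (area a b ?g (z - p)) * sgn (area a b ?g k)"
      using ccw_dir_eq[OF conv(1) fr' e\<Phi> z(2,3)] by (simp add: area_scale_left sgn_mult)
    have "eventually (\<lambda>s::real. s > 0) (at_right 0)" by (simp add: eventually_at_filter)
    with ev1 show ?thesis
    proof eventually_elim
      case (elim s)
      have 1: "vis m (\<nu> + s *\<^sub>R x) p q \<longleftrightarrow> \<tau> < 0"
      proof
        assume "vis m (\<nu> + s *\<^sub>R x) p q"
        then have "L \<bullet> (z - p) + s * (y \<bullet> (z - p)) < 0" using zV unfolding vis_plus by blast
        then have "s * (y \<bullet> (z - p)) < 0" using on[OF z(2)] by simp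
        then have "y \<bullet> (z - p) < 0" using elim(2) by (simp add: mult_less_0_iff)
        then show "\<tau> < 0" using side[OF zV z(2)] by (simp add: sgn_if)
      next
        assume t: "\<tau> < 0"
        have "L \<bullet> (v - p) + s * (y \<bullet> (v - p)) < 0" if v: "v \<in> ?V" for v
        proof (cases "v \<in> \<Phi>")
          case True
          then have "y \<bullet> (v - p) < 0" using side[OF v True] t by (auto simp: sgn_if split: if_splits)
          then show ?thesis using on[OF True] elim(2) by (simp add: mult_less_0_iff)
        qed (use elim(1) v in blast)
        then show "vis m (\<nu> + s *\<^sub>R x) p q" by (simp add: vis_plus)
      qed
      have 2: "vis m (\<nu> - s *\<^sub>R x) p q \<longleftrightarrow> \<tau> > 0"
      proof
        assume "vis m (\<nu> - s *\<^sub>R x) p q"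
        then have "L \<bullet> (z - p) - s * (y \<bullet> (z - p)) < 0" using zV unfolding vis_minus by blast
        then have "0 < s * (y \<bullet> (z - p))" using on[OF z(2)] by simp
        then have "y \<bullet> (z - p) > 0" using elim(2) by (simp add: zero_less_mult_iff)
        then show "\<tau> > 0" using side[OF zV z(2)] by (simp add: sgn_if)
      next
        assume t: "\<tau> > 0"
        have "L \<bullet> (v - p) - s * (y \<bullet> (v - p)) < 0" if v: "v \<in> ?V" for v
        proof (cases "v \<in> \<Phi>")
          case True
          then have "y \<bullet> (v - p) > 0" using side[OF v True] t by (auto simp: sgn_if split: if_splits)
          then show ?thesis using on[OF True] elim(2) by (simp add: zero_less_mult_iff)
        qed (use elim(1) v in blast)
        then show "vis m (\<nu> - s *\<^sub>R x) p q" by (simp add: vis_minus)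
      qed
      have "\<tau> = 1 \<or> \<tau> = -1" using side[OF zV z(2)] by (auto simp: sgn_if split: if_splits)
      moreover have "- sgn (x \<bullet> k) * sgn (area a b (ccw_dir a b \<Phi> (closed_segment p q)) k) = - \<tau>"
        by (simp add: \<tau>_def ccw)
      ultimately show ?case using True 1 2 by auto
    qed
  next
    case False
    have "eventually (\<lambda>s. vis m (\<nu> + s *\<^sub>R x) p q \<longleftrightarrow> vis m \<nu> p q) (nhds 0)"
      using pq
    proof (cases rule: lam_face_cases[where n = \<nu>])
      case (beaten v)
      then show ?thesis using vis_stable[OF pq] by blast
    next
      case edge
      then show ?thesis using vis_stable[OF pq, of \<nu>] ePq by (simp add: edge_of_def)
    next
      \<comment> \<open>By \<open>nondeg\<close> a larger face containing the edge is a 2-face with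
        direction plane \<open>S\<close>. Then \<open>L\<close> kills \<open>h\<close>, which forces
        \<open>\<beta> = 0\<close>, and the face is \<Phi> itself, against the case
        assumption.\<close>
      case large
      let ?\<Psi> = "max_face P L"
      have face: "?\<Psi> face_of P" by (rule max_face_face_of[OF convex_P])
      have two: "2 \<le> aff_dim ?\<Psi>" using large by (simp add: L_def)
      define \<beta> where "\<beta> = - ((\<nu> \<bullet> ?g) / (m \<bullet> ?g))"
      have L\<beta>: "L = \<nu> + \<beta> *\<^sub>R m" by (simp add: L_def lam_def \<beta>_def)
      have par: "direction_space G = S" if G: "two_face P G" "G \<subseteq> ?\<Psi>" for G
      proof -
        obtain g where g: "g \<in> direction_space G" "g \<noteq> 0" "m \<bullet> g = 0"
          using plane_orth_vector[OF subspace_direction_space two_face_dim[OF G(1)]] by metis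
        have "L \<bullet> g = 0" using max_face_direction_orth direction_space_mono[OF G(2)] g(1) by blast
        then have "\<nu> \<bullet> g = 0" using g(3) by (simp add: L\<beta> inner_add_left)
        then show ?thesis using nondeg[OF G(1) g(1,2) _ g(3)] by blast
      qed
      obtain G where G: "two_face ?\<Psi> G" using two_face_exists[OF polytope_max_face two] .
      have "direction_space G = S"
        using par two_face_of_face[OF G face] G face_of_imp_subset by (auto simp: two_face_def)
      then have "dim S = 2" using two_face_dim[OF G] by simp
      then have \<Psi>: "two_face P ?\<Psi>" "direction_space ?\<Psi> = S"
        using two_face_if_2_faces_parallel[OF poly face two, of S] par frame_subspace[OF fr] by blast+
      then have "L \<bullet> h = 0" using max_face_direction_orth mS(1) by blast
      then have "\<beta> = 0" using \<nu>S[OF mS(1)] mS(2) by (simp add: L\<beta> inner_add_left)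
      then have "L = \<nu>" by (simp add: L\<beta>)
      then have "two_face P \<Phi>" "closed_segment p q edge_of \<Phi>"
        using \<Psi> large ePq edge_of_two_face[of \<Phi>] \<Phi> by (auto simp: L_def)
      then show ?thesis using False by blast
    qed
    from eventually_nhds_0_pm[OF this] show ?thesis
      by (rule eventually_mono) (use False in auto)
  qed
qed

text \<open>Sum of \<open>vis_jump\<close> over all edges. Since \<open>m\<close> is generic, each
  edge of the 2-face occurs exactly once among the upward pairs.\<close>

lemma local_jump:
  assumes gen: "generic m" and fr: "frame a b S" and \<nu>S: "\<And>g. g \<in> S \<Longrightarrow> \<nu> \<bullet> g = 0"
    and mS: "h \<in> S" "m \<bullet> h \<noteq> 0"
    and nondeg: "\<And>G g. two_face P G \<Longrightarrow> g \<in> direction_space G \<Longrightarrow> g \<noteq> 0 \<Longrightarrow> \<nu> \<bullet> g = 0 \<Longrightarrow>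
      m \<bullet> g = 0 \<Longrightarrow> direction_space G = S"
    and k: "k \<in> S" "m \<bullet> k = 0" "x \<bullet> k \<noteq> 0"
  shows "eventually (\<lambda>s. real (card (vis_edges m (\<nu> + s *\<^sub>R x))) - real (card (vis_edges m (\<nu> - s *\<^sub>R x))) =
    - sgn (x \<bullet> k) * edge_sum a b (max_face P \<nu>) k) (at_right 0)"
proof -
  define \<Phi> where "\<Phi> = max_face P \<nu>"
  define c where "c = (\<lambda>(p, q). if two_face P \<Phi> \<and> closed_segment p q edge_of \<Phi>
     then - sgn (x \<bullet> k) * sgn (area a b (ccw_dir a b \<Phi> (closed_segment p q)) k) else (0::real))"
  have "eventually (\<lambda>s. \<forall>pq\<in>up_edges m. (case pq of (p, q) \<Rightarrow> (if vis m (\<nu> + s *\<^sub>R x) p q then 1 else 0)) -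
      (case pq of (p, q) \<Rightarrow> (if vis m (\<nu> - s *\<^sub>R x) p q then 1 else 0)) = c pq) (at_right 0)"
  proof (intro eventually_ball_finite finite_up_edges ballI)
    fix pq assume pq: "pq \<in> up_edges m"
    obtain p q where [simp]: "pq = (p, q)" by force
    show "eventually (\<lambda>s. (case pq of (p, q) \<Rightarrow> (if vis m (\<nu> + s *\<^sub>R x) p q then 1 else 0)) -
      (case pq of (p, q) \<Rightarrow> (if vis m (\<nu> - s *\<^sub>R x) p q then 1 else 0)) = c pq) (at_right 0)"
      using vis_jump[OF assms(2-), where p = p and q = q] pq unfolding c_def \<Phi>_def by simp
  qed
  moreover have "(\<Sum>pq\<in>up_edges m. c pq) = - sgn (x \<bullet> k) * edge_sum a b \<Phi> k"
  proof (cases "two_face P \<Phi>")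
    case False
    then show ?thesis by (simp add: c_def edge_sum_def case_prod_unfold)
  next
    case True
    define f where "f e = - sgn (x \<bullet> k) * sgn (area a b (ccw_dir a b \<Phi> e) k)" for e
    let ?A = "{pq \<in> up_edges m. case pq of (p, q) \<Rightarrow> closed_segment p q edge_of \<Phi>}"
    have bij: "bij_betw (\<lambda>(p, q). closed_segment p q) ?A {e. e edge_of \<Phi>}"
    proof (rule bij_betw_imageI)
      show "inj_on (\<lambda>(p, q). closed_segment p q) ?A"
        by (auto simp: inj_on_def up_edges_def closed_segment_eq doubleton_eq_iff)
      show "(\<lambda>(p, q). closed_segment p q) ` ?A = {e. e edge_of \<Phi>}"
      proof (intro equalityI subsetI)
        fix e assume "e \<in> {e. e edge_of \<Phi>}"
        then have e: "e edge_of \<Phi>" by simp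
        obtain p q where pq: "e = closed_segment p q"
          using edge_endpoints[OF two_face_polytope[OF poly True] e] by metis
        then have eP: "closed_segment p q edge_of P" using e edge_of_two_face[OF True] by simp
        then have "m \<bullet> (q - p) \<noteq> 0" using gen by (simp add: generic_def)
        then consider "m \<bullet> p < m \<bullet> q" | "m \<bullet> q < m \<bullet> p" by (fastforce simp: inner_diff_right)
        then show "e \<in> (\<lambda>(p, q). closed_segment p q) ` ?A"
        proof cases
          case 1
          then have "(p, q) \<in> ?A" using e pq eP by (simp add: up_edges_def)
          then show ?thesis using pq by force
        next
          case 2
          then have "(q, p) \<in> ?A" using e pq eP by (simp add: up_edges_def closed_segment_commute)
          moreover have "e = closed_segment q p" using pq by (simp add: closed_segment_commute)
          ultimately show ?thesis by force
        qed
      qed auto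
    qed
    have "(\<Sum>pq\<in>up_edges m. c pq) = (\<Sum>pq\<in>?A. f (case pq of (p, q) \<Rightarrow> closed_segment p q))"
      by (rule sum.mono_neutral_cong_right[OF finite_up_edges]) (auto simp: c_def f_def True split: if_splits)
    also have "\<dots> = (\<Sum>e | e edge_of \<Phi>. f e)"
      using sum.reindex_bij_betw[OF bij, of f] by (simp add: case_prod_unfold)
    also have "\<dots> = - sgn (x \<bullet> k) * edge_sum a b \<Phi> k"
      by (simp add: f_def edge_sum_def True sum_distrib_left sum_negf)
    finally show ?thesis .
  qed
  ultimately show ?thesis
  proof (elim eventually_mono)
    fix s
    assume s: "\<forall>pq\<in>up_edges m. (case pq of (p, q) \<Rightarrow> (if vis m (\<nu> + s *\<^sub>R x) p q then 1 else 0)) -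
      (case pq of (p, q) \<Rightarrow> (if vis m (\<nu> - s *\<^sub>R x) p q then 1 else 0)) = c pq"
    assume c: "(\<Sum>pq\<in>up_edges m. c pq) = - sgn (x \<bullet> k) * edge_sum a b \<Phi> k"
    show "real (card (vis_edges m (\<nu> + s *\<^sub>R x))) - real (card (vis_edges m (\<nu> - s *\<^sub>R x))) =
      - sgn (x \<bullet> k) * edge_sum a b (max_face P \<nu>) k"
      unfolding card_vis_edges sum_subtractf[symmetric] \<Phi>_def[symmetric] c[symmetric]
      by (rule sum.cong[OF refl]) (use s in blast)
  qed
qed

end

subsection \<open>Normals of simultaneously visible 2-faces\<close>

text \<open>A subspace is not covered by finitely many hyperplanes none of which contains it: adding
  a small multiple of a vector off the new hyperplane corrects the choice there without spoiling the
  earlier conditions.\<close>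

lemma subspace_avoid:
  fixes W :: "'a::real_inner set"
  assumes "subspace W" "finite D" "\<And>d. d \<in> D \<Longrightarrow> \<exists>w\<in>W. w \<bullet> d \<noteq> 0"
  obtains w where "w \<in> W" "\<And>d. d \<in> D \<Longrightarrow> w \<bullet> d \<noteq> 0"
proof -
  have "\<exists>w\<in>W. \<forall>d\<in>D. w \<bullet> d \<noteq> 0"
    using assms(2,3)
  proof (induction D rule: finite_induct)
    case empty
    then show ?case using subspace_0[OF assms(1)] by blast
  next
    case (insert e D)
    then obtain w where w: "w \<in> W" "\<And>d. d \<in> D \<Longrightarrow> w \<bullet> d \<noteq> 0" by blast
    show ?case
    proof (cases "w \<bullet> e = 0")
      case False then show ?thesis using w by blast
    next
      case True
      obtain u where u: "u \<in> W" "u \<bullet> e \<noteq> 0" using insert.prems by blast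
      have "eventually (\<lambda>t. (w + t *\<^sub>R u) \<bullet> d \<noteq> 0) (at_right 0)" if "d \<in> D" for d
      proof -
        have "((\<lambda>t. (w + t *\<^sub>R u) \<bullet> d) \<longlongrightarrow> (w + 0 *\<^sub>R u) \<bullet> d) (at_right 0)" by (intro tendsto_intros)
        then show ?thesis using w(2)[OF that] by (intro tendsto_imp_eventually_ne) auto
      qed
      then have "eventually (\<lambda>t. \<forall>d\<in>D. (w + t *\<^sub>R u) \<bullet> d \<noteq> 0) (at_right 0)"
        using insert.hyps(1) by (intro eventually_ball_finite) auto
      moreover have "eventually (\<lambda>t::real. t > 0) (at_right 0)" by (simp add: eventually_at_filter)
      ultimately have "eventually (\<lambda>t. (\<forall>d\<in>D. (w + t *\<^sub>R u) \<bullet> d \<noteq> 0) \<and> t > 0) (at_right 0)"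
        by (rule eventually_conj)
      then obtain t where t: "\<forall>d\<in>D. (w + t *\<^sub>R u) \<bullet> d \<noteq> 0" "t > 0"
        using eventually_happens'[OF trivial_limit_at_right_real] by blast
      have "(w + t *\<^sub>R u) \<bullet> e \<noteq> 0" using True t(2) u(2) by (simp add: inner_add_left)
      then show ?thesis using t(1) w(1) u(1) assms(1)
        by (intro bexI[of _ "w + t *\<^sub>R u"]) (auto intro: subspace_add subspace_scale)
    qed
  qed
  then show ?thesis using that by blast
qed

context full_polytope begin

lemma direction_P: "direction_space P = UNIV"
proof -
  have "dim (direction_space P) = DIM('a)" using dim_direction_space[OF P_ne] full by simp
  then show ?thesis using subspace_dim_equal[of "direction_space P" UNIV] by simp
qed

lemma max_face_ne_P: "w \<noteq> 0 \<Longrightarrow> max_face P w \<noteq> P"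
  using max_face_direction_orth[of w P w] direction_P by fastforce

text \<open>Otherwise \<open>w\<close> would be constant on \<open>P\<close>, which is impossible
  for a full-dimensional polytope.\<close>

lemma max_face_opposite:
  assumes "w \<noteq> 0" "x \<in> max_face P w" "y \<in> max_face P (- w)"
  shows "w \<bullet> y < w \<bullet> x"
proof (rule ccontr)
  assume n: "\<not> w \<bullet> y < w \<bullet> x"
  have "w \<bullet> z \<le> w \<bullet> x" "w \<bullet> y \<le> w \<bullet> z" if "z \<in> P" for z
    using assms(2,3) that by (auto simp: max_face_def)
  then have "max_face P w = P" using n by (force simp: max_face_def)
  then show False using max_face_ne_P assms(1) by blast
qed

lemma max_face_ne_opposite: "w \<noteq> 0 \<Longrightarrow> max_face P w \<noteq> max_face P (- w)"
  using max_face_opposite max_face_nonempty by blast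

lemma finite_edge_dirs: "finite ((\<lambda>(p, q). q - p) ` {(p, q). closed_segment p q edge_of P})"
proof -
  have "{(p, q). closed_segment p q edge_of P} \<subseteq> {v. v extreme_point_of P} \<times> {v. v extreme_point_of P}"
    using edge_segment[OF poly] by auto
  then show ?thesis using finite_verts finite_subset by blast
qed

lemma finite_two_faces: "finite {G. two_face P G}"
  by (rule finite_subset[OF _ finite_polytope_faces[OF poly]]) (auto simp: two_face_def)

lemma two_faceD:
  assumes "two_face P G"
  shows "polytope G" "convex G" "G \<noteq> {}" "G \<subseteq> P" "G face_of P" "aff_dim G = 2"
  using assms two_face_polytope[OF poly assms] two_face_nonempty[OF assms]
    polytope_imp_convex[of G] face_of_imp_subset[of G P]
  by (auto simp: two_face_def)

lemma two_face_edge: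
  assumes "two_face P G"
  obtains p q where "closed_segment p q edge_of P" "closed_segment p q edge_of G" "q - p \<in> direction_space G"
    "q - p \<noteq> 0" "p \<in> G" "q \<in> G"
proof -
  obtain e where e: "e face_of G" "aff_dim e = 1"
    using polytope_face_of_dim[of G 1] two_faceD[OF assms] by auto
  then have "e edge_of G" by (simp add: edge_of_def)
  then obtain p q where pq: "e = closed_segment p q"
    using edge_endpoints two_faceD(1)[OF assms] by metis
  then have eG: "closed_segment p q edge_of G" using e by (simp add: edge_of_def)
  then have eP: "closed_segment p q edge_of P" "p \<in> G" "q \<in> G"
    using edge_of_two_face[OF assms] by auto
  moreover have "q - p \<noteq> 0" using edge_segment(1)[OF poly eP(1)] by simp
  moreover have "q - p \<in> direction_space G" using eP by (simp add: diff_in_direction_space)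
  ultimately show ?thesis using that eG by blast
qed

text \<open>A face is the intersection of the polytope with its affine hull, and the latter is
  determined by one point and the direction plane.\<close>

lemma parallel_two_faces_eq:
  assumes "two_face P F" "two_face P G" "direction_space F = direction_space G" "p \<in> F" "p \<in> G"
  shows "F = G"
proof -
  have "F \<subseteq> G" if "two_face P F" "two_face P G" "direction_space F = direction_space G" "p \<in> F" "p \<in> G" for F G
  proof
    fix x assume "x \<in> F"
    then have "x - p \<in> direction_space G" using that diff_in_direction_space by blast
    then have "x \<in> affine hull G" using affine_hull_direction_space that by blast
    moreover have "x \<in> P" using \<open>x \<in> F\<close> two_faceD(4)[OF that(1)] by auto
    ultimately show "x \<in> G"
      using face_of_imp_eq_affine_Int[OF convex_P two_faceD(5)[OF that(2)]] by blast
  qed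
  then show ?thesis using assms by (metis subset_antisym)
qed

text \<open>Tilt a functional exposing \<open>e\<close> away from one exposing \<open>F\<close> until a vertex outside \<open>F\<close>
  becomes maximal as well.\<close>

lemma other_two_face:
  assumes F: "two_face P F" and e: "e edge_of F"
  obtains G where "two_face P G" "e \<subseteq> G" "G \<noteq> F"
proof -
  have eF: "e face_of F" "aff_dim e = 1" using e by (auto simp: edge_of_def)
  then have eP: "e face_of P" using F face_of_trans by (auto simp: two_face_def)
  have "e \<noteq> {}" using eF by auto
  then obtain p where p: "p \<in> e" by auto
  have pF: "p \<in> F" "p \<in> P" using p face_of_imp_subset eF eP by blast+
  obtain we where we: "e = max_face P we" using exposed_as_max_face[OF poly eP \<open>e \<noteq> {}\<close>] .
  obtain wF where wF: "F = max_face P wF" using exposed_as_max_face[OF poly two_faceD(5,3)[OF F]] .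
  define Z where "Z = {v. v extreme_point_of P \<and> v \<notin> F}"
  have "finite Z" by (rule finite_subset[OF _ finite_verts]) (auto simp: Z_def)
  moreover have "Z \<noteq> {}"
  proof
    assume "Z = {}"
    then have "convex hull {v. v extreme_point_of P} \<subseteq> F"
      by (intro hull_minimal) (auto simp: Z_def two_faceD[OF F])
    then have "P \<subseteq> F" using polytope_eq_hull[OF poly] by simp
    then have "aff_dim P \<le> aff_dim F" by (rule aff_dim_subset)
    then show False using full dim3 two_faceD(6)[OF F] by simp
  qed
  \<comment> \<open>\<open>r v\<close> is the amount of tilt at which \<open>v\<close> reaches the
    value of \<open>p\<close>; the smallest of these amounts is used.\<close>
  define r where "r v = (we \<bullet> p - we \<bullet> v) / (wF \<bullet> p - wF \<bullet> v)" for v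
  obtain v0 where v0: "v0 \<in> Z" "\<And>v. v \<in> Z \<Longrightarrow> r v0 \<le> r v"
    using ex_is_arg_min_if_finite[OF \<open>finite Z\<close> \<open>Z \<noteq> {}\<close>, of r] by (auto simp: is_arg_min_linorder)
  have below: "wF \<bullet> v < wF \<bullet> p" if "v \<in> P" "v \<notin> F" for v
    using that pF(1) unfolding wF max_face_def by force
  have ebelow: "we \<bullet> v \<le> we \<bullet> p" if "v \<in> P" for v
    using that p unfolding we max_face_def by force
  define w where "w = we - r v0 *\<^sub>R wF"
  have ext: "v \<in> P" if "v extreme_point_of P" for v using that by (simp add: extreme_point_of_def)
  have wle: "w \<bullet> v \<le> w \<bullet> p" if v: "v extreme_point_of P" for v
  proof (cases "v \<in> F")
    case True
    then have "wF \<bullet> v = wF \<bullet> p" using pF(1) max_face_inner unfolding wF by blast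
    then show ?thesis using ebelow[OF ext[OF v]] by (simp add: w_def inner_diff_left)
  next
    case False
    then have "r v0 \<le> r v" "wF \<bullet> v < wF \<bullet> p" using v0 v below[OF ext[OF v]] by (auto simp: Z_def)
    then have "r v0 * (wF \<bullet> p - wF \<bullet> v) \<le> we \<bullet> p - we \<bullet> v" by (simp add: r_def[of v] field_simps)
    then show ?thesis by (simp add: w_def inner_diff_left algebra_simps)
  qed
  have pM: "p \<in> max_face P w" by (rule in_max_faceI[OF pF(2) wle])
  have v0P: "v0 \<in> P" "v0 \<notin> F" using v0 ext by (auto simp: Z_def)
  then have "r v0 * (wF \<bullet> p - wF \<bullet> v0) = we \<bullet> p - we \<bullet> v0"
    using below[OF v0P] by (simp add: r_def)
  then have "w \<bullet> v0 = w \<bullet> p" by (simp add: w_def inner_diff_left algebra_simps)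
  then have v0M: "v0 \<in> max_face P w" using pM v0P by (simp add: max_face_def)
  have eM: "e \<subseteq> max_face P w"
  proof
    fix x assume x: "x \<in> e"
    then have xF: "x \<in> F" "x \<in> P" using face_of_imp_subset eF eP by blast+
    have "we \<bullet> x = we \<bullet> p" using x p max_face_inner unfolding we by blast
    moreover have "wF \<bullet> x = wF \<bullet> p" using xF pF max_face_inner unfolding wF by blast
    ultimately have "w \<bullet> x = w \<bullet> p" by (simp add: w_def inner_diff_left)
    then show "x \<in> max_face P w" using pM xF by (simp add: max_face_def)
  qed
  \<comment> \<open>On \<open>F\<close> the functional \<open>wF\<close> is constant, so the tilt
    does not help points of \<open>F\<close> off \<open>e\<close>: they stay strictly below
    \<open>e\<close>.\<close>
  have "\<not> F \<subseteq> max_face P w"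
  proof
    assume sub: "F \<subseteq> max_face P w"
    have "F \<noteq> e" using eF two_faceD(6)[OF F] by auto
    then obtain u where u: "u \<in> F" "u \<notin> e" using face_of_imp_subset[OF eF(1)] by blast
    then have "u \<in> P" using two_faceD(4)[OF F] by auto
    then have "we \<bullet> u < we \<bullet> p" using u(2) p unfolding we max_face_def by force
    moreover have "wF \<bullet> u = wF \<bullet> p" using u(1) pF(1) max_face_inner unfolding wF by blast
    ultimately have "w \<bullet> u < w \<bullet> p" by (simp add: w_def inner_diff_left)
    moreover have "w \<bullet> u = w \<bullet> p" using sub u(1) pM max_face_inner by blast
    ultimately show False by simp
  qed
  moreover have "2 \<le> aff_dim (max_face P w)"
  proof -
    have face: "max_face P w face_of P" by (rule max_face_face_of[OF convex_P])
    have "e face_of max_face P w" using face_of_face[OF face] eP eM by simp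
    moreover have "e \<noteq> max_face P w" using v0M v0P face_of_imp_subset[OF eF(1)] by blast
    ultimately have "aff_dim e < aff_dim (max_face P w)"
      using face_of_aff_dim_lt[OF face_of_imp_convex[OF face]] by blast
    then show ?thesis using eF by simp
  qed
  moreover have "e face_of max_face P w"
    using face_of_face[OF max_face_face_of[OF convex_P]] eP eM by blast
  ultimately obtain G where G: "G face_of max_face P w" "aff_dim G = 2" "e \<subseteq> G"
    using face_between_dim[OF polytope_max_face _ \<open>e \<noteq> {}\<close>, of w 2] eF(2) by auto
  have "G \<noteq> F" using G face_of_imp_subset \<open>\<not> F \<subseteq> max_face P w\<close> by blast
  moreover have "two_face P G"
    using G(2) face_of_trans[OF G(1) max_face_face_of[OF convex_P]] by (simp add: two_face_def)
  ultimately show ?thesis using that G by blast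
qed

text \<open>The right side makes \<open>n\<close> and \<open>m\<close> independent: were both
  multiples of one \<open>u\<close>, any 2-face would contain a nonzero direction killed by
  \<open>u\<close>, hence by both.\<close>

lemma admissible_span_iff:
  "admissible P (span {n, m}) \<longleftrightarrow>
    (\<forall>G g. two_face P G \<longrightarrow> g \<in> direction_space G \<longrightarrow> g \<noteq> 0 \<longrightarrow> m \<bullet> g = 0 \<longrightarrow> n \<bullet> g \<noteq> 0)"
  (is "_ \<longleftrightarrow> ?R")
proof
  assume "admissible P (span {n, m})"
  then show ?R unfolding admissible_iff
    by (metis (no_types, lifting) add.right_neutral inner_add_left inner_scaleR_left mult_zero_right span_pair)
next
  assume R: ?R
  have "dim (span {n, m}) = 2"
  proof (rule ccontr)
    assume ne: "dim (span {n, m}) \<noteq> 2"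
    have "\<exists>u. n \<in> span {u} \<and> m \<in> span {u}"
    proof (cases "n = 0")
      case True then show ?thesis by (intro exI[of _ m]) (auto intro: span_base span_zero)
    next
      case False
      have "m \<in> span {n}"
      proof (rule ccontr)
        assume m: "m \<notin> span {n}"
        then have "independent {n, m}"
          using False independent_insert[of m "{n}"] by (simp add: insert_commute dependent_single)
        moreover have "n \<noteq> m" using m by (auto intro: span_base)
        ultimately show False using ne by (simp add: dim_eq_card_independent)
      qed
      then show ?thesis by (intro exI[of _ n]) (auto intro: span_base)
    qed
    then obtain u where u: "n \<in> span {u}" "m \<in> span {u}" by blast
    have "2 \<le> aff_dim P" using full dim3 by simp
    then obtain G where G: "two_face P G" using two_face_exists[OF poly] by blast
    obtain g where g: "g \<in> direction_space G" "g \<noteq> 0" "u \<bullet> g = 0"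
      using plane_orth_vector[OF subspace_direction_space two_face_dim[OF G]] by metis
    then have "n \<bullet> g = 0" "m \<bullet> g = 0" using u by (auto simp: span_singleton)
    then show False using R G g by blast
  qed
  then have "linear_plane (span {n, m})" by (simp add: linear_plane_def)
  moreover have "n \<in> span {n, m}" "m \<in> span {n, m}" by (auto intro: span_base)
  ultimately show "admissible P (span {n, m})" using R unfolding admissible_iff by blast
qed

text \<open>A generic \<open>m\<close> does not vanish on the edge directions of \<open>G\<close>,
  so its kernel in the direction plane is exactly one line.\<close>

lemma null_line:
  assumes "generic m" "two_face P G"
  shows "\<exists>\<gamma>. \<gamma> \<in> direction_space G \<and> \<gamma> \<noteq> 0 \<and> m \<bullet> \<gamma> = 0 \<and>
    (\<forall>g\<in>direction_space G. m \<bullet> g = 0 \<longrightarrow> (\<exists>c. g = c *\<^sub>R \<gamma>))"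
proof -
  obtain \<gamma> where \<gamma>: "\<gamma> \<in> direction_space G" "\<gamma> \<noteq> 0" "m \<bullet> \<gamma> = 0"
    using plane_orth_vector[OF subspace_direction_space two_face_dim[OF assms(2)]] by metis
  obtain p q where pq: "closed_segment p q edge_of P" "q - p \<in> direction_space G"
    using two_face_edge[OF assms(2)] by metis
  have "\<exists>c. g = c *\<^sub>R \<gamma>" if g: "g \<in> direction_space G" "m \<bullet> g = 0" for g
  proof (rule ccontr)
    assume "\<nexists>c. g = c *\<^sub>R \<gamma>"
    then have "g \<notin> span {\<gamma>}" by (auto simp: span_singleton)
    then have "direction_space G = span {\<gamma>, g}"
      using plane_eq_span[OF subspace_direction_space two_face_dim[OF assms(2)]] \<gamma> g by blast
    then have "m \<bullet> (q - p) = 0" using pq(2) \<gamma> g by (auto simp: span_pair inner_add_right simp del: inner_diff_right)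
    then show False using assms(1) pq(1) by (simp add: generic_def)
  qed
  then show ?thesis using \<gamma> by blast
qed

text \<open>A generator of the line in the direction plane of \<open>G\<close> orthogonal to a
  generic \<open>m\<close>. With \<open>m\<close> fixed, \<open>span {n, m}\<close> degenerates
  \<open>G\<close> exactly when \<open>n\<close> lies in the hyperplane orthogonal to this vector;
  these hyperplanes are the walls.\<close>

definition null_vec :: "'a \<Rightarrow> 'a set \<Rightarrow> 'a" where
  "null_vec m G = (SOME \<gamma>. \<gamma> \<in> direction_space G \<and> \<gamma> \<noteq> 0 \<and> m \<bullet> \<gamma> = 0 \<and>
    (\<forall>g\<in>direction_space G. m \<bullet> g = 0 \<longrightarrow> (\<exists>c. g = c *\<^sub>R \<gamma>)))"

lemma null_vec:
  assumes "generic m" "two_face P G"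
  shows "null_vec m G \<in> direction_space G" "null_vec m G \<noteq> 0" "m \<bullet> null_vec m G = 0"
    "\<And>g. g \<in> direction_space G \<Longrightarrow> m \<bullet> g = 0 \<Longrightarrow> \<exists>c. g = c *\<^sub>R null_vec m G"
  using someI_ex[OF null_line[OF assms]] unfolding null_vec_def[symmetric] by auto

lemma admissible_null_vec:
  assumes "generic m"
  shows "admissible P (span {n, m}) \<longleftrightarrow> (\<forall>G. two_face P G \<longrightarrow> n \<bullet> null_vec m G \<noteq> 0)"
proof -
  have "(\<forall>g. g \<in> direction_space G \<longrightarrow> g \<noteq> 0 \<longrightarrow> m \<bullet> g = 0 \<longrightarrow> n \<bullet> g \<noteq> 0) \<longleftrightarrow> n \<bullet> null_vec m G \<noteq> 0"
    if G: "two_face P G" for G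
  proof
    assume *: "n \<bullet> null_vec m G \<noteq> 0"
    show "\<forall>g. g \<in> direction_space G \<longrightarrow> g \<noteq> 0 \<longrightarrow> m \<bullet> g = 0 \<longrightarrow> n \<bullet> g \<noteq> 0"
    proof (intro allI impI)
      fix g assume g: "g \<in> direction_space G" "g \<noteq> 0" "m \<bullet> g = 0"
      then obtain c where "g = c *\<^sub>R null_vec m G" using null_vec(4)[OF assms G] by blast
      then show "n \<bullet> g \<noteq> 0" using * g(2) by auto
    qed
  qed (use null_vec[OF assms G] in blast)
  then show ?thesis unfolding admissible_span_iff by blast
qed

definition nverts :: "'a set \<Rightarrow> nat" where
  "nverts W = card {v. v extreme_point_of (orth_proj W ` P)}"

lemma nverts_vis:
  assumes "admissible P (span {n, m})" "generic m"
  shows "nverts (span {n, m}) = card (vis_edges m n) + card (vis_edges m (- n))"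
  unfolding nverts_def by (rule card_vertices_projection[OF assms])

lemma admissible_perturb:
  assumes gen: "generic m" and adm: "admissible P (span {n, m})"
  shows "eventually (\<lambda>s. admissible P (span {n + s *\<^sub>R x, m})) (nhds 0)"
proof -
  have "eventually (\<lambda>s. \<forall>G\<in>{G. two_face P G}. (n + s *\<^sub>R x) \<bullet> null_vec m G \<noteq> 0) (nhds 0)"
  proof (intro eventually_ball_finite finite_two_faces ballI)
    fix G assume "G \<in> {G. two_face P G}"
    then have ne: "n \<bullet> null_vec m G \<noteq> 0" using adm admissible_null_vec[OF gen] by blast
    have "((\<lambda>s. (n + s *\<^sub>R x) \<bullet> null_vec m G) \<longlongrightarrow> (n + 0 *\<^sub>R x) \<bullet> null_vec m G) (nhds 0)"
      by (intro tendsto_inner tendsto_add tendsto_scaleR tendsto_const filterlim_ident)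
    then show "eventually (\<lambda>s. (n + s *\<^sub>R x) \<bullet> null_vec m G \<noteq> 0) (nhds 0)"
      using ne by (intro tendsto_imp_eventually_ne) auto
  qed
  then show ?thesis by (rule eventually_mono) (use admissible_null_vec[OF gen] in blast)
qed

lemma nverts_locally_constant:
  assumes gen: "generic m" and adm: "admissible P (span {n, m})"
  shows "eventually (\<lambda>s. admissible P (span {n + s *\<^sub>R x, m}) \<and>
    nverts (span {n + s *\<^sub>R x, m}) = nverts (span {n, m})) (nhds 0)"
proof -
  have adm': "admissible P (span {- n, m})"
    using adm by (simp add: admissible_null_vec[OF gen])
  show ?thesis
    using admissible_perturb[OF gen adm, of x] vis_locally_constant[OF adm, of x]
      vis_locally_constant[OF adm', of "- x"]
  proof eventually_elim
    case (elim s)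
    then show ?case using nverts_vis[OF _ gen] adm by simp
  qed
qed

text \<open>The projected polygon is supported at the image of a relatively interior point of
  \<open>G\<close>. Up to sign, the projection to \<open>W\<close> of the supporting functional has
  its maximum over \<open>P\<close> at this point, hence on all of \<open>G\<close>.\<close>

lemma projects_to_boundary_max_face:
  assumes W: "linear_plane W" and G: "two_face P G" and b: "projects_to_boundary P W G"
  obtains w where "w \<in> W" "w \<noteq> 0" "G \<subseteq> max_face P w"
proof -
  have sW: "subspace W" using W by (simp add: linear_plane_def)
  interpret p: linear "orth_proj W" using linear_orth_proj[OF sW] .
  have polyW: "polytope (orth_proj W ` P)" using polytope_linear_image[OF p.linear_axioms poly] .
  obtain x0 where x0: "x0 \<in> rel_interior G"
    using rel_interior_eq_empty two_faceD(2,3)[OF G] by blast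
  then have x0G: "x0 \<in> G" "x0 \<in> P" using rel_interior_subset two_faceD(4)[OF G] by blast+
  then have "orth_proj W x0 \<in> rel_frontier (orth_proj W ` P)"
    using b by (auto simp: projects_to_boundary_def)
  then have nri: "orth_proj W x0 \<notin> rel_interior (orth_proj W ` P)" by (simp add: rel_frontier_def)
  have "orth_proj W x0 \<in> orth_proj W ` P" using x0G by simp
  then obtain a where a: "\<And>y. y \<in> orth_proj W ` P \<Longrightarrow> a \<bullet> orth_proj W x0 \<le> a \<bullet> y"
    "\<And>y. y \<in> rel_interior (orth_proj W ` P) \<Longrightarrow> a \<bullet> orth_proj W x0 < a \<bullet> y"
    using supporting_hyperplane_rel_boundary[OF polytope_imp_convex[OF polyW] _ nri] by metis
  \<comment> \<open>The sign turns the minimum supplied by the supporting hyperplane into a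
    maximum.\<close>
  define w where "w = - orth_proj W a"
  have wW: "w \<in> W" unfolding w_def using orth_proj(1)[OF sW] sW by (simp add: subspace_neg)
  have eq: "a \<bullet> orth_proj W y = - (w \<bullet> y)" for y
    using inner_orth_proj[OF sW orth_proj(1)[OF sW], of y a] inner_orth_proj[OF sW orth_proj(1)[OF sW], of a y]
    by (simp add: w_def inner_commute)
  have "x0 \<in> max_face P w"
    using a(1)[OF imageI] x0G by (auto simp: max_face_def eq)
  then have "G \<subseteq> max_face P w"
    using subset_of_face_of[OF max_face_face_of[OF convex_P] two_faceD(4)[OF G]] x0 by blast
  moreover have "w \<noteq> 0"
  proof
    assume "w = 0"
    obtain y where y: "y \<in> rel_interior (orth_proj W ` P)"
      using rel_interior_eq_empty[OF polytope_imp_convex[OF polyW]] P_ne by blast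
    then obtain z where "y = orth_proj W z" using rel_interior_subset by blast
    then show False using a(2)[OF y] eq[of x0] eq[of z] \<open>w = 0\<close> by simp
  qed
  ultimately show ?thesis using that wW by blast
qed

text \<open>The image is a proper face of the projected polygon, because \<open>w\<close> is not
  constant on a full-dimensional polytope.\<close>

lemma max_face_projects_to_boundary:
  assumes W: "subspace W" and w: "w \<in> W" "w \<noteq> 0"
  shows "projects_to_boundary P W (max_face P w)"
proof -
  interpret p: linear "orth_proj W" using linear_orth_proj[OF W] .
  have cW: "convex (orth_proj W ` P)"
    using polytope_linear_image[OF p.linear_axioms poly] polytope_imp_convex by blast
  have eq: "orth_proj W ` max_face P w = max_face (orth_proj W ` P) w"
    using inner_orth_proj[OF W w(1)] by (auto simp: max_face_def)
  have "max_face (orth_proj W ` P) w \<noteq> orth_proj W ` P"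
  proof
    assume *: "max_face (orth_proj W ` P) w = orth_proj W ` P"
    have "max_face P w = P"
    proof (intro subset_antisym max_face_subset subsetI)
      fix x assume x: "x \<in> P"
      then have "orth_proj W x \<in> max_face (orth_proj W ` P) w" using * by simp
      then show "x \<in> max_face P w" using x inner_orth_proj[OF W w(1)] by (auto simp: max_face_def)
    qed
    then show False using max_face_ne_P w by blast
  qed
  then show ?thesis
    unfolding projects_to_boundary_def eq
    using face_of_subset_rel_frontier[OF max_face_face_of[OF cW]] by blast
qed

lemma only_degenerating_max_face:
  assumes W: "linear_plane W" and F: "two_face P F" and od: "only_degenerating P W F"
    and w: "w \<in> W" "w \<noteq> 0" and G: "two_face P G" "G \<subseteq> max_face P w"
  shows "direction_space G = direction_space F"
proof -
  have sW: "subspace W" "dim W = 2" using W by (auto simp: linear_plane_def)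
  obtain w' where w': "W = span {w, w'}" using plane_basis[OF sW w] by metis
  obtain g where g: "g \<in> direction_space G" "g \<noteq> 0" "w' \<bullet> g = 0"
    using plane_orth_vector[OF subspace_direction_space two_face_dim[OF G(1)]] by metis
  have "w \<bullet> g = 0" using direction_space_mono[OF G(2)] g(1) max_face_direction_orth by blast
  then have "\<forall>u\<in>W. u \<bullet> g = 0" using g(3) w' by (auto simp: span_pair inner_add_left)
  then show ?thesis using od only_degenerating_iff[OF sW(1) F] G(1) g by blast
qed

text \<open>All 2-faces of the exposed face around \<open>G\<close> are parallel to
  \<open>G\<close>, so this face is itself a 2-face, and it equals \<open>G\<close>.\<close>

lemma visible_max_face:
  assumes W: "linear_plane W" and F: "two_face P F" and od: "only_degenerating P W F"
    and G: "two_face P G" "direction_space G = direction_space F" and b: "projects_to_boundary P W G"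
  obtains w where "w \<in> W" "w \<noteq> 0" "max_face P w = G"
proof -
  obtain w where w: "w \<in> W" "w \<noteq> 0" "G \<subseteq> max_face P w"
    using projects_to_boundary_max_face[OF W G(1) b] .
  have "2 \<le> aff_dim (max_face P w)" using aff_dim_subset[OF w(3)] two_faceD(6)[OF G(1)] by simp
  then have tf: "two_face P (max_face P w)" "direction_space (max_face P w) = direction_space F"
    using two_face_if_2_faces_parallel[OF poly max_face_face_of[OF convex_P] _ two_face_dim[OF F] subspace_direction_space]
      only_degenerating_max_face[OF W F od w(1,2)] by blast+
  obtain p where "p \<in> G" using two_faceD(3)[OF G(1)] by blast
  then have "G = max_face P w"
    using parallel_two_faces_eq[OF G(1) tf(1)] G(2) tf(2) w(3) by auto
  then show ?thesis using that w by blast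
qed

text \<open>The second 2-face at an edge of \<open>F\<close> belongs to another class and does not
  degenerate, so \<open>W\<close> does not vanish on that edge. Hence the functionals in
  \<open>W\<close> that vanish on \<open>direction_space F\<close> lie on one line, which makes the
  normals of two visible faces proportional.\<close>

lemma plane_not_orthogonal:
  assumes W: "linear_plane W" and F: "two_face P F" and od: "only_degenerating P W F"
  obtains u g where "u \<in> W" "g \<in> direction_space F" "u \<bullet> g \<noteq> 0"
proof -
  have sW: "subspace W" using W by (simp add: linear_plane_def)
  obtain p q where pq: "closed_segment p q edge_of F" "q - p \<in> direction_space F" "q - p \<noteq> 0" "p \<in> F"
    using two_face_edge[OF F] by metis
  obtain G where G: "two_face P G" "closed_segment p q \<subseteq> G" "G \<noteq> F"
    using other_two_face[OF F pq(1)] .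
  have "direction_space G \<noteq> direction_space F"
    using parallel_two_faces_eq[OF G(1) F _ _ pq(4)] G(2,3) by auto
  moreover have "q - p \<in> direction_space G"
    using G(2) by (intro diff_in_direction_space) auto
  ultimately have "\<not> (\<forall>w\<in>W. w \<bullet> (q - p) = 0)"
    using od only_degenerating_iff[OF sW F] G(1) pq(3) by blast
  then show ?thesis using that pq(2) by blast
qed

lemma max_face_scale: "c > 0 \<Longrightarrow> max_face P (c *\<^sub>R w) = max_face P w"
  by (auto simp: max_face_def)

text \<open>Replaces visibility, which speaks of some plane \<open>W\<close>, by a single functional
  \<nu> whose two signs expose \<open>F\<close> and its partner. A 2-face orthogonal to \<nu>
  contains a direction killed by all of \<open>W\<close>, so it belongs to the only degenerating
  class.\<close>

lemma visible_normal:
  assumes vis: "simultaneously_visible P F F'"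
  obtains \<nu> where "\<nu> \<noteq> 0" "max_face P \<nu> = F" "two_face P F"
    "\<And>G. two_face P G \<Longrightarrow> (\<And>g. g \<in> direction_space G \<Longrightarrow> \<nu> \<bullet> g = 0) \<Longrightarrow> direction_space G = direction_space F"
    "if F' = {} then \<not> two_face P (max_face P (- \<nu>)) else max_face P (- \<nu>) = F' \<and> two_face P F'"
proof -
  obtain W where F: "two_face P F" and W: "linear_plane W" and od: "only_degenerating P W F"
    and bF: "projects_to_boundary P W F"
    and F': "if F' = {} then (\<forall>G. two_face P G \<and> parallel_faces G F \<and> G \<noteq> F \<longrightarrow> \<not> projects_to_boundary P W G)
      else two_face P F' \<and> direction_space F' = direction_space F \<and> F' \<noteq> F \<and> projects_to_boundary P W F'"
    using vis by (cases "F' = {}") (auto simp: simultaneously_visible_def parallel_faces_def)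
  have sW: "subspace W" "dim W = 2" using W by (auto simp: linear_plane_def)
  obtain w where w: "w \<in> W" "w \<noteq> 0" "max_face P w = F"
    using visible_max_face[OF W F od F refl bF] .
  obtain u g where u: "u \<in> W" "g \<in> direction_space F" "u \<bullet> g \<noteq> 0"
    using plane_not_orthogonal[OF W F od] .
  have minus: "- w \<in> W" "- w \<noteq> 0" using w sW by (auto simp: subspace_neg)
  have FF: "max_face P w \<noteq> max_face P (- w)" by (rule max_face_ne_opposite[OF w(2)])
  show ?thesis
  proof (rule that[OF w(2,3) F])
    fix G assume G: "two_face P G" "\<And>g. g \<in> direction_space G \<Longrightarrow> w \<bullet> g = 0"
    obtain w' where w': "W = span {w, w'}" using plane_basis[OF sW w(1,2)] by metis
    obtain h where h: "h \<in> direction_space G" "h \<noteq> 0" "w' \<bullet> h = 0"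
      using plane_orth_vector[OF subspace_direction_space two_face_dim[OF G(1)]] by metis
    then have "\<forall>u\<in>W. u \<bullet> h = 0" using G(2) w' by (auto simp: span_pair inner_add_left)
    then show "direction_space G = direction_space F"
      using od only_degenerating_iff[OF sW(1) F] G(1) h by blast
  next
    show "if F' = {} then \<not> two_face P (max_face P (- w)) else max_face P (- w) = F' \<and> two_face P F'"
    proof (cases "F' = {}")
      case True
      have "\<not> two_face P (max_face P (- w))"
      proof
        assume tf: "two_face P (max_face P (- w))"
        have "direction_space (max_face P (- w)) = direction_space F"
          using only_degenerating_max_face[OF W F od minus tf] by blast
        then have "\<not> projects_to_boundary P W (max_face P (- w))"
          using F' True tf FF w(3) by (auto simp: parallel_faces_def)
        then show False using max_face_projects_to_boundary[OF sW(1) minus] by blast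
      qed
      then show ?thesis using True by simp
    next
      case False
      then have f: "two_face P F'" "direction_space F' = direction_space F" "F' \<noteq> F" "projects_to_boundary P W F'"
        using F' by auto
      obtain w' where w': "w' \<in> W" "w' \<noteq> 0" "max_face P w' = F'"
        using visible_max_face[OF W F od f(1,2,4)] .
      \<comment> \<open>Two independent functionals vanishing on the common direction plane would
        generate \<open>W\<close>, against \<open>plane_not_orthogonal\<close>. The factor between
        them is negative, because a positive one would expose the same face.\<close>
      have "w' \<in> span {w}"
      proof (rule ccontr)
        assume "w' \<notin> span {w}"
        then have "W = span {w, w'}" using plane_eq_span[OF sW w(1,2) w'(1)] by blast
        moreover have "w \<bullet> g = 0" "w' \<bullet> g = 0"
          using u(2) f(2) w(3) w'(3) max_face_direction_orth by metis+
        ultimately show False using u(1,3) by (auto simp: span_pair inner_add_left)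
      qed
      then obtain c where c: "w' = c *\<^sub>R w" by (auto simp: span_singleton)
      have "c \<noteq> 0" using c w'(2) by auto
      moreover have "\<not> c > 0" using max_face_scale[of c w] c w'(3) w(3) f(3) by auto
      ultimately have "- c > 0" by simp
      then have "max_face P (- w) = F'" using max_face_scale[of "- c" "- w"] c w'(3) by simp
      then show ?thesis using f False by simp
    qed
  qed
qed

end

subsection \<open>Moving between admissible planes\<close>

lemma linear_plane_span:
  fixes n m :: "'a::euclidean_space"
  assumes "n \<notin> span {m}" "m \<noteq> 0"
  shows "linear_plane (span {n, m})"
proof -
  have "independent {n, m}" using assms independent_insert[of n "{m}"] by (simp add: dependent_single)
  moreover have "n \<noteq> m" using assms(1) by (auto intro: span_base)
  ultimately show ?thesis by (simp add: linear_plane_def dim_eq_card_independent)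
qed

lemma span_shift:
  fixes n m :: "'a::real_vector"
  shows "span {n + c *\<^sub>R m, m} = span {n, m}"
proof -
  have "n + c *\<^sub>R m \<in> span {n, m}" by (intro span_add span_mul span_base) auto
  moreover have "(n + c *\<^sub>R m) - c *\<^sub>R m \<in> span {n + c *\<^sub>R m, m}"
    by (intro span_diff span_mul span_base) auto
  then have "n \<in> span {n + c *\<^sub>R m, m}" by simp
  ultimately show ?thesis
    by (intro span_eq[THEN iffD2]) (auto intro: span_base)
qed

section \<open>The jump of the vertex count and its vanishing for equiprojective polytopes\<close>

context full_polytope begin

text \<open>The vertex count adds the visible edges for \<open>n\<close> and for \<open>- n\<close>.
  Passing from \<nu> to \<open>- \<nu>\<close> also reverses \<open>x\<close>, which is why the
  second edge sum enters with a minus sign.\<close>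

lemma jump_total:
  assumes gen: "generic m" and fr: "frame a b S" and \<nu>S: "\<And>g. g \<in> S \<Longrightarrow> \<nu> \<bullet> g = 0"
    and mS: "h \<in> S" "m \<bullet> h \<noteq> 0"
    and nondeg: "\<And>G g. two_face P G \<Longrightarrow> g \<in> direction_space G \<Longrightarrow> g \<noteq> 0 \<Longrightarrow> \<nu> \<bullet> g = 0 \<Longrightarrow>
      m \<bullet> g = 0 \<Longrightarrow> direction_space G = S"
    and k: "k \<in> S" "m \<bullet> k = 0" "x \<bullet> k \<noteq> 0"
  shows "eventually (\<lambda>s. admissible P (span {\<nu> + s *\<^sub>R x, m}) \<and> admissible P (span {\<nu> - s *\<^sub>R x, m}) \<and>
    real (nverts (span {\<nu> + s *\<^sub>R x, m})) - real (nverts (span {\<nu> - s *\<^sub>R x, m})) =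
      - sgn (x \<bullet> k) * (edge_sum a b (max_face P \<nu>) k - edge_sum a b (max_face P (- \<nu>)) k)) (at_right 0)"
proof -
  have 1: "eventually (\<lambda>s. real (card (vis_edges m (\<nu> + s *\<^sub>R x))) - real (card (vis_edges m (\<nu> - s *\<^sub>R x))) =
    - sgn (x \<bullet> k) * edge_sum a b (max_face P \<nu>) k) (at_right 0)"
    by (rule local_jump[OF gen fr \<nu>S mS nondeg k])
  have 2: "eventually (\<lambda>s. real (card (vis_edges m (- \<nu> + s *\<^sub>R - x))) - real (card (vis_edges m (- \<nu> - s *\<^sub>R - x))) =
    - sgn (- x \<bullet> k) * edge_sum a b (max_face P (- \<nu>)) k) (at_right 0)"
    by (rule local_jump[OF gen fr _ mS _ k(1,2)]) (use \<nu>S nondeg k(3) in auto)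
  have "eventually (\<lambda>s. \<forall>G\<in>{G. two_face P G}. (\<nu> + s *\<^sub>R x) \<bullet> null_vec m G \<noteq> 0 \<and> (\<nu> - s *\<^sub>R x) \<bullet> null_vec m G \<noteq> 0) (at_right 0)"
  proof (intro eventually_ball_finite finite_two_faces ballI)
    fix G assume "G \<in> {G. two_face P G}"
    then have G: "two_face P G" by simp
    note \<gamma> = null_vec[OF gen G]
    show "eventually (\<lambda>s. (\<nu> + s *\<^sub>R x) \<bullet> null_vec m G \<noteq> 0 \<and> (\<nu> - s *\<^sub>R x) \<bullet> null_vec m G \<noteq> 0) (at_right 0)"
    proof (cases "\<nu> \<bullet> null_vec m G = 0")
      \<comment> \<open>Null vectors killed by \<nu> belong to the class \<open>S\<close> and are
        proportional to \<open>k\<close>, so a nonzero multiple of \<open>x\<close> does not kill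
        them.\<close>
      case True
      then have "direction_space G = S" using nondeg[OF G] \<gamma>(1-3) by blast
      then obtain c where "k = c *\<^sub>R null_vec m G" using \<gamma>(4) k(1,2) by blast
      then have "x \<bullet> null_vec m G \<noteq> 0" using k(3) by auto
      moreover have "eventually (\<lambda>s::real. s > 0) (at_right 0)" by (simp add: eventually_at_filter)
      ultimately show ?thesis
        by (auto elim!: eventually_mono simp: inner_add_left inner_diff_left True)
    next
      case False
      have "((\<lambda>s. (\<nu> + s *\<^sub>R x) \<bullet> null_vec m G) \<longlongrightarrow> (\<nu> + 0 *\<^sub>R x) \<bullet> null_vec m G) (at_right 0)"
        "((\<lambda>s. (\<nu> - s *\<^sub>R x) \<bullet> null_vec m G) \<longlongrightarrow> (\<nu> - 0 *\<^sub>R x) \<bullet> null_vec m G) (at_right 0)"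
        by (intro tendsto_intros)+
      then show ?thesis using False by (intro eventually_conj tendsto_imp_eventually_ne) auto
    qed
  qed
  then show ?thesis using 1 2
  proof eventually_elim
    case (elim s)
    then have adm: "admissible P (span {\<nu> + s *\<^sub>R x, m})" "admissible P (span {\<nu> - s *\<^sub>R x, m})"
      using admissible_null_vec[OF gen] by auto
    have e: "- \<nu> + s *\<^sub>R - x = - (\<nu> + s *\<^sub>R x)" "- \<nu> - s *\<^sub>R - x = - (\<nu> - s *\<^sub>R x)" by auto
    have s: "sgn (- x \<bullet> k) = - sgn (x \<bullet> k)" by (simp add: sgn_minus)
    show ?case
      using adm elim(2) elim(3)[unfolded e s] nverts_vis[OF adm(1) gen] nverts_vis[OF adm(2) gen]
      by (simp add: algebra_simps)
  qed
qed

text \<open>The projection of a full-dimensional polytope to a plane has dimension 2, so only the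
  number of vertices is at stake.\<close>

lemma equiprojective_nverts:
  "equiprojective P \<longleftrightarrow> (\<forall>W W'. admissible P W \<longrightarrow> admissible P W' \<longrightarrow> nverts W = nverts W')"
proof -
  have kg: "k_gon k (orth_proj W ` P) \<longleftrightarrow> nverts W = k" if "admissible P W" for W k
  proof -
    have W: "subspace W" "dim W = 2" using that by (auto simp: admissible_def linear_plane_def)
    interpret p: linear "orth_proj W" using linear_orth_proj[OF W(1)] .
    have "polytope (orth_proj W ` P)" using polytope_linear_image[OF p.linear_axioms poly] .
    moreover have "aff_dim (orth_proj W ` P) = 2"
    proof -
      have "W \<subseteq> direction_space (orth_proj W ` P)"
      proof
        fix w assume w: "w \<in> W"
        obtain p0 where p0: "p0 \<in> P" using P_ne by blast
        have "w \<in> span ((\<lambda>x. x - p0) ` P)"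
          using direction_space_basepoint[OF p0] direction_P by simp
        then have "orth_proj W w \<in> orth_proj W ` span ((\<lambda>x. x - p0) ` P)" by simp
        also have "\<dots> = span (orth_proj W ` (\<lambda>x. x - p0) ` P)" by (rule linear_span_image[OF p.linear_axioms, symmetric])
        also have "\<dots> \<subseteq> direction_space (orth_proj W ` P)"
          using p0 by (intro span_minimal) (auto simp: p.diff intro!: diff_in_direction_space)
        finally have "orth_proj W w \<in> direction_space (orth_proj W ` P)" .
        moreover have "orth_proj W w = w"
          by (rule orth_proj_eqI[OF W(1) w]) (simp add: orthogonal_def)
        ultimately show "w \<in> direction_space (orth_proj W ` P)" by simp
      qed
      moreover have "direction_space (orth_proj W ` P) \<subseteq> W"
        by (rule direction_space_least[OF W(1)]) (auto intro!: subspace_diff[OF W(1)] orth_proj(1)[OF W(1)])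
      ultimately have "direction_space (orth_proj W ` P) = W" by blast
      then show ?thesis using dim_direction_space[of "orth_proj W ` P"] P_ne W(2) by simp
    qed
    ultimately show ?thesis by (simp add: k_gon_def nverts_def)
  qed
  show ?thesis
    unfolding equiprojective_def k_equiprojective_def using kg by (metis (full_types))
qed

text \<open>A crossing is built at which exactly the class of \<open>F\<close> degenerates, in the
  prescribed direction \<open>k\<close>; equiprojectivity forces its jump to vanish. The set
  \<open>D\<close> collects the directions that must not be parallel to \<open>k\<close>, so that
  some generic \<open>m\<close> orthogonal to \<open>k\<close> degenerates no other class together
  with \<nu>.\<close>

lemma equiprojective_edge_sum:
  assumes eq: "equiprojective P" and vis: "simultaneously_visible P F F'"
    and fr: "frame a b (direction_space F)"
  obtains D where "finite D" "0 \<notin> D"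
    "\<And>k. k \<in> direction_space F \<Longrightarrow> k \<noteq> 0 \<Longrightarrow> (\<And>d. d \<in> D \<Longrightarrow> d \<notin> span {k}) \<Longrightarrow>
      edge_sum a b F k = edge_sum a b F' k"
proof -
  obtain \<nu> where \<nu>: "\<nu> \<noteq> 0" "max_face P \<nu> = F" "two_face P F"
    "\<And>G. two_face P G \<Longrightarrow> (\<And>g. g \<in> direction_space G \<Longrightarrow> \<nu> \<bullet> g = 0) \<Longrightarrow> direction_space G = direction_space F"
    "if F' = {} then \<not> two_face P (max_face P (- \<nu>)) else max_face P (- \<nu>) = F' \<and> two_face P F'"
    by (rule visible_normal[OF vis]) blast
  define S where "S = direction_space F"
  have "\<exists>g. g \<in> direction_space G \<and> g \<noteq> 0 \<and> \<nu> \<bullet> g = 0" if "two_face P G" for G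
    using plane_orth_vector[OF subspace_direction_space two_face_dim[OF that]] by metis
  then obtain \<gamma> where \<gamma>: "\<And>G. two_face P G \<Longrightarrow> \<gamma> G \<in> direction_space G \<and> \<gamma> G \<noteq> 0 \<and> \<nu> \<bullet> \<gamma> G = 0"
    by metis
  have line: "\<exists>c. g = c *\<^sub>R \<gamma> G"
    if G: "two_face P G" "direction_space G \<noteq> S" and g: "g \<in> direction_space G" "\<nu> \<bullet> g = 0" for G g
  proof (rule ccontr)
    assume "\<nexists>c. g = c *\<^sub>R \<gamma> G"
    then have "g \<notin> span {\<gamma> G}" by (auto simp: span_singleton)
    then have "direction_space G = span {\<gamma> G, g}"
      using plane_eq_span[OF subspace_direction_space two_face_dim[OF G(1)]] \<gamma>[OF G(1)] g(1) by blast
    then have "\<nu> \<bullet> x = 0" if "x \<in> direction_space G" for x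
      using that \<gamma>[OF G(1)] g(2) by (auto simp: span_pair inner_add_right)
    then show False using \<nu>(4)[OF G(1)] G(2) by (simp add: S_def)
  qed
  \<comment> \<open>Avoiding the edge directions makes \<open>m\<close> generic; the vectors
    \<open>\<gamma> G\<close> span the directions killed by \<nu> in the 2-faces of the other
    classes.\<close>
  define D where "D = (\<lambda>(p, q). q - p) ` {(p, q). closed_segment p q edge_of P} \<union>
    \<gamma> ` {G. two_face P G}"
  have finD: "finite D" using finite_two_faces finite_edge_dirs by (simp add: D_def)
  have D0: "0 \<notin> D" using \<gamma> by (auto simp: D_def edge_of_def)
  have sum: "edge_sum a b F k = edge_sum a b F' k"
    if k: "k \<in> S" "k \<noteq> 0" "\<And>d. d \<in> D \<Longrightarrow> d \<notin> span {k}" for k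
  proof -
    \<comment> \<open>The functional \<open>m\<close> is the component orthogonal to
      \<open>k\<close> of some \<open>z\<close>. Since
      \<open>m \<bullet> d = z \<bullet> pr d\<close>, it is enough that \<open>z\<close> avoids the
      projected directions, which are nonzero because no \<open>d\<close> is parallel to
      \<open>k\<close>.\<close>
    define pr where "pr d = d - ((d \<bullet> k) / (k \<bullet> k)) *\<^sub>R k" for d
    have kk: "k \<bullet> k \<noteq> 0" using k(2) by simp
    have "pr d \<noteq> 0" if "d \<in> D" for d
    proof
      assume "pr d = 0"
      then have "d = ((d \<bullet> k) / (k \<bullet> k)) *\<^sub>R k" by (simp add: pr_def)
      then have "d \<in> span {k}" by (metis span_base span_mul singletonI)
      then show False using k(3) that by blast
    qed
    then have "\<exists>w\<in>UNIV. w \<bullet> d \<noteq> 0" if "d \<in> pr ` D" for d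
      using that by (intro bexI[of _ d]) auto
    then obtain z where z: "\<And>d. d \<in> pr ` D \<Longrightarrow> z \<bullet> d \<noteq> 0"
      using subspace_avoid[OF subspace_UNIV, of "pr ` D"] finD by blast
    define m where "m = z - ((z \<bullet> k) / (k \<bullet> k)) *\<^sub>R k"
    have mk: "m \<bullet> k = 0" using kk by (simp add: m_def inner_diff_left)
    have mD: "m \<bullet> d \<noteq> 0" if "d \<in> D" for d
    proof -
      have "m \<bullet> d = z \<bullet> pr d" using kk by (simp add: m_def pr_def inner_diff_left inner_diff_right inner_commute)
      then show ?thesis using z that by simp
    qed
    have gen: "generic m" unfolding generic_def
      using mD by (force simp: D_def)
    obtain p q where pq: "closed_segment p q edge_of P" "q - p \<in> S"
      using two_face_edge[OF \<nu>(3)] unfolding S_def by metis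
    have mh: "m \<bullet> (q - p) \<noteq> 0" using gen pq by (simp add: generic_def)
    have nondeg: "direction_space G = S"
      if G: "two_face P G" "g \<in> direction_space G" "g \<noteq> 0" "\<nu> \<bullet> g = 0" "m \<bullet> g = 0" for G g
    proof (rule ccontr)
      assume ne: "direction_space G \<noteq> S"
      obtain c where c: "g = c *\<^sub>R \<gamma> G" using line[OF G(1) ne G(2,4)] by blast
      have "m \<bullet> \<gamma> G \<noteq> 0" using mD G(1) by (simp add: D_def)
      then show False using c G(3,5) by auto
    qed
    have \<nu>S: "\<nu> \<bullet> g = 0" if "g \<in> S" for g
      using that max_face_direction_orth[of g P \<nu>] \<nu>(2) by (simp add: S_def)
    have "eventually (\<lambda>s. admissible P (span {\<nu> + s *\<^sub>R k, m}) \<and> admissible P (span {\<nu> - s *\<^sub>R k, m}) \<and>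
      real (nverts (span {\<nu> + s *\<^sub>R k, m})) - real (nverts (span {\<nu> - s *\<^sub>R k, m})) =
        - sgn (k \<bullet> k) * (edge_sum a b (max_face P \<nu>) k - edge_sum a b (max_face P (- \<nu>)) k)) (at_right 0)"
      by (rule jump_total[OF gen fr[folded S_def] \<nu>S pq(2) mh nondeg k(1) mk kk])
    then obtain s where s: "admissible P (span {\<nu> + s *\<^sub>R k, m})" "admissible P (span {\<nu> - s *\<^sub>R k, m})"
      "real (nverts (span {\<nu> + s *\<^sub>R k, m})) - real (nverts (span {\<nu> - s *\<^sub>R k, m})) =
        - sgn (k \<bullet> k) * (edge_sum a b (max_face P \<nu>) k - edge_sum a b (max_face P (- \<nu>)) k)"
      using eventually_happens'[OF trivial_limit_at_right_real] by blast
    have "nverts (span {\<nu> + s *\<^sub>R k, m}) = nverts (span {\<nu> - s *\<^sub>R k, m})"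
      using eq s(1,2) unfolding equiprojective_nverts by blast
    then have "edge_sum a b F k = edge_sum a b (max_face P (- \<nu>)) k"
      using s(3) kk \<nu>(2) by (simp add: sgn_eq_0_iff)
    \<comment> \<open>If \<open>F'\<close> is empty, the opposite exposed face is not a 2-face, and
      both sums are 0 by the default value.\<close>
    moreover have "edge_sum a b (max_face P (- \<nu>)) k = edge_sum a b F' k"
      using \<nu>(5) by (auto simp: edge_sum_def two_face_def split: if_splits)
    ultimately show ?thesis by simp
  qed
  show ?thesis by (rule that[OF finD D0 sum[unfolded S_def]])
qed

end

text \<open>The balance condition is all that a pairing has to provide; it separates the geometry of
  crossings from edge-2-faces and their orientations.\<close>

locale balanced_polytope = full_polytope +
  assumes balanced: "\<And>F F' a b k. simultaneously_visible P F F' \<Longrightarrow> frame a b (direction_space F) \<Longrightarrow>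
    k \<in> direction_space F \<Longrightarrow> edge_sum a b F k = edge_sum a b F' k"
begin

text \<open>With \<open>span {\<nu>, m}\<close> as the witness plane, the 2-faces exposed by \<nu>
  and \<open>- \<nu>\<close> form a simultaneously visible pair, or one of them is visible alone, or
  there are none. In each case \<open>balanced\<close> or the default value 0 gives the
  equation.\<close>

lemma crossing_balanced:
  assumes gen: "generic m" and G0: "two_face P G0" and fr: "frame a b (direction_space G0)"
    and \<nu>S: "\<And>g. g \<in> direction_space G0 \<Longrightarrow> \<nu> \<bullet> g = 0"
    and nondeg: "\<And>G g. two_face P G \<Longrightarrow> g \<in> direction_space G \<Longrightarrow> g \<noteq> 0 \<Longrightarrow> \<nu> \<bullet> g = 0 \<Longrightarrow>
      m \<bullet> g = 0 \<Longrightarrow> direction_space G = direction_space G0"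
    and k: "k \<in> direction_space G0"
  shows "edge_sum a b (max_face P \<nu>) k = edge_sum a b (max_face P (- \<nu>)) k"
proof -
  define S where "S = direction_space G0"
  obtain p q where pq: "closed_segment p q edge_of P" "closed_segment p q edge_of G0" "q - p \<in> S" "p \<in> G0"
    using two_face_edge[OF G0] unfolding S_def by metis
  have mh: "m \<bullet> (q - p) \<noteq> 0" using gen pq(1) by (simp add: generic_def)
  \<comment> \<open>A second 2-face at an edge of \<open>G0\<close> is not parallel to
    \<open>G0\<close>. Its direction orthogonal to \<open>m\<close> is not killed by \<nu>, which
    shows that \<nu> and \<open>m\<close> span a plane.\<close>
  obtain G1 where G1: "two_face P G1" "closed_segment p q \<subseteq> G1" "G1 \<noteq> G0"
    using other_two_face[OF G0 pq(2)] .
  have G1S: "direction_space G1 \<noteq> S"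
    using parallel_two_faces_eq[OF G1(1) G0 _ _ pq(4)] G1(2,3) by (auto simp: S_def)
  obtain g1 where g1: "g1 \<in> direction_space G1" "g1 \<noteq> 0" "m \<bullet> g1 = 0"
    using plane_orth_vector[OF subspace_direction_space two_face_dim[OF G1(1)]] by metis
  have \<nu>g1: "\<nu> \<bullet> g1 \<noteq> 0" using nondeg[OF G1(1) g1(1,2) _ g1(3)] G1S S_def by blast
  then have \<nu>0: "\<nu> \<noteq> 0" by auto
  define W where "W = span {\<nu>, m}"
  have "\<nu> \<notin> span {m}" using \<nu>g1 g1(3) by (auto simp: span_singleton)
  moreover have "m \<noteq> 0" using mh by auto
  ultimately have W: "linear_plane W" unfolding W_def by (rule linear_plane_span)
  have sW: "subspace W" by (simp add: W_def)
  have \<nu>W: "\<nu> \<in> W" "- \<nu> \<in> W" "- \<nu> \<noteq> 0" "m \<in> W" using \<nu>0 by (auto simp: W_def intro: span_base span_neg)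
  have od: "only_degenerating P W F" if F: "two_face P F" "direction_space F = S" for F
    unfolding only_degenerating_iff[OF sW F(1)] F(2)
  proof (intro allI impI iffI)
    fix G assume "two_face P G" "\<exists>g\<in>direction_space G. g \<noteq> 0 \<and> (\<forall>w\<in>W. w \<bullet> g = 0)"
    then show "direction_space G = S" using nondeg \<nu>W S_def by blast
  next
    fix G assume G: "two_face P G" "direction_space G = S"
    obtain g where g: "g \<in> direction_space G" "g \<noteq> 0" "m \<bullet> g = 0"
      using plane_orth_vector[OF subspace_direction_space two_face_dim[OF G(1)]] by metis
    moreover have "\<nu> \<bullet> g = 0" using \<nu>S g(1) G(2) S_def by blast
    ultimately show "\<exists>g\<in>direction_space G. g \<noteq> 0 \<and> (\<forall>w\<in>W. w \<bullet> g = 0)"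
      by (intro bexI[of _ g]) (auto simp: W_def span_pair inner_add_left)
  qed
  have dir: "direction_space (max_face P w) = S" if w: "two_face P (max_face P w)" "w = \<nu> \<or> w = - \<nu>" for w
  proof -
    obtain g where g: "g \<in> direction_space (max_face P w)" "g \<noteq> 0" "m \<bullet> g = 0"
      using plane_orth_vector[OF subspace_direction_space two_face_dim[OF w(1)]] by metis
    have "\<nu> \<bullet> g = 0" using max_face_direction_orth[OF g(1)] w(2) by auto
    then show ?thesis using nondeg[OF w(1) g(1,2) _ g(3)] S_def by blast
  qed
  \<comment> \<open>A functional in \<open>W\<close> that kills \<open>q - p\<close> has no
    \<open>m\<close>-component, so up to positive factors only \<nu> and \<open>- \<nu>\<close>
    expose 2-faces of this class.\<close>
  have vis_only: "G = max_face P \<nu> \<or> G = max_face P (- \<nu>)"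
    if G: "two_face P G" "direction_space G = S" "projects_to_boundary P W G" for G
  proof -
    obtain w where w: "w \<in> W" "w \<noteq> 0" "max_face P w = G"
      using visible_max_face[OF W G(1) od[OF G(1,2)] G(1) refl G(3)] .
    obtain s t where st: "w = s *\<^sub>R \<nu> + t *\<^sub>R m" using w(1) by (auto simp: W_def span_pair)
    have "w \<bullet> (q - p) = 0" using max_face_direction_orth[of "q - p" P w] w(3) G(2) pq(3) by simp
    moreover have "\<nu> \<bullet> (q - p) = 0" using \<nu>S pq(3) S_def by blast
    ultimately have "t * (m \<bullet> (q - p)) = 0" by (simp add: st inner_add_left del: inner_diff_right)
    then have "w = s *\<^sub>R \<nu>" using st mh by simp
    moreover have "s \<noteq> 0" using w(2) calculation by auto
    ultimately show ?thesis
      using max_face_scale[of s \<nu>] max_face_scale[of "- s" "- \<nu>"] w(3) by (cases "s > 0") auto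
  qed
  have bd: "projects_to_boundary P W (max_face P \<nu>)" "projects_to_boundary P W (max_face P (- \<nu>))"
    using max_face_projects_to_boundary[OF sW] \<nu>W \<nu>0 by auto
  have ne: "max_face P \<nu> \<noteq> max_face P (- \<nu>)" by (rule max_face_ne_opposite[OF \<nu>0])
  have single: "edge_sum a b (max_face P w) k = 0"
    if w: "w = \<nu> \<or> w = - \<nu>" "two_face P (max_face P w)" "\<not> two_face P (max_face P (- w))" for w
  proof -
    have d: "direction_space (max_face P w) = S" using dir w by blast
    have "\<not> projects_to_boundary P W G"
      if "two_face P G" "parallel_faces G (max_face P w)" "G \<noteq> max_face P w" for G
      using vis_only[of G] that w d by (auto simp: parallel_faces_def)
    then have "simultaneously_visible P (max_face P w) {}"
      unfolding simultaneously_visible_def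
      using w(1,2) W od[OF w(2) d] bd by auto
    then have "edge_sum a b (max_face P w) k = edge_sum a b {} k"
      using balanced d fr k S_def by metis
    then show ?thesis by (simp add: edge_sum_def two_face_def)
  qed
  consider "two_face P (max_face P \<nu>)" "two_face P (max_face P (- \<nu>))"
    | "two_face P (max_face P \<nu>)" "\<not> two_face P (max_face P (- \<nu>))"
    | "\<not> two_face P (max_face P \<nu>)" "two_face P (max_face P (- \<nu>))"
    | "\<not> two_face P (max_face P \<nu>)" "\<not> two_face P (max_face P (- \<nu>))" by blast
  then show ?thesis
  proof cases
    case 1
    have d: "direction_space (max_face P \<nu>) = S" "direction_space (max_face P (- \<nu>)) = S"
      using dir 1 by blast+
    have "simultaneously_visible P (max_face P \<nu>) (max_face P (- \<nu>))"
      unfolding simultaneously_visible_def using max_face_nonempty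
      using 1 W od[OF 1(1) d(1)] bd ne d by (auto simp: parallel_faces_def)
    then show ?thesis using balanced d(1) fr k S_def by metis
  next
    case 2
    then show ?thesis using single[of \<nu>] by (simp add: edge_sum_def)
  next
    case 3
    then show ?thesis using single[of "- \<nu>"] by (simp add: edge_sum_def)
  next
    case 4
    then show ?thesis by (simp add: edge_sum_def)
  qed
qed

text \<open>The condition beyond genericity makes the null vectors of non-parallel 2-faces
  independent, so that their walls in the variable \<open>n\<close> are distinct
  hyperplanes.\<close>

definition regular :: "'a \<Rightarrow> bool" where
  "regular m \<longleftrightarrow> generic m \<and> (\<forall>G H g. two_face P G \<longrightarrow> two_face P H \<longrightarrow>
    direction_space G \<noteq> direction_space H \<longrightarrow> g \<in> direction_space G \<longrightarrow> g \<in> direction_space H \<longrightarrow>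
    m \<bullet> g = 0 \<longrightarrow> g = 0)"

text \<open>At a plane that is not admissible only one class degenerates, by \<open>one\<close>.
  Adding a multiple of \<open>m\<close> to \<open>n\<close> does not change the plane and makes the
  functional vanish on the whole direction plane of this class, as \<open>jump_total\<close>
  requires; the jump is then 0 by \<open>crossing_balanced\<close>.\<close>

lemma nverts_across:
  assumes gen: "generic m"
    and one: "\<And>G H. two_face P G \<Longrightarrow> two_face P H \<Longrightarrow> n \<bullet> null_vec m G = 0 \<Longrightarrow> n \<bullet> null_vec m H = 0 \<Longrightarrow>
      direction_space G = direction_space H"
    and x: "\<And>G. two_face P G \<Longrightarrow> n \<bullet> null_vec m G = 0 \<Longrightarrow> x \<bullet> null_vec m G \<noteq> 0"
  shows "eventually (\<lambda>s. admissible P (span {n + s *\<^sub>R x, m}) \<and> admissible P (span {n - s *\<^sub>R x, m}) \<and>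
    nverts (span {n + s *\<^sub>R x, m}) = nverts (span {n - s *\<^sub>R x, m})) (at_right 0)"
proof (cases "admissible P (span {n, m})")
  case True
  from eventually_nhds_0_pm[OF nverts_locally_constant[OF gen True, of x]]
  show ?thesis by (rule eventually_mono) auto
next
  case False
  then obtain G0 where G0: "two_face P G0" "n \<bullet> null_vec m G0 = 0"
    using admissible_null_vec[OF gen] by blast
  define S where "S = direction_space G0"
  define k where "k = null_vec m G0"
  note kk = null_vec[OF gen G0(1), folded k_def S_def]
  obtain a b where fr: "frame a b S" unfolding S_def
    using frame_exists[OF subspace_direction_space two_face_dim[OF G0(1)]] .
  obtain p q where pq: "closed_segment p q edge_of P" "q - p \<in> S"
    using two_face_edge[OF G0(1)] unfolding S_def by metis
  define h where "h = q - p"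
  have h: "h \<in> S" "m \<bullet> h \<noteq> 0" using pq gen by (auto simp: h_def generic_def simp del: inner_diff_right)
  define c where "c = - ((n \<bullet> h) / (m \<bullet> h))"
  define \<nu> where "\<nu> = n + c *\<^sub>R m"
  have \<nu>h: "\<nu> \<bullet> h = 0" using h(2) by (simp add: \<nu>_def c_def inner_add_left inner_diff_left)
  have \<nu>k: "\<nu> \<bullet> k = 0" using G0(2) kk(3) by (simp add: \<nu>_def k_def inner_add_left)
  have "h \<notin> span {k}" using h(2) kk(3) by (auto simp: span_singleton)
  then have "S = span {k, h}"
    using plane_eq_span[OF subspace_direction_space two_face_dim[OF G0(1)]] kk(1,2) h(1) S_def by blast
  then have \<nu>S: "\<nu> \<bullet> g = 0" if "g \<in> S" for g
    using that \<nu>h \<nu>k by (auto simp: span_pair inner_add_right)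
  have nondeg: "direction_space G = S"
    if G: "two_face P G" "g \<in> direction_space G" "g \<noteq> 0" "\<nu> \<bullet> g = 0" "m \<bullet> g = 0" for G g
  proof -
    obtain r where r: "g = r *\<^sub>R null_vec m G" using null_vec(4)[OF gen G(1,2,5)] by blast
    have "n \<bullet> g = 0" using G(4,5) by (simp add: \<nu>_def inner_add_left)
    then have "n \<bullet> null_vec m G = 0" using r G(3) by auto
    then show ?thesis using one[OF G(1) G0(1) _ G0(2)] S_def by blast
  qed
  have xk: "x \<bullet> k \<noteq> 0" using x[OF G0] by (simp add: k_def)
  have shift: "span {\<nu> + s *\<^sub>R x, m} = span {n + s *\<^sub>R x, m}" "span {\<nu> - s *\<^sub>R x, m} = span {n - s *\<^sub>R x, m}" for s
    using span_shift[of "n + s *\<^sub>R x" c m] span_shift[of "n - s *\<^sub>R x" c m] by (simp_all add: \<nu>_def algebra_simps)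
  have "edge_sum a b (max_face P \<nu>) k = edge_sum a b (max_face P (- \<nu>)) k"
    by (rule crossing_balanced[OF gen G0(1) fr[unfolded S_def] _ _ kk(1)[unfolded S_def]])
      (use \<nu>S nondeg S_def in blast)+
  then show ?thesis
    using jump_total[OF gen fr \<nu>S h nondeg kk(1,3) xk] by (simp add: shift)
qed

text \<open>Around every parameter \<open>t\<close> the count has one value \<open>c t\<close> at
  all nearby parameters, whether the plane at \<open>t\<close> is admissible or a wall is crossed
  there. The function \<open>c\<close> is locally constant on an interval, hence constant, and it
  agrees with the count at the admissible ends.\<close>

lemma nverts_segment:
  assumes gen: "generic m"
    and adm: "admissible P (span {n, m})" "admissible P (span {n + x, m})"
    and one: "\<And>t G H. two_face P G \<Longrightarrow> two_face P H \<Longrightarrow> (n + t *\<^sub>R x) \<bullet> null_vec m G = 0 \<Longrightarrow>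
      (n + t *\<^sub>R x) \<bullet> null_vec m H = 0 \<Longrightarrow> direction_space G = direction_space H"
  shows "nverts (span {n, m}) = nverts (span {n + x, m})"
proof -
  define W where "W t = span {n + t *\<^sub>R x, m}" for t
  \<comment> \<open>If \<open>x\<close> killed this null vector, then so would \<open>n\<close>,
    against admissibility at the start of the segment.\<close>
  have x0: "x \<bullet> null_vec m G \<noteq> 0" if "two_face P G" "(n + t *\<^sub>R x) \<bullet> null_vec m G = 0" for t G
    using that adm(1) unfolding admissible_null_vec[OF gen] by (auto simp: inner_add_left)
  have W_shift: "span {(n + t *\<^sub>R x) + s *\<^sub>R x, m} = W (t + s)" "span {(n + t *\<^sub>R x) - s *\<^sub>R x, m} = W (t - s)" for s t
    by (simp_all add: W_def algebra_simps)
  have const: "nverts (W s) = nverts (W t)"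
    if "\<And>r. u < r \<Longrightarrow> r < v \<Longrightarrow> admissible P (W r)" "u < s" "s < v" "u < t" "t < v" for u v s t
  proof (rule connected_local_const[of "{u<..<v}"])
    show "\<forall>r\<in>{u<..<v}. eventually (\<lambda>r'. nverts (W r) = nverts (W r')) (at r within {u<..<v})"
    proof
      fix r assume "r \<in> {u<..<v}"
      then have "admissible P (span {n + r *\<^sub>R x, m})" using that(1) by (simp add: W_def)
      from nverts_locally_constant[OF gen this, of x]
      obtain d where d: "d > 0" "\<And>s. \<bar>s\<bar> < d \<Longrightarrow> nverts (W (r + s)) = nverts (W r)"
        by (auto simp: eventually_nhds_metric W_shift W_def)
      have "nverts (W r) = nverts (W r')" if "dist r' r < d" for r'
        using d(2)[of "r' - r"] that by (simp add: dist_real_def)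
      then show "eventually (\<lambda>r'. nverts (W r) = nverts (W r')) (at r within {u<..<v})"
        using d(1) by (auto simp: eventually_at)
    qed
  qed (use that in auto)
  have limit: "\<exists>c d. d > 0 \<and> (\<forall>r. r \<noteq> t \<longrightarrow> \<bar>r - t\<bar> < d \<longrightarrow> admissible P (W r) \<and> nverts (W r) = c) \<and>
      (admissible P (W t) \<longrightarrow> nverts (W t) = c)" for t
  proof (cases "admissible P (W t)")
    case True
    have "eventually (\<lambda>s. admissible P (W (t + s)) \<and> nverts (W (t + s)) = nverts (W t)) (nhds 0)"
      using nverts_locally_constant[OF gen, of "n + t *\<^sub>R x" x] True by (simp add: W_shift) (simp add: W_def)
    then obtain d where d: "d > 0" "\<And>s. \<bar>s\<bar> < d \<Longrightarrow> admissible P (W (t + s)) \<and> nverts (W (t + s)) = nverts (W t)"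
      by (auto simp: eventually_nhds_metric)
    have "admissible P (W r) \<and> nverts (W r) = nverts (W t)" if "\<bar>r - t\<bar> < d" for r
      using d(2)[of "r - t"] that by simp
    then show ?thesis using d(1) by blast
  next
    case False
    have "eventually (\<lambda>s. admissible P (span {(n + t *\<^sub>R x) + s *\<^sub>R x, m}) \<and>
        admissible P (span {(n + t *\<^sub>R x) - s *\<^sub>R x, m}) \<and>
        nverts (span {(n + t *\<^sub>R x) + s *\<^sub>R x, m}) = nverts (span {(n + t *\<^sub>R x) - s *\<^sub>R x, m})) (at_right 0)"
      by (rule nverts_across[OF gen one x0])
    then have "eventually (\<lambda>s. admissible P (W (t + s)) \<and> admissible P (W (t - s)) \<and>
        nverts (W (t + s)) = nverts (W (t - s))) (at_right 0)"
      unfolding W_shift .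
    then obtain d where d: "d > 0" "\<And>s. 0 < s \<Longrightarrow> s < d \<Longrightarrow> admissible P (W (t + s)) \<and> admissible P (W (t - s)) \<and>
        nverts (W (t + s)) = nverts (W (t - s))"
      by (auto simp: eventually_at_right_field)
    have right: "admissible P (W r)" if "t < r" "r < t + d" for r
      using d(2)[of "r - t"] that by auto
    have left: "admissible P (W r)" if "t - d < r" "r < t" for r
      using d(2)[of "t - r"] that by auto
    let ?c = "nverts (W (t + d / 2))"
    have "admissible P (W r) \<and> nverts (W r) = ?c" if "r \<noteq> t" "\<bar>r - t\<bar> < d" for r
    proof (cases "r > t")
      case True
      then show ?thesis
        using right[of r] const[of t "t + d" r "t + d / 2"] right that d(1) by auto
    next
      case False
      have "nverts (W r) = nverts (W (t - d / 2))"
        using const[of "t - d" t r "t - d / 2"] left that d(1) False by auto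
      also have "\<dots> = ?c" using d(2)[of "d / 2"] d(1) by simp
      finally show ?thesis using left[of r] that False by auto
    qed
    then show ?thesis using d(1) False by blast
  qed
  then obtain c where c: "\<And>t. \<exists>d>0. (\<forall>r. r \<noteq> t \<longrightarrow> \<bar>r - t\<bar> < d \<longrightarrow> admissible P (W r) \<and> nverts (W r) = c t) \<and>
      (admissible P (W t) \<longrightarrow> nverts (W t) = c t)"
    by metis
  have "c 0 = c 1"
  proof (rule connected_local_const[of "{0..1::real}"])
    show "\<forall>t\<in>{0..1}. eventually (\<lambda>r. c t = c r) (at t within {0..1})"
    proof
      fix t :: real assume "t \<in> {0..1}"
      obtain d where d: "d > 0" "\<And>r. r \<noteq> t \<Longrightarrow> \<bar>r - t\<bar> < d \<Longrightarrow> admissible P (W r) \<and> nverts (W r) = c t"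
        using c[of t] by blast
      have "c t = c r" if "r \<noteq> t" "\<bar>r - t\<bar> < d" for r
        using d(2)[OF that] c[of r] by metis
      then show "eventually (\<lambda>r. c t = c r) (at t within {0..1})"
        using d(1) by (auto simp: eventually_at dist_real_def)
    qed
  qed auto
  moreover have "nverts (W 0) = c 0" "nverts (W 1) = c 1"
    using c[of 0] c[of 1] adm by (auto simp: W_def)
  ultimately show ?thesis by (simp add: W_def)
qed

text \<open>After a small perturbation of \<open>n\<close>, the segment from \<open>n\<close> to \<open>n'\<close> meets the hyperplanes
  of distinct classes of 2-faces at distinct times.\<close>

lemma nverts_fixed_direction:
  assumes reg: "regular m"
    and adm: "admissible P (span {n, m})" "admissible P (span {n', m})"
  shows "nverts (span {n, m}) = nverts (span {n', m})"
proof -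
  have gen: "generic m" using reg by (simp add: regular_def)
  let ?\<gamma> = "null_vec m"
  have a1: "n' \<bullet> ?\<gamma> G \<noteq> 0" if "two_face P G" for G
    using adm that unfolding admissible_null_vec[OF gen] by auto
  \<comment> \<open>If a point of the segment kills both null vectors, eliminating its parameter
    shows that the starting point is orthogonal to \<open>w (G, H)\<close>. For non-parallel faces
    these vectors are nonzero, and the perturbed starting point has to avoid their orthogonal
    hyperplanes.\<close>
  define w where "w = (\<lambda>(G, H). (n' \<bullet> ?\<gamma> H) *\<^sub>R ?\<gamma> G - (n' \<bullet> ?\<gamma> G) *\<^sub>R ?\<gamma> H)"
  define I where "I = {(G, H). two_face P G \<and> two_face P H \<and> direction_space G \<noteq> direction_space H}"
  have finI: "finite I"
    by (rule finite_subset[of _ "{G. two_face P G} \<times> {G. two_face P G}"]) (auto simp: I_def finite_two_faces)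
  have w0: "w (G, H) \<noteq> 0" if GH: "(G, H) \<in> I" for G H
  proof
    assume "w (G, H) = 0"
    then have eq: "(n' \<bullet> ?\<gamma> H) *\<^sub>R ?\<gamma> G = (n' \<bullet> ?\<gamma> G) *\<^sub>R ?\<gamma> H" by (simp add: w_def)
    have GH': "two_face P G" "two_face P H" "direction_space G \<noteq> direction_space H" using GH by (auto simp: I_def)
    let ?g = "(n' \<bullet> ?\<gamma> H) *\<^sub>R ?\<gamma> G"
    have "?g \<in> direction_space G" using null_vec(1)[OF gen GH'(1)] by (simp add: subspace_scale)
    moreover have "?g \<in> direction_space H" unfolding eq using null_vec(1)[OF gen GH'(2)] by (simp add: subspace_scale)
    moreover have "m \<bullet> ?g = 0" using null_vec(3)[OF gen GH'(1)] by simp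
    ultimately have "?g = 0" using reg GH' unfolding regular_def by blast
    then show False using a1[OF GH'(2)] null_vec(2)[OF gen GH'(1)] by simp
  qed
  have ex: "\<exists>u\<in>UNIV. u \<bullet> d \<noteq> 0" if "d \<in> w ` I" for d
    using that w0 by (intro bexI[of _ d]) auto
  obtain z where z: "\<And>d. d \<in> w ` I \<Longrightarrow> z \<bullet> d \<noteq> 0"
    using subspace_avoid[OF subspace_UNIV finite_imageI[OF finI] ex] by blast
  have ev1: "eventually (\<lambda>s. \<forall>i\<in>I. (n + s *\<^sub>R z) \<bullet> w i \<noteq> 0) (at_right 0)"
  proof (intro eventually_ball_finite finI ballI)
    fix i assume i: "i \<in> I"
    show "eventually (\<lambda>s. (n + s *\<^sub>R z) \<bullet> w i \<noteq> 0) (at_right 0)"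
    proof (cases "n \<bullet> w i = 0")
      case True
      have "eventually (\<lambda>s::real. s > 0) (at_right 0)" by (simp add: eventually_at_filter)
      then show ?thesis by (rule eventually_mono) (use z i True in \<open>auto simp: inner_add_left\<close>)
    next
      case False
      have "((\<lambda>s. (n + s *\<^sub>R z) \<bullet> w i) \<longlongrightarrow> (n + 0 *\<^sub>R z) \<bullet> w i) (at_right 0)" by (intro tendsto_intros)
      then show ?thesis using False by (intro tendsto_imp_eventually_ne) auto
    qed
  qed
  obtain s where s: "\<forall>i\<in>I. (n + s *\<^sub>R z) \<bullet> w i \<noteq> 0" "admissible P (span {n + s *\<^sub>R z, m})"
    "nverts (span {n + s *\<^sub>R z, m}) = nverts (span {n, m})"
    using eventually_happens'[OF trivial_limit_at_right_real
        eventually_conj[OF ev1 eventually_nhds_0_pm[OF nverts_locally_constant[OF gen adm(1), of z]]]]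
    by blast
  define n0 where "n0 = n + s *\<^sub>R z"
  have "nverts (span {n0, m}) = nverts (span {n0 + (n' - n0), m})"
  proof (rule nverts_segment[OF gen])
    show "admissible P (span {n0, m})" using s(2) by (simp add: n0_def)
    show "admissible P (span {n0 + (n' - n0), m})" using adm(2) by simp
    fix t G H assume G: "two_face P G" and H: "two_face P H"
      and tG: "(n0 + t *\<^sub>R (n' - n0)) \<bullet> ?\<gamma> G = 0" and tH: "(n0 + t *\<^sub>R (n' - n0)) \<bullet> ?\<gamma> H = 0"
    show "direction_space G = direction_space H"
    proof (rule ccontr)
      assume "direction_space G \<noteq> direction_space H"
      then have i: "(G, H) \<in> I" using G H by (simp add: I_def)
      have eG: "(1 - t) * (n0 \<bullet> ?\<gamma> G) = - t * (n' \<bullet> ?\<gamma> G)"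
        and eH: "(1 - t) * (n0 \<bullet> ?\<gamma> H) = - t * (n' \<bullet> ?\<gamma> H)"
        using tG tH by (simp_all add: inner_add_left inner_diff_left algebra_simps)
      have t1: "1 - t \<noteq> 0"
      proof
        assume "1 - t = 0"
        then show False using eG a1[OF G] by simp
      qed
      have "(1 - t) * (n0 \<bullet> w (G, H)) = ((1 - t) * (n0 \<bullet> ?\<gamma> G)) * (n' \<bullet> ?\<gamma> H) - ((1 - t) * (n0 \<bullet> ?\<gamma> H)) * (n' \<bullet> ?\<gamma> G)"
        by (simp add: w_def inner_diff_right algebra_simps)
      also have "\<dots> = 0" unfolding eG eH by simp
      finally show False using t1 s(1) i by (simp add: n0_def)
    qed
  qed
  then show ?thesis using s(3) by (simp add: n0_def)
qed

text \<open>Each condition asks that \<open>m\<close> is not orthogonal to a certain nonzero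
  direction of a 2-face. By admissibility none of these directions is orthogonal to all of
  \<open>W\<close>, so each condition only excludes a proper subspace.\<close>

lemma exists_regular:
  assumes adm: "admissible P W" and D: "finite D" "\<And>d. d \<in> D \<Longrightarrow> \<exists>G. two_face P G \<and> d \<in> direction_space G \<and> d \<noteq> 0"
  obtains m where "m \<in> W" "regular m" "\<And>d. d \<in> D \<Longrightarrow> m \<bullet> d \<noteq> 0"
proof -
  have W: "subspace W" using adm by (simp add: admissible_iff linear_plane_def)
  define E where "E = (\<lambda>(p, q). q - p) ` {(p, q). closed_segment p q edge_of P}"
  have finE: "finite E" unfolding E_def by (rule finite_edge_dirs)
  \<comment> \<open>For non-parallel 2-faces with a common direction, \<open>c (G, H)\<close> spans
    the intersection of their direction planes; \<open>m\<close> must not vanish there.\<close>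
  define c where "c = (\<lambda>(G :: 'a set, H :: 'a set). SOME g. g \<in> direction_space G \<and> g \<in> direction_space H \<and> g \<noteq> 0)"
  define I where "I = {(G, H). two_face P G \<and> two_face P H \<and>
    (\<exists>g. g \<in> direction_space G \<and> g \<in> direction_space H \<and> g \<noteq> 0)}"
  have finI: "finite I"
    by (rule finite_subset[of _ "{G. two_face P G} \<times> {G. two_face P G}"]) (auto simp: I_def finite_two_faces)
  have c: "c (G, H) \<in> direction_space G" "c (G, H) \<in> direction_space H" "c (G, H) \<noteq> 0" if "(G, H) \<in> I" for G H
  proof -
    have "\<exists>g. g \<in> direction_space G \<and> g \<in> direction_space H \<and> g \<noteq> 0" using that by (simp add: I_def)
    from someI_ex[OF this] show "c (G, H) \<in> direction_space G" "c (G, H) \<in> direction_space H" "c (G, H) \<noteq> 0"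
      by (auto simp: c_def)
  qed
  have "\<exists>w\<in>W. w \<bullet> d \<noteq> 0" if d: "d \<in> D \<union> E \<union> c ` I" for d
  proof -
    have "\<exists>G. two_face P G \<and> d \<in> direction_space G \<and> d \<noteq> 0"
    proof -
      consider "d \<in> D" | "d \<in> E" | "d \<in> c ` I" using d by blast
      then show ?thesis
      proof cases
        case 2
        then obtain p q where pq: "closed_segment p q edge_of P" "d = q - p" by (auto simp: E_def)
        obtain G where "two_face P G" "closed_segment p q \<subseteq> G"
          using edge_in_two_face[OF poly _ pq(1)] full dim3 by auto
        moreover have "p \<noteq> q" using edge_segment(1)[OF poly pq(1)] .
        ultimately show ?thesis using pq(2) diff_in_direction_space[of q G p] by auto
      next
        case 3
        then obtain G H where "(G, H) \<in> I" "d = c (G, H)" by auto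
        then show ?thesis using c by (auto simp: I_def)
      qed (use D in blast)
    qed
    then show ?thesis using adm by (auto simp: admissible_iff)
  qed
  then obtain m where m: "m \<in> W" "\<And>d. d \<in> D \<union> E \<union> c ` I \<Longrightarrow> m \<bullet> d \<noteq> 0"
    using subspace_avoid[OF W, of "D \<union> E \<union> c ` I"] D(1) finE finI by blast
  have "generic m" unfolding generic_def using m(2) by (force simp: E_def)
  moreover have "g = 0"
    if GH: "two_face P G" "two_face P H" "direction_space G \<noteq> direction_space H"
      and g: "g \<in> direction_space G" "g \<in> direction_space H" "m \<bullet> g = 0" for G H g
  proof (rule ccontr)
    assume g0: "g \<noteq> 0"
    then have I: "(G, H) \<in> I" using GH g by (auto simp: I_def)
    have mc: "m \<bullet> c (G, H) \<noteq> 0" using m(2) I by blast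
    then have "c (G, H) \<notin> span {g}" using g(3) by (auto simp: span_singleton)
    then have "direction_space G = span {g, c (G, H)}" "direction_space H = span {g, c (G, H)}"
      using plane_eq_span[OF subspace_direction_space two_face_dim] GH(1,2) g g0 c[OF I] by blast+
    then show False using GH(3) by simp
  qed
  ultimately have "regular m" unfolding regular_def by blast
  then show ?thesis using that m by blast
qed

text \<open>Exchange one basis vector at a time: \<open>m\<close> and \<open>m'\<close> can be chosen in \<open>W\<close> and \<open>W'\<close> such that
  they span an admissible plane as well.\<close>

lemma nverts_constant:
  assumes adm: "admissible P W" "admissible P W'"
  shows "nverts W = nverts W'"
proof -
  have plane: "subspace W" "dim W = 2" "subspace W'" "dim W' = 2"
    using adm by (auto simp: admissible_def linear_plane_def)
  have "2 \<le> aff_dim P" using full dim3 by simp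
  then obtain F where F: "two_face P F" using two_face_exists[OF poly] by blast
  obtain m where m: "m \<in> W" "regular m" using exists_regular[OF adm(1), of "{}"] by auto
  have gen: "generic m" using m by (simp add: regular_def)
  obtain m' where m': "m' \<in> W'" "regular m'" "\<And>d. d \<in> null_vec m ` {G. two_face P G} \<Longrightarrow> m' \<bullet> d \<noteq> 0"
    using exists_regular[OF adm(2) finite_imageI[OF finite_two_faces], of "null_vec m"] null_vec[OF gen] by blast
  have adm': "admissible P (span {m', m})" using m'(3) by (simp add: admissible_null_vec[OF gen])
  have "m \<noteq> 0" "m' \<noteq> 0"
    using plane_independent[of m' m 0 1] plane_independent[of m' m 1 0] adm' by (auto simp: admissible_def)
  then obtain n n' where n: "W = span {m, n}" and n': "W' = span {m', n'}"
    using plane_basis plane m(1) m'(1) by metis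
  have "nverts (span {n, m}) = nverts (span {m', m})"
    by (rule nverts_fixed_direction[OF m(2) _ adm']) (use adm n in \<open>simp add: insert_commute\<close>)
  moreover have "nverts (span {m, m'}) = nverts (span {n', m'})"
    by (rule nverts_fixed_direction[OF m'(2)]) (use adm adm' n' in \<open>simp_all add: insert_commute\<close>)
  ultimately show ?thesis using n n' by (simp add: insert_commute)
qed

lemma equiprojective_P: "equiprojective P"
  using nverts_constant equiprojective_nverts by blast

end

subsection \<open>Pairings and cyclic orientations\<close>

text \<open>The pairing covers \<open>E\<close> while the sum runs over one group \<open>T\<close>.
  Since pairs respect \<open>T\<close>, extending \<open>h\<close> by 0 allows the sum to be taken
  pair by pair.\<close>

lemma zero_sum_if_paired:
  fixes h :: "'b \<Rightarrow> real"
  assumes M: "partition_on E M" and fin: "finite E" and T: "T \<subseteq> E"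
    and pair: "\<And>X. X \<in> M \<Longrightarrow> \<exists>s t. X = {s, t} \<and> s \<noteq> t \<and> (s \<in> T \<longleftrightarrow> t \<in> T) \<and> (s \<in> T \<longrightarrow> h s + h t = 0)"
  shows "(\<Sum>t\<in>T. h t) = 0"
proof -
  define h' where "h' t = (if t \<in> T then h t else 0)" for t
  have "(\<Sum>t\<in>T. h t) = (\<Sum>t\<in>E. h' t)"
    by (rule sum.mono_neutral_cong_left) (use fin T in \<open>auto simp: h'_def\<close>)
  also have "\<dots> = (\<Sum>X\<in>M. \<Sum>t\<in>X. h' t)"
  proof -
    have E: "E = \<Union>M" and disj: "disjoint M" using M by (auto simp: partition_on_def)
    have "\<forall>X\<in>M. finite X" using E fin by (meson Union_upper finite_subset)
    then show ?thesis
      using disj unfolding E disjoint_def by (subst sum.Union_disjoint) auto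
  qed
  also have "\<dots> = 0"
  proof (rule sum.neutral, rule)
    fix X assume "X \<in> M"
    then obtain s t where "X = {s, t}" "s \<noteq> t" "s \<in> T \<longleftrightarrow> t \<in> T" "s \<in> T \<longrightarrow> h s + h t = 0"
      using pair by blast
    then show "(\<Sum>t\<in>X. h' t) = 0" by (auto simp: h'_def)
  qed
  finally show ?thesis .
qed

text \<open>A vector \<open>z\<close> orthogonal to no \<open>V t\<close> separates each value of
  \<open>V\<close> from its negative. Only the elements with positive \<open>z \<bullet> V t\<close>
  choose a partner, by bijections onto the sets with the negated vector, so the choices cannot
  conflict.\<close>

lemma exists_pairing:
  fixes V :: "'b \<Rightarrow> 'a::real_inner" and key :: "'b \<Rightarrow> 'c"
  assumes fin: "finite E" and V0: "\<And>t. t \<in> E \<Longrightarrow> V t \<noteq> 0"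
    and card: "\<And>\<kappa> v. card {t \<in> E. key t = \<kappa> \<and> V t = v} = card {t \<in> E. key t = \<kappa> \<and> V t = - v}"
  obtains M where "partition_on E M"
    "\<And>X. X \<in> M \<Longrightarrow> \<exists>s t. X = {s, t} \<and> s \<in> E \<and> t \<in> E \<and> key s = key t \<and> V t = - V s"
proof -
  have ex: "\<exists>w\<in>UNIV. w \<bullet> d \<noteq> 0" if "d \<in> V ` E" for d
    using that V0 by (intro bexI[of _ d]) auto
  obtain z where "\<And>d. d \<in> V ` E \<Longrightarrow> z \<bullet> d \<noteq> 0"
  proof (rule subspace_avoid[OF subspace_UNIV finite_imageI[OF fin] ex])
    fix w assume "\<And>d. d \<in> V ` E \<Longrightarrow> w \<bullet> d \<noteq> 0"
    then show thesis by (rule that)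
  qed
  then have z: "z \<bullet> V t \<noteq> 0" if "t \<in> E" for t using that by simp
  define B where "B \<kappa> v = {t \<in> E. key t = \<kappa> \<and> V t = v}" for \<kappa> v
  have "\<exists>\<phi>. bij_betw \<phi> (B \<kappa> v) (B \<kappa> (- v))" for \<kappa> v
    using fin card unfolding B_def by (intro finite_same_card_bij) auto
  then obtain \<phi> where \<phi>: "\<And>\<kappa> v. bij_betw (\<phi> \<kappa> v) (B \<kappa> v) (B \<kappa> (- v))" by metis
  define f where "f t = \<phi> (key t) (V t) t" for t
  define Q where "Q = {t \<in> E. z \<bullet> V t > 0}"
  have f: "f t \<in> E" "key (f t) = key t" "V (f t) = - V t" if "t \<in> Q" for t
  proof -
    have "t \<in> B (key t) (V t)" using that by (simp add: B_def Q_def)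
    then have "f t \<in> B (key t) (- V t)" unfolding f_def using \<phi> bij_betwE by blast
    then show "f t \<in> E" "key (f t) = key t" "V (f t) = - V t" by (auto simp: B_def)
  qed
  have fQ: "f t \<notin> Q" if "t \<in> Q" for t using f(3)[OF that] that by (auto simp: Q_def)
  have inj: "s = t" if "s \<in> Q" "t \<in> Q" "f s = f t" for s t
  proof -
    have e: "key s = key t" "V s = V t" using f[OF that(1)] f[OF that(2)] that(3) by auto
    have "s \<in> B (key t) (V t)" "t \<in> B (key t) (V t)" using e that by (auto simp: B_def Q_def)
    then show ?thesis using \<phi>[of "key t" "V t"] that(3) e
      unfolding f_def bij_betw_def inj_on_def by metis
  qed
  define M where "M = (\<lambda>t. {t, f t}) ` Q"
  have "partition_on E M"
  proof (rule partition_onI)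
    show "\<Union>M = E"
    proof (intro equalityI subsetI)
      fix s assume "s \<in> E"
      show "s \<in> \<Union>M"
      proof (cases "s \<in> Q")
        case True then show ?thesis by (auto simp: M_def)
      next
        case False
        then have neg: "z \<bullet> V s < 0" using z[OF \<open>s \<in> E\<close>] \<open>s \<in> E\<close> by (auto simp: Q_def)
        have "s \<in> B (key s) (- (- V s))" using \<open>s \<in> E\<close> by (simp add: B_def)
        then obtain t where t: "t \<in> B (key s) (- V s)" "\<phi> (key s) (- V s) t = s"
          using \<phi>[of "key s" "- V s"] unfolding bij_betw_def by (metis imageE)
        then have "t \<in> Q" "f t = s" using neg by (auto simp: B_def Q_def f_def)
        then show ?thesis by (auto simp: M_def)
      qed
    qed (auto simp: M_def Q_def f)
    show "disjnt X Y" if XY: "X \<in> M" "Y \<in> M" "X \<noteq> Y" for X Y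
    proof -
      obtain s t where st: "s \<in> Q" "t \<in> Q" "X = {s, f s}" "Y = {t, f t}" using XY(1,2) by (auto simp: M_def)
      then have "s \<noteq> t" using XY by auto
      then show ?thesis using st fQ inj by (auto simp: disjnt_def)
    qed
    show "{} \<notin> M" by (auto simp: M_def)
  qed
  moreover have "\<exists>s t. X = {s, t} \<and> s \<in> E \<and> t \<in> E \<and> key s = key t \<and> V t = - V s" if "X \<in> M" for X
    using that f by (fastforce simp: M_def Q_def)
  ultimately show ?thesis using that by blast
qed

text \<open>Compare the sums for directions \<open>k\<close> slightly to the left and to the right of \<open>v\<close>: only the
  vectors parallel to \<open>v\<close> contribute to the difference.\<close>

lemma balanced_directions:
  fixes U :: "'b \<Rightarrow> 'a::euclidean_space"
  assumes fin: "finite T" and fr: "frame a b S" and U: "\<And>t. t \<in> T \<Longrightarrow> U t \<in> S"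
    and D: "finite D" "0 \<notin> D"
    and sum: "\<And>k. k \<in> S \<Longrightarrow> k \<noteq> 0 \<Longrightarrow> (\<And>d. d \<in> D \<Longrightarrow> d \<notin> span {k}) \<Longrightarrow> (\<Sum>t\<in>T. sgn (area a b (U t) k)) = 0"
    and v: "v \<in> S" "norm v = 1"
  shows "card {t \<in> T. sgn (U t) = v} = card {t \<in> T. sgn (U t) = - v}"
proof -
  have sS: "subspace S" using fr frame_subspace by blast
  have abS: "a \<in> S" "b \<in> S" using fr by (auto simp: frame_def intro: span_base)
  have ab: "a \<bullet> a = 1" "b \<bullet> b = 1" "a \<bullet> b = 0" "b \<bullet> a = 0"
    using fr by (auto simp: frame_def inner_commute)
  have v0: "v \<noteq> 0" using v(2) by auto
  \<comment> \<open>\<open>j\<close> is \<open>v\<close> rotated by a right angle inside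
    \<open>S\<close>, so that moving \<open>k\<close> from \<open>v\<close> by small positive and
    negative multiples of \<open>j\<close> leaves the line of \<open>v\<close> on its two
    sides.\<close>
  define j where "j = (- (v \<bullet> b)) *\<^sub>R a + (v \<bullet> a) *\<^sub>R b"
  have jS: "j \<in> S" unfolding j_def using abS sS by (intro subspace_add subspace_scale)
  have vj: "area a b v j > 0"
  proof -
    have "area a b v j = (v \<bullet> a)\<^sup>2 + (v \<bullet> b)\<^sup>2"
      by (simp add: area_def j_def inner_add_left inner_diff_left ab power2_eq_square)
    moreover have "v \<bullet> a \<noteq> 0 \<or> v \<bullet> b \<noteq> 0" using frame_expand[OF fr v(1)] v0 by auto
    ultimately show ?thesis by (simp add: sum_power2_gt_zero_iff)
  qed
  have kS: "v + s *\<^sub>R j \<in> S" for s using v(1) jS sS by (simp add: subspace_add subspace_scale)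
  have area_k: "area a b d (v + s *\<^sub>R j) = area a b d v + s * area a b d j" for d s
    by (simp add: area_add_right area_scale_right)
  have pos: "eventually (\<lambda>s::real. s > 0) (at_right 0)" by (simp add: eventually_at_filter)
  have parallel: "\<exists>c. d = c *\<^sub>R v" if "d \<in> S" "area a b d v = 0" for d
    using area_eq_0[OF fr v(1) that(1) v0] that(2) area_swap[of a b d v] by auto
  have evD: "eventually (\<lambda>s. \<forall>d\<in>D. d \<notin> span {v + s *\<^sub>R j} \<and> d \<notin> span {v + (- s) *\<^sub>R j}) (at_right 0)"
  proof (intro eventually_ball_finite D(1) ballI)
    fix d assume d: "d \<in> D"
    have in_span: "d \<in> S \<and> area a b d (v + s *\<^sub>R j) = 0" if sp: "d \<in> span {v + s *\<^sub>R j}" for s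
    proof -
      obtain c where "d = c *\<^sub>R (v + s *\<^sub>R j)" using sp by (auto simp: span_singleton)
      then show ?thesis using kS sS by (auto simp: area_scale_left area_self subspace_scale)
    qed
    show "eventually (\<lambda>s. d \<notin> span {v + s *\<^sub>R j} \<and> d \<notin> span {v + (- s) *\<^sub>R j}) (at_right 0)"
    proof (cases "d \<in> S")
      case False
      then show ?thesis using in_span by (intro always_eventually) blast
    next
      case True
      show ?thesis
      proof (cases "area a b d v = 0")
        case par: True
        then obtain c where "d = c *\<^sub>R v" using parallel True by blast
        then have dj: "area a b d j \<noteq> 0" using vj d D(2) by (auto simp: area_scale_left)
        show ?thesis
          using pos
        proof eventually_elim
          case (elim s)
          then have "area a b d (v + s *\<^sub>R j) \<noteq> 0" "area a b d (v + (- s) *\<^sub>R j) \<noteq> 0"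
            unfolding area_k using par dj by auto
          then show ?case using in_span by blast
        qed
      next
        case False
        have "((\<lambda>s. area a b d v + s * area a b d j) \<longlongrightarrow> area a b d v + 0 * area a b d j) (at_right 0)"
          "((\<lambda>s. area a b d v + (- s) * area a b d j) \<longlongrightarrow> area a b d v + (- 0) * area a b d j) (at_right 0)"
          by (intro tendsto_intros)+
        then have "eventually (\<lambda>s. area a b d v + s * area a b d j \<noteq> 0 \<and> area a b d v + (- s) * area a b d j \<noteq> 0) (at_right 0)"
          using False by (intro eventually_conj tendsto_imp_eventually_ne) auto
        then show ?thesis
          by (rule eventually_mono) (use in_span area_k in metis)
      qed
    qed
  qed
  have evT: "eventually (\<lambda>s. \<forall>t\<in>T. sgn (area a b (U t) (v + s *\<^sub>R j)) - sgn (area a b (U t) (v + (- s) *\<^sub>R j)) =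
      2 * ((if sgn (U t) = v then 1 else 0) - (if sgn (U t) = - v then 1 else 0))) (at_right 0)"
  proof (intro eventually_ball_finite fin ballI)
    fix t assume t: "t \<in> T"
    show "eventually (\<lambda>s. sgn (area a b (U t) (v + s *\<^sub>R j)) - sgn (area a b (U t) (v + (- s) *\<^sub>R j)) =
      2 * ((if sgn (U t) = v then 1 else 0) - (if sgn (U t) = - v then 1 else 0))) (at_right 0)"
    proof (cases "area a b (U t) v = 0")
      case True
      then obtain c where c: "U t = c *\<^sub>R v" using parallel U t by blast
      have sv: "sgn v = v" using v(2) by (simp add: sgn_div_norm)
      have vv: "v \<noteq> - v"
      proof
        assume "v = - v"
        then have "2 *\<^sub>R v = 0" by (metis add.right_inverse scaleR_2)
        then show False using v0 by simp
      qed
      then have vv': "- v \<noteq> v" by metis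
      have sU: "sgn (U t) = sgn c *\<^sub>R v" by (simp add: c sgn_scaleR sv)
      have cases: "(if sgn (U t) = v then 1 else 0) - (if sgn (U t) = - v then 1 else 0) = sgn c"
        using vv vv' v0 unfolding sU by (cases c "0::real" rule: linorder_cases) auto
      show ?thesis
        using pos
      proof eventually_elim
        case (elim s)
        have "sgn (area a b (U t) (v + s *\<^sub>R j)) = sgn c" "sgn (area a b (U t) (v + (- s) *\<^sub>R j)) = - sgn c"
          using elim vj unfolding area_k by (simp_all add: c area_scale_left area_self sgn_mult sgn_minus)
        then show ?case unfolding cases by simp
      qed
    next
      case False
      have ne: "sgn (U t) \<noteq> v" "sgn (U t) \<noteq> - v"
      proof -
        have "U t = norm (U t) *\<^sub>R sgn (U t)" by (cases "U t = 0") (simp_all add: sgn_div_norm)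
        then have e: "area a b (U t) v = norm (U t) * area a b (sgn (U t)) v" by (metis area_scale_left)
        show "sgn (U t) \<noteq> v" "sgn (U t) \<noteq> - v"
          using False unfolding e by (auto simp: area_self area_minus_left)
      qed
      define A B where "A = area a b (U t) v" and "B = area a b (U t) j"
      have "((\<lambda>s. A + s * B) \<longlongrightarrow> A + 0 * B) (at_right 0)"
        "((\<lambda>s. A + (- s) * B) \<longlongrightarrow> A + (- 0) * B) (at_right 0)"
        by (intro tendsto_intros)+
      then have l: "((\<lambda>s. A + s * B) \<longlongrightarrow> A) (at_right 0)" "((\<lambda>s. A + (- s) * B) \<longlongrightarrow> A) (at_right 0)" by auto
      have "eventually (\<lambda>s. sgn (A + s * B) = sgn A \<and> sgn (A + (- s) * B) = sgn A) (at_right 0)"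
      proof (cases "A > 0")
        case True
        show ?thesis using order_tendstoD(1)[OF l(1) True] order_tendstoD(1)[OF l(2) True]
          by eventually_elim (use True in simp)
      next
        case f: False
        then have neg: "A < 0" using False by (simp add: A_def)
        show ?thesis using order_tendstoD(2)[OF l(1) neg] order_tendstoD(2)[OF l(2) neg]
          by eventually_elim (use neg in simp)
      qed
      then show ?thesis
        unfolding area_k A_def[symmetric] B_def[symmetric]
        by (rule eventually_mono) (use ne in simp)
    qed
  qed
  obtain s where s: "s > 0" "\<forall>d\<in>D. d \<notin> span {v + s *\<^sub>R j} \<and> d \<notin> span {v + (- s) *\<^sub>R j}"
    "\<forall>t\<in>T. sgn (area a b (U t) (v + s *\<^sub>R j)) - sgn (area a b (U t) (v + (- s) *\<^sub>R j)) =
      2 * ((if sgn (U t) = v then 1 else 0) - (if sgn (U t) = - v then 1 else 0))"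
    using eventually_happens'[OF trivial_limit_at_right_real eventually_conj[OF pos eventually_conj[OF evD evT]]]
    by blast
  have k0: "v + r *\<^sub>R j \<noteq> 0" if "r \<noteq> 0" for r
  proof
    assume "v + r *\<^sub>R j = 0"
    then have "area a b v (v + r *\<^sub>R j) = 0" by (simp add: area_zero)
    then show False using that vj unfolding area_k by (simp add: area_self)
  qed
  have "(\<Sum>t\<in>T. sgn (area a b (U t) (v + s *\<^sub>R j))) = 0" "(\<Sum>t\<in>T. sgn (area a b (U t) (v + (- s) *\<^sub>R j))) = 0"
    using s(1,2) k0[of s] k0[of "- s"] by (intro sum kS; auto)+
  then have "0 = (\<Sum>t\<in>T. sgn (area a b (U t) (v + s *\<^sub>R j)) - sgn (area a b (U t) (v + (- s) *\<^sub>R j)))"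
    by (simp only: sum_subtractf)
  also have "\<dots> = (\<Sum>t\<in>T. 2 * ((if sgn (U t) = v then 1 else 0) - (if sgn (U t) = - v then 1 else 0)))"
    by (rule sum.cong[OF refl]) (use s(3) in blast)
  also have "\<dots> = 2 * (real (card {t \<in> T. sgn (U t) = v}) - real (card {t \<in> T. sgn (U t) = - v}))"
    using fin by (simp add: sum_distrib_left[symmetric] sum_subtractf sum.If_cases Int_def)
  finally show ?thesis by simp
qed

section \<open>Senses of rotation of polygons and orientations of 3-space\<close>

lemma ccw_eq:
  assumes F: "polytope F" "aff_dim F = 2" and fr: "frame a b (direction_space F)" and e: "e edge_of F"
  shows "ccw a b F e u \<longleftrightarrow> u = ccw_dir a b F e"
    and "\<exists>p q. e = closed_segment p q \<and> p \<noteq> q \<and> p \<in> F \<and> q \<in> F \<and> ccw_dir a b F e = q - p"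
proof -
  have conv: "convex F" using F polytope_imp_convex by blast
  obtain p q where pq: "p \<noteq> q" "e = closed_segment p q" "p extreme_point_of F" "q extreme_point_of F"
    using edge_endpoints[OF F(1) e] .
  have e': "closed_segment p q edge_of F" using e pq by simp
  obtain z where z: "z \<in> F" "z \<notin> closed_segment p q" using polygon_vertex_off_edge[OF F e'] by metis
  show "ccw a b F e u \<longleftrightarrow> u = ccw_dir a b F e"
    unfolding pq(2) using ccw_iff[OF conv fr e' z] ccw_dir_eq[OF conv fr e' z] by simp
  have d: "ccw_dir a b F e = sgn (area a b (q - p) (z - p)) *\<^sub>R (q - p)"
    unfolding pq(2) by (rule ccw_dir_eq[OF conv fr e' z])
  have "area a b (q - p) (z - p) \<noteq> 0" by (rule edge_side[OF conv fr e' z])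
  then have "ccw_dir a b F e = q - p \<or> ccw_dir a b F e = p - q"
    unfolding d by (auto simp: sgn_if)
  moreover have "p \<in> F" "q \<in> F" using pq by (auto simp: extreme_point_of_def)
  ultimately show "\<exists>p q. e = closed_segment p q \<and> p \<noteq> q \<and> p \<in> F \<and> q \<in> F \<and> ccw_dir a b F e = q - p"
    using pq(1,2) closed_segment_commute by metis
qed

text \<open>Consecutive edges are traversed with the same sense of rotation, because for both of them it
  is given by the sign of the area form at the pair of their directions.\<close>

lemma boundary_cycle_ccw:
  assumes F: "polytope F" "aff_dim F = 2" and fr: "frame a b (direction_space F)"
    and vs: "boundary_cycle F vs"
  obtains \<sigma> :: real where "\<sigma> = 1 \<or> \<sigma> = - 1"
    "\<And>e u. e edge_of F \<Longrightarrow> traverses_cyclically vs e u \<longleftrightarrow> u = \<sigma> *\<^sub>R ccw_dir a b F e"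
proof -
  have conv: "convex F" using F polytope_imp_convex by blast
  define n where "n = length vs"
  define nx where "nx i = vs ! (Suc i mod n)" for i
  have dist: "distinct vs" and set: "set vs = {v. v extreme_point_of F}"
    and edges: "{e. e edge_of F} = {closed_segment (vs ! i) (nx i) | i. i < n}"
    using vs by (auto simp: boundary_cycle_def nx_def n_def)
  \<comment> \<open>With at least three vertices, the vertex two steps ahead is off the current edge
    and can serve as the test point for its side.\<close>
  have n3: "3 \<le> n"
  proof -
    have "aff_dim F \<le> aff_dim (set vs)"
      using polytope_eq_hull[OF F(1)] set by (metis aff_dim_convex_hull order_refl)
    also have "\<dots> \<le> int (card (set vs)) - 1" by (rule aff_dim_le_card) simp
    also have "card (set vs) = n" using dist by (simp add: n_def distinct_card)
    finally show ?thesis using F by simp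
  qed
  have vin: "vs ! i extreme_point_of F" "vs ! i \<in> F" if "i < n" for i
    using that set nth_mem[of i vs] by (auto simp: n_def extreme_point_of_def)
  have off: "vs ! l \<notin> closed_segment (vs ! i) (nx i)" if "i < n" "l < n" "l \<noteq> i" "l \<noteq> Suc i mod n" for i l
  proof
    assume *: "vs ! l \<in> closed_segment (vs ! i) (nx i)"
    have "closed_segment (vs ! i) (nx i) edge_of F" using edges that(1) by blast
    then have "vs ! l extreme_point_of closed_segment (vs ! i) (nx i)"
      using extreme_point_of_face * vin(1)[OF that(2)] by (auto simp: edge_of_def)
    then have "vs ! l = vs ! i \<or> vs ! l = vs ! (Suc i mod n)" by (simp add: extreme_point_of_segment nx_def)
    moreover have "Suc i mod n < n" using n3 by simp
    ultimately show False using that dist by (auto simp: n_def nth_eq_iff_index_eq)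
  qed
  define u where "u i = nx i - vs ! i" for i
  define s where "s i = sgn (area a b (u i) (nx (Suc i mod n) - vs ! i))" for i
  have step: "s i = sgn (area a b (u i) (u (Suc i mod n))) \<and>
      ccw_dir a b F (closed_segment (vs ! i) (nx i)) = s i *\<^sub>R u i \<and> s i \<noteq> 0" if i: "i < n" for i
  proof -
    define l where "l = Suc (Suc i mod n) mod n"
    have l: "l < n" "l \<noteq> i" "l \<noteq> Suc i mod n"
      using n3 i by (auto simp: l_def mod_Suc split: if_splits)
    have e: "closed_segment (vs ! i) (nx i) edge_of F" using edges i by blast
    have z: "vs ! l \<in> F" "vs ! l \<notin> closed_segment (vs ! i) (nx i)" using vin[OF l(1)] off[OF i l] by auto
    have nl: "nx (Suc i mod n) = vs ! l" by (simp add: nx_def l_def)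
    have "area a b (u i) (vs ! l - vs ! i) = area a b (u i) (u (Suc i mod n) + u i)"
      by (rule arg_cong[of _ _ "area a b (u i)"]) (simp add: u_def nx_def l_def)
    then have "area a b (u i) (vs ! l - vs ! i) = area a b (u i) (u (Suc i mod n))"
      by (simp add: area_add_right area_self)
    then show ?thesis
      using ccw_dir_eq[OF conv fr e z] edge_side[OF conv fr e z]
      by (simp add: s_def nl u_def sgn_eq_0_iff)
  qed
  \<comment> \<open>For edge \<open>i\<close> the test point is the vertex two steps ahead, for edge
    \<open>Suc i\<close> it is the vertex behind; both give the area of the same pair of edge
    directions.\<close>
  have step2: "s (Suc i) = s i" if i: "Suc i < n" for i
  proof -
    have e: "closed_segment (vs ! Suc i) (nx (Suc i)) edge_of F" using edges i by blast
    have z: "vs ! i \<in> F" "vs ! i \<notin> closed_segment (vs ! Suc i) (nx (Suc i))"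
      using vin[of i] off[OF i, of i] i n3 by (auto simp: mod_Suc split: if_splits)
    have "ccw_dir a b F (closed_segment (vs ! Suc i) (nx (Suc i))) = sgn (area a b (u (Suc i)) (vs ! i - vs ! Suc i)) *\<^sub>R u (Suc i)"
      using ccw_dir_eq[OF conv fr e z] by (simp add: u_def)
    moreover have "vs ! i - vs ! Suc i = - u i" using i by (simp add: u_def nx_def)
    ultimately have "s (Suc i) *\<^sub>R u (Suc i) = sgn (area a b (u (Suc i)) (- u i)) *\<^sub>R u (Suc i)"
      using step[OF i] by simp
    moreover have "u (Suc i) \<noteq> 0"
    proof
      assume "u (Suc i) = 0"
      then have "closed_segment (vs ! Suc i) (nx (Suc i)) = {vs ! Suc i}" by (simp add: u_def)
      then show False using e by (simp add: edge_of_def)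
    qed
    ultimately have "s (Suc i) = sgn (area a b (u (Suc i)) (- u i))" by simp
    also have "area a b (u (Suc i)) (- u i) = area a b (u i) (u (Suc i))"
      using area_swap[of a b "u (Suc i)" "- u i"] by (simp add: area_minus_left)
    finally show ?thesis using step[of i] i by simp
  qed
  have s0: "s i = s 0" if "i < n" for i
    using that by (induction i) (use step2 in auto)
  define \<sigma> where "\<sigma> = s 0"
  have \<sigma>: "\<sigma> = 1 \<or> \<sigma> = - 1"
    using step[of 0] n3 by (auto simp: \<sigma>_def s_def sgn_if split: if_splits)
  have ui: "u i = \<sigma> *\<^sub>R ccw_dir a b F (closed_segment (vs ! i) (nx i))" if "i < n" for i
    using step[OF that] s0[OF that] \<sigma> by (auto simp: \<sigma>_def)
  have trav: "traverses_cyclically vs e w \<longleftrightarrow> (\<exists>i<n. e = closed_segment (vs ! i) (nx i) \<and> w = u i)" for e w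
    unfolding traverses_cyclically_def n_def[symmetric] nx_def[symmetric] u_def ..
  show ?thesis
  proof (rule that[OF \<sigma>])
    fix e w assume "e edge_of F"
    then obtain i where "i < n" "e = closed_segment (vs ! i) (nx i)" using edges by blast
    then show "traverses_cyclically vs e w \<longleftrightarrow> w = \<sigma> *\<^sub>R ccw_dir a b F e"
      unfolding trav using ui by metis
  qed
qed

lemma range_3: "range (f :: 3 \<Rightarrow> 'b) = {f 1, f 2, f 3}"
  by (simp only: UNIV_3 image_insert image_empty)

lemma span_triple: "x \<in> span {a, b, c} \<longleftrightarrow> (\<exists>r s t. x = r *\<^sub>R a + s *\<^sub>R b + t *\<^sub>R c)"
proof
  assume "x \<in> span {a, b, c}"
  then obtain r where "x - r *\<^sub>R a \<in> span {b, c}" by (auto simp: span_insert[of a])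
  then obtain s t where "x - r *\<^sub>R a = s *\<^sub>R b + t *\<^sub>R c" by (auto simp: span_pair)
  then have "x = r *\<^sub>R a + s *\<^sub>R b + t *\<^sub>R c" by (simp add: algebra_simps)
  then show "\<exists>r s t. x = r *\<^sub>R a + s *\<^sub>R b + t *\<^sub>R c" by blast
qed (auto intro!: span_add span_mul intro: span_base)

text \<open>In the coordinates of \<open>a\<close>, \<open>b\<close>, \<open>n0\<close> the triple
  has determinant \<open>c * area a b u w\<close>, and the change of basis to \<open>bs\<close>
  multiplies it by a nonzero constant. The chosen orientation thus enters only through the sign of
  \<kappa>.\<close>

lemma positively_oriented_frame:
  fixes a b n0 :: "'a::euclidean_space"
  assumes fr: "frame a b S" and n0: "n0 \<bullet> a = 0" "n0 \<bullet> b = 0" "n0 \<noteq> 0"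
    and basis: "ordered_basis (span {a, b, n0}) bs"
  obtains \<kappa> :: real where "\<kappa> \<noteq> 0"
    "\<And>u w c. u \<in> S \<Longrightarrow> w \<in> S \<Longrightarrow> positively_oriented bs (vector [u, w, c *\<^sub>R n0]) \<longleftrightarrow> c * area a b u w * \<kappa> > 0"
proof -
  have ab: "a \<bullet> a = 1" "b \<bullet> b = 1" "a \<bullet> b = 0" "b \<bullet> a = 0" "a \<bullet> n0 = 0" "b \<bullet> n0 = 0"
    using fr n0 by (auto simp: frame_def inner_commute)
  have nn: "n0 \<bullet> n0 \<noteq> 0" using n0 by simp
  define E :: "'a^3" where "E = vector [a, b, n0]"
  have E: "E $ 1 = a" "E $ 2 = b" "E $ 3 = n0" by (simp_all add: E_def)
  have span: "span {bs $ 1, bs $ 2, bs $ 3} = span {a, b, n0}"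
    using basis by (simp add: ordered_basis_def range_3)
  define comb :: "real^3 \<Rightarrow> 'a^3 \<Rightarrow> 'a" where "comb c B = (\<Sum>j\<in>UNIV. c $ j *\<^sub>R B $ j)" for c B
  have combE: "comb c E = c $ 1 *\<^sub>R a + c $ 2 *\<^sub>R b + c $ 3 *\<^sub>R n0" for c by (simp add: comb_def sum_3 E)
  have uniq: "c = c'" if "comb c E = comb c' E" for c c'
  proof -
    have "comb c E \<bullet> a = comb c' E \<bullet> a" "comb c E \<bullet> b = comb c' E \<bullet> b" "comb c E \<bullet> n0 = comb c' E \<bullet> n0"
      using that by simp_all
    then show ?thesis unfolding combE using nn n0
      by (simp add: inner_add_left ab vec_eq_iff forall_3)
  qed
  have coord: "\<exists>c. x = comb c B" if sp: "x \<in> span {B $ 1, B $ 2, B $ 3}" for x and B :: "'a^3"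
  proof -
    obtain r s t where "x = r *\<^sub>R B $ 1 + s *\<^sub>R B $ 2 + t *\<^sub>R B $ 3" using sp by (auto simp: span_triple)
    then show ?thesis by (intro exI[of _ "vector [r, s, t]"]) (simp add: comb_def sum_3)
  qed
  have ex: "\<exists>M::real^3^3. \<forall>i. B' $ i = comb (M $ i) B"
    if mem: "\<And>i. B' $ i \<in> span {B $ 1, B $ 2, B $ 3}" for B B' :: "'a^3"
  proof -
    obtain c where "\<And>i. B' $ i = comb (c i) B" using coord[OF mem] by metis
    then show ?thesis by (intro exI[of _ "\<chi> i. c i"]) simp
  qed
  have bsE: "bs $ i \<in> span {E $ 1, E $ 2, E $ 3}" for i
  proof -
    have "bs $ i \<in> span (range (($) bs))" by (rule span_base) simp
    then show ?thesis using span by (simp add: E range_3)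
  qed
  have Ebs: "E $ i \<in> span {bs $ 1, bs $ 2, bs $ 3}" for i
  proof -
    have "E $ i \<in> span (range (($) E))" by (rule span_base) simp
    then show ?thesis using span by (simp add: E range_3)
  qed
  \<comment> \<open>The rows of \<open>N\<close> are the coordinates of \<open>bs\<close> in the
    basis \<open>E\<close>, those of \<open>M0\<close> the coordinates of \<open>E\<close> in
    \<open>bs\<close>; the two matrices are inverse to each other.\<close>
  obtain N where N: "\<And>i. bs $ i = comb (N $ i) E" using ex[OF bsE] by blast
  obtain M0 where M0: "\<And>i. E $ i = comb (M0 $ i) bs" using ex[OF Ebs] by blast
  have mul: "comb (M $ i) B = comb ((M ** L) $ i) B'" if "\<And>j. B $ j = comb (L $ j) B'" for M L :: "real^3^3" and B B' :: "'a^3" and i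
    using that by (simp add: comb_def matrix_matrix_mult_def sum_3 algebra_simps)
  have detN: "det M0 * det N = 1"
  proof -
    have "comb ((M0 ** N) $ i) E = comb (mat 1 $ i) E" for i
    proof -
      have "comb ((M0 ** N) $ i) E = E $ i" using mul[of bs N E M0 i] N M0 by metis
      also have "\<dots> = comb (mat 1 $ i) E"
        by (cases i rule: exhaust_3[THEN disjE]) (auto simp: combE mat_def E elim: disjE)
      finally show ?thesis .
    qed
    then have "M0 ** N = mat 1" using uniq by (metis vec_eq_iff)
    then have "det (M0 ** N) = 1" by simp
    then show ?thesis by (simp add: det_mul)
  qed
  show ?thesis
  proof (rule that[of "det N"])
    show "det N \<noteq> 0" using detN by auto
    fix u w c assume uw: "u \<in> S" "w \<in> S"
    define K :: "real^3^3" where "K = vector [vector [u \<bullet> a, u \<bullet> b, 0], vector [w \<bullet> a, w \<bullet> b, 0], vector [0, 0, c]]"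
    have detK: "det K = c * area a b u w" by (simp add: K_def det_3 area_def algebra_simps)
    have K: "vector [u, w, c *\<^sub>R n0] $ i = comb (K $ i) E" for i :: 3
    proof -
      have "i = 1 \<or> i = 2 \<or> i = 3" by (rule exhaust_3)
      then show ?thesis
        using frame_expand[OF fr uw(1)] frame_expand[OF fr uw(2)] by (auto simp: combE K_def)
    qed
    show "positively_oriented bs (vector [u, w, c *\<^sub>R n0]) \<longleftrightarrow> c * area a b u w * det N > 0"
    proof
      assume "positively_oriented bs (vector [u, w, c *\<^sub>R n0])"
      then obtain M :: "real^3^3" where M: "det M > 0" "\<And>i. vector [u, w, c *\<^sub>R n0] $ i = comb (M $ i) bs"
        by (auto simp: positively_oriented_def comb_def)
      have "comb ((M ** N) $ i) E = comb (K $ i) E" for i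
        using mul[of bs N E M i] N M(2)[of i] K[of i] by metis
      then have "M ** N = K" using uniq by (metis vec_eq_iff)
      then have "det K = det M * det N" by (metis det_mul)
      then have "det K * det N = det M * (det N * det N)" by simp
      moreover have "det N \<noteq> 0" using detN by auto
      then have "det N * det N > 0" using not_real_square_gt_zero by blast
      ultimately have "det K * det N > 0" using M(1) mult_pos_pos by metis
      then show "c * area a b u w * det N > 0" using detK by simp
    next
      assume *: "c * area a b u w * det N > 0"
      have "vector [u, w, c *\<^sub>R n0] $ i = comb ((K ** M0) $ i) bs" for i
        using mul[of E M0 bs K i] M0 K[of i] by metis
      moreover have "det (K ** M0) > 0"
      proof -
        have "det M0 = det N * (det M0 * det M0)" using detN by (simp add: algebra_simps)
        then have "det K * det M0 = (det K * det N) * (det M0 * det M0)" by (metis mult.assoc)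
        moreover have "det M0 \<noteq> 0" using detN by auto
        then have "det M0 * det M0 > 0" using not_real_square_gt_zero by blast
        ultimately have "det K * det M0 > 0" using * mult_pos_pos unfolding detK by metis
        then show ?thesis by (simp add: det_mul)
      qed
      ultimately show "positively_oriented bs (vector [u, w, c *\<^sub>R n0])"
        unfolding positively_oriented_def comb_def by blast
    qed
  qed
qed

subsection \<open>Orientations of edge-2-faces\<close>

context full_polytope begin

text \<open>\<open>n0\<close> is the component of \<open>f - f'\<close> orthogonal to the direction
  plane of \<open>F\<close>, and every normal of \<open>F\<close> inside the direction space of
  \<open>Q\<close> is a multiple of it. Comparing \<open>F\<close> with the point \<open>f'\<close>
  of \<open>Q\<close> excludes negative factors; conversely, \<nu> exposes \<open>F\<close> and is
  positive on \<open>n0\<close>, so \<open>Q\<close> lies on the inner side.\<close>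

lemma outward_normal_iff:
  assumes F: "max_face P \<nu> = F"
    and fr: "frame a b (direction_space F)"
    and n0: "\<nu> \<bullet> n0 > 0" "n0 \<bullet> a = 0" "n0 \<bullet> b = 0" "n0 \<in> direction_space Q" "f - f' - n0 \<in> direction_space F"
    and Q: "F \<subseteq> Q" "F' \<subseteq> Q" "Q \<subseteq> P" "direction_space Q = span {a, b, n0}"
    and f: "f \<in> F" "f' \<in> F'"
  shows "outward_normal n Q F \<longleftrightarrow> (\<exists>c>0. n = c *\<^sub>R n0)"
proof
  have ab: "a \<bullet> a = 1" "b \<bullet> b = 1" "a \<bullet> b = 0" "b \<bullet> a = 0" "a \<bullet> n0 = 0" "b \<bullet> n0 = 0"
    using fr n0 by (auto simp: frame_def inner_commute)
  have abF: "a \<in> direction_space F" "b \<in> direction_space F"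
    using fr by (auto simp: frame_def intro: span_base)
  have n00: "n0 \<noteq> 0" using n0(1) by auto
  have orth: "\<nu> \<bullet> v = 0" if "v \<in> direction_space F" for v
    using max_face_direction_orth that F by blast
  have n0S: "n0 \<bullet> v = 0" if "v \<in> direction_space F" for v
    using that fr n0(2,3) by (auto simp: frame_def span_pair inner_add_right)
  {
    assume "outward_normal n Q F"
    then have n: "n \<in> span {a, b, n0}" "n \<noteq> 0" "\<And>v. v \<in> direction_space F \<Longrightarrow> n \<bullet> v = 0"
      "\<And>x y. y \<in> F \<Longrightarrow> x \<in> Q \<Longrightarrow> n \<bullet> x \<le> n \<bullet> y"
      using Q(4) by (auto simp: outward_normal_def orthogonal_def)
    obtain r s c where rsc: "n = r *\<^sub>R a + s *\<^sub>R b + c *\<^sub>R n0" using n(1) by (auto simp: span_triple)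
    have "r = 0" "s = 0" using n(3)[OF abF(1)] n(3)[OF abF(2)] ab n0 by (simp_all add: rsc inner_add_left)
    then have nc: "n = c *\<^sub>R n0" using rsc by simp
    have "f' \<in> Q" using f Q by auto
    then have "0 \<le> n \<bullet> (f - f')" using n(4)[OF f(1)] by (simp add: inner_diff_right)
    also have "n \<bullet> (f - f') = c * (n0 \<bullet> n0)" using n0S[OF n0(5)] unfolding nc
      by (simp add: inner_diff_right[of n0 "f - f'"] del: inner_diff_right)
    finally have "0 \<le> c * (n0 \<bullet> n0)" .
    moreover have "n0 \<bullet> n0 > 0" using n00 by simp
    ultimately have "0 \<le> c" by (auto simp: zero_le_mult_iff)
    then have "c > 0" using n(2) nc by (cases "c = 0") auto
    then show "\<exists>c>0. n = c *\<^sub>R n0" using nc by blast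
  next
    assume "\<exists>c>0. n = c *\<^sub>R n0"
    then obtain c where c: "c > 0" "n = c *\<^sub>R n0" by blast
    have "n \<bullet> x \<le> n \<bullet> y" if y: "y \<in> F" and x: "x \<in> Q" for x y
    proof -
      have "x - y \<in> span {a, b, n0}" using diff_in_direction_space[of x Q y] x y Q by auto
      then obtain r s t where rst: "x - y = r *\<^sub>R a + s *\<^sub>R b + t *\<^sub>R n0" by (auto simp: span_triple)
      have "\<nu> \<bullet> x \<le> \<nu> \<bullet> y" using y x F Q by (auto simp: max_face_def)
      then have "\<nu> \<bullet> (x - y) \<le> 0" by (simp add: inner_diff_right)
      then have "t * (\<nu> \<bullet> n0) \<le> 0" unfolding rst by (simp add: inner_add_right orth[OF abF(1)] orth[OF abF(2)])
      then have "t \<le> 0" using n0(1) by (simp add: mult_le_0_iff)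
      then have "c * (t * (n0 \<bullet> n0)) \<le> 0"
        using c(1) by (simp add: mult_nonneg_nonpos mult_nonpos_nonneg)
      then have "n \<bullet> (x - y) \<le> 0" unfolding rst c(2) by (simp add: inner_add_right n0 mult.left_commute)
      then show ?thesis by (simp add: inner_diff_right)
    qed
    then show "outward_normal n Q F"
      using c n00 n0(4) n0S by (auto simp: outward_normal_def orthogonal_def subspace_scale)
  }
qed

text \<open>The positive factor of the normal drops out of the sign condition, which leaves the
  planar condition \<open>ccw\<close> up to the sign of \<kappa>.\<close>

lemma traverses_ccw_frame:
  assumes F: "two_face P F" and fr: "frame a b (direction_space F)" and e: "e edge_of F"
    and out: "\<And>n. outward_normal n Q F \<longleftrightarrow> (\<exists>c>0. n = c *\<^sub>R n0)"
    and or: "\<kappa> \<noteq> 0" "\<And>u w c. u \<in> direction_space F \<Longrightarrow> w \<in> direction_space F \<Longrightarrow>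
      positively_oriented bs (vector [u, w, c *\<^sub>R n0]) \<longleftrightarrow> c * area a b u w * \<kappa> > 0"
  shows "traverses_ccw bs Q F e u \<longleftrightarrow> u = sgn \<kappa> *\<^sub>R ccw_dir a b F e"
proof -
  have eF: "e \<subseteq> F" using e edge_of_imp_subset by blast
  have uF: "u \<in> direction_space F" if "e = closed_segment p q" "u = q - p" for p q u
    using that eF by (auto intro!: diff_in_direction_space)
  have wF: "w \<in> direction_space F" if pw: "points_into w e F" for w
  proof -
    obtain x t where x: "x \<in> F" "t > 0" "x + t *\<^sub>R w \<in> F" using pw eF by (auto simp: points_into_def)
    then have "(1 / t) *\<^sub>R ((x + t *\<^sub>R w) - x) \<in> direction_space F"
      by (intro subspace_scale subspace_direction_space diff_in_direction_space)
    then show ?thesis using x(2) by simp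
  qed
  have sg: "sgn \<kappa> = 1 \<or> sgn \<kappa> = - 1" using or(1) by (auto simp: sgn_if)
  have seg: "(\<exists>p q. e = closed_segment p q \<and> sgn \<kappa> *\<^sub>R u = q - p) \<longleftrightarrow> (\<exists>p q. e = closed_segment p q \<and> u = q - p)"
  proof -
    have neg: "\<exists>p q. e = closed_segment p q \<and> - u = q - p" if seg: "\<exists>p q. e = closed_segment p q \<and> u = q - p" for u
    proof -
      obtain p q where "e = closed_segment p q" "u = q - p" using seg by blast
      then have "e = closed_segment q p \<and> - u = p - q" by (simp add: closed_segment_commute)
      then show ?thesis by blast
    qed
    show ?thesis using sg
    proof
      assume "sgn \<kappa> = - 1"
      then have "sgn \<kappa> *\<^sub>R u = - u" by simp
      then show ?thesis using neg[of u] neg[of "- u"] by auto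
    qed simp
  qed
  have "traverses_ccw bs Q F e u \<longleftrightarrow> (\<exists>p q. e = closed_segment p q \<and> u = q - p) \<and>
      (\<exists>w. points_into w e F \<and> (\<exists>c>0. positively_oriented bs (vector [u, w, c *\<^sub>R n0])))"
    unfolding traverses_ccw_def out by blast
  also have "\<dots> \<longleftrightarrow> (\<exists>p q. e = closed_segment p q \<and> u = q - p) \<and>
      (\<exists>w. points_into w e F \<and> area a b (sgn \<kappa> *\<^sub>R u) w > 0)"
  proof (intro conj_cong refl ex_cong1)
    fix w assume "\<exists>p q. e = closed_segment p q \<and> u = q - p" and pw: "points_into w e F"
    then have u: "u \<in> direction_space F" using uF by blast
    have "(\<exists>c>0. positively_oriented bs (vector [u, w, c *\<^sub>R n0])) \<longleftrightarrow> (\<exists>c>0. c * area a b u w * \<kappa> > 0)"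
      using or(2)[OF u wF[OF pw]] by blast
    also have "\<dots> \<longleftrightarrow> area a b u w * \<kappa> > 0"
      by (auto simp: zero_less_mult_iff mult.assoc intro: exI[of _ 1])
    also have "\<dots> \<longleftrightarrow> area a b (sgn \<kappa> *\<^sub>R u) w > 0"
      by (auto simp: area_scale_left zero_less_mult_iff sgn_if)
    finally show "(\<exists>c>0. positively_oriented bs (vector [u, w, c *\<^sub>R n0])) \<longleftrightarrow> area a b (sgn \<kappa> *\<^sub>R u) w > 0" .
  qed
  also have "\<dots> \<longleftrightarrow> ccw a b F e (sgn \<kappa> *\<^sub>R u)"
    unfolding ccw_def seg ..
  also have "\<dots> \<longleftrightarrow> sgn \<kappa> *\<^sub>R u = ccw_dir a b F e"
    by (rule ccw_eq(1)[OF two_faceD(1,6)[OF F] fr e])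
  also have "\<dots> \<longleftrightarrow> u = sgn \<kappa> *\<^sub>R ccw_dir a b F e" using sg by (auto simp: minus_equation_iff[of u])
  finally show ?thesis .
qed

text \<open>The outward normals of \<open>F\<close> and \<open>F'\<close> in \<open>Q\<close> are
  opposite, so one orientation of space induces opposite senses on the two polygons relative to a
  common frame. This is the same minus sign as in \<open>jump_total\<close>.\<close>

lemma oriented_pair:
  assumes vis: "simultaneously_visible P F F'" and F'0: "F' \<noteq> {}"
    and fr: "frame a b (direction_space F)"
    and basis: "ordered_basis (direction_space (affine hull (F \<union> F'))) bs"
  defines "Q \<equiv> P \<inter> affine hull (F \<union> F')"
  obtains \<sigma> :: real where "\<sigma> = 1 \<or> \<sigma> = - 1"
    "\<And>e u. e edge_of F \<Longrightarrow> traverses_ccw bs Q F e u \<longleftrightarrow> u = \<sigma> *\<^sub>R ccw_dir a b F e"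
    "\<And>e u. e edge_of F' \<Longrightarrow> traverses_ccw bs Q F' e u \<longleftrightarrow> u = - \<sigma> *\<^sub>R ccw_dir a b F' e"
proof -
  obtain \<nu> where \<nu>: "\<nu> \<noteq> 0" "max_face P \<nu> = F" "two_face P F"
    "if F' = {} then \<not> two_face P (max_face P (- \<nu>)) else max_face P (- \<nu>) = F' \<and> two_face P F'"
    by (rule visible_normal[OF vis]) blast
  have F': "max_face P (- \<nu>) = F'" "two_face P F'" using \<nu>(4) F'0 by auto
  have dirF': "direction_space F' = direction_space F" and ne: "F \<noteq> F'"
    using vis F'0 by (auto simp: simultaneously_visible_def parallel_faces_def)
  obtain f f' where f: "f \<in> F" "f' \<in> F'" using two_faceD(3) \<nu>(3) F'(2) by blast
  have ab: "a \<bullet> a = 1" "b \<bullet> b = 1" "a \<bullet> b = 0" "b \<bullet> a = 0" and S: "direction_space F = span {a, b}"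
    using fr by (auto simp: frame_def inner_commute)
  define n0 where "n0 = (f - f') - ((f - f') \<bullet> a) *\<^sub>R a - ((f - f') \<bullet> b) *\<^sub>R b"
  have n0ab: "n0 \<bullet> a = 0" "n0 \<bullet> b = 0" by (simp_all add: n0_def inner_diff_left ab)
  have abS: "a \<in> direction_space F" "b \<in> direction_space F" unfolding S by (auto intro: span_base)
  have \<nu>ab: "\<nu> \<bullet> a = 0" "\<nu> \<bullet> b = 0" using abS max_face_direction_orth \<nu>(2) by metis+
  have diff: "f - f' - n0 \<in> direction_space F"
  proof -
    have "f - f' - n0 = ((f - f') \<bullet> a) *\<^sub>R a + ((f - f') \<bullet> b) *\<^sub>R b" by (simp add: n0_def)
    then show ?thesis unfolding S span_pair by blast
  qed
  have "\<nu> \<bullet> f' < \<nu> \<bullet> f" using max_face_opposite[OF \<nu>(1)] f \<nu>(2) F'(1) by blast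
  then have \<nu>n0: "\<nu> \<bullet> n0 > 0" by (simp add: n0_def inner_diff_right \<nu>ab)
  have FQ: "F \<subseteq> Q" "F' \<subseteq> Q" "Q \<subseteq> P"
    using two_faceD(4)[OF \<nu>(3)] two_faceD(4)[OF F'(2)] hull_subset[of "F \<union> F'" affine] by (auto simp: Q_def)
  have dirA: "direction_space (affine hull (F \<union> F')) = span {a, b, n0}"
  proof -
    have "direction_space (F \<union> F') = span {a, b, n0}"
    proof
      have "x - f \<in> span {a, b, n0}" if x: "x \<in> F \<union> F'" for x
      proof (cases "x \<in> F")
        case True
        then have "x - f \<in> span {a, b}" using diff_in_direction_space f(1) S by blast
        then show ?thesis using span_mono[of "{a, b}" "{a, b, n0}"] by auto
      next
        case False
        then have "x - f' \<in> span {a, b}" using x diff_in_direction_space f(2) S dirF' by blast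
        then have "(x - f') - (f - f' - n0) \<in> span {a, b}" using diff S span_diff by blast
        then have "(x - f') - (f - f' - n0) \<in> span {a, b, n0}" using span_mono[of "{a, b}" "{a, b, n0}"] by auto
        moreover have "n0 \<in> span {a, b, n0}" by (simp add: span_base)
        ultimately have "(x - f') - (f - f' - n0) - n0 \<in> span {a, b, n0}" by (rule span_diff)
        then show ?thesis by (simp add: algebra_simps)
      qed
      then have "(\<lambda>x. x - f) ` (F \<union> F') \<subseteq> span {a, b, n0}" by blast
      then have "span ((\<lambda>x. x - f) ` (F \<union> F')) \<subseteq> span {a, b, n0}" by (rule span_minimal) simp
      then show "direction_space (F \<union> F') \<subseteq> span {a, b, n0}"
        using direction_space_basepoint[of f "F \<union> F'"] f(1) by simp
      have "direction_space F \<subseteq> direction_space (F \<union> F')" by (rule direction_space_mono) simp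
      moreover have "f - f' \<in> direction_space (F \<union> F')" using f by (simp add: diff_in_direction_space)
      ultimately have abn: "a \<in> direction_space (F \<union> F')" "b \<in> direction_space (F \<union> F')"
        and "f - f' - n0 \<in> direction_space (F \<union> F')" "f - f' \<in> direction_space (F \<union> F')"
        using abS diff by blast+
      then have "f - f' - (f - f' - n0) \<in> direction_space (F \<union> F')"
        using subspace_diff[OF subspace_direction_space] by blast
      then have "n0 \<in> direction_space (F \<union> F')" by simp
      with abn show "span {a, b, n0} \<subseteq> direction_space (F \<union> F')"
        by (intro span_minimal) auto
    qed
    then show ?thesis by (simp add: direction_space_affine_hull)
  qed
  have dirQ: "direction_space Q = span {a, b, n0}"
  proof
    show "direction_space Q \<subseteq> span {a, b, n0}"
      unfolding dirA[symmetric] by (rule direction_space_mono) (simp add: Q_def)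
    have "direction_space (F \<union> F') \<subseteq> direction_space Q" by (rule direction_space_mono) (use FQ in auto)
    then show "span {a, b, n0} \<subseteq> direction_space Q"
      using dirA by (simp add: direction_space_affine_hull)
  qed
  have n0Q: "n0 \<in> direction_space Q" "- n0 \<in> direction_space Q"
    unfolding dirQ by (auto intro: span_base span_neg)
  have n00: "n0 \<noteq> 0" using \<nu>n0 by auto
  obtain \<kappa> where \<kappa>: "\<kappa> \<noteq> 0" "\<And>u w c. u \<in> direction_space F \<Longrightarrow> w \<in> direction_space F \<Longrightarrow>
      positively_oriented bs (vector [u, w, c *\<^sub>R n0]) \<longleftrightarrow> c * area a b u w * \<kappa> > 0"
    using positively_oriented_frame[OF fr n0ab n00 basis[unfolded dirA]] by blast
  have out: "outward_normal n Q F \<longleftrightarrow> (\<exists>c>0. n = c *\<^sub>R n0)" for n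
    by (rule outward_normal_iff[OF \<nu>(2) fr \<nu>n0 n0ab n0Q(1) diff FQ dirQ f])
  have out': "outward_normal n Q F' \<longleftrightarrow> (\<exists>c>0. n = c *\<^sub>R - n0)" for n
  proof (rule outward_normal_iff[OF F'(1)])
    show "frame a b (direction_space F')" using fr dirF' by simp
    show "- \<nu> \<bullet> - n0 > 0" "- n0 \<bullet> a = 0" "- n0 \<bullet> b = 0" using \<nu>n0 n0ab by auto
    have "- (f - f' - n0) \<in> direction_space F" using diff by (simp add: subspace_neg del: minus_diff_eq)
    then show "f' - f - - n0 \<in> direction_space F'" by (simp add: dirF' algebra_simps)
    show "direction_space Q = span {a, b, - n0}"
    proof -
      have "span {a, b, - n0} = span {a, b, n0}"
      proof (rule span_eq[THEN iffD2], rule conjI)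
        show "{a, b, - n0} \<subseteq> span {a, b, n0}" by (auto intro: span_base span_neg)
        have "- (- n0) \<in> span {a, b, - n0}" by (intro span_neg span_base) simp
        then show "{a, b, n0} \<subseteq> span {a, b, - n0}" by (auto intro: span_base)
      qed
      then show ?thesis using dirQ by simp
    qed
  qed (use FQ f n0Q in auto)
  have \<kappa>': "- \<kappa> \<noteq> 0" "positively_oriented bs (vector [u, w, c *\<^sub>R - n0]) \<longleftrightarrow> c * area a b u w * - \<kappa> > 0"
    if "u \<in> direction_space F'" "w \<in> direction_space F'" for u w c
    using \<kappa>(1) \<kappa>(2)[of u w "- c"] that dirF' by auto
  have \<kappa>0: "- \<kappa> \<noteq> 0" using \<kappa>(1) by simp
  show ?thesis
  proof (rule that[of "sgn \<kappa>"])
    show "sgn \<kappa> = 1 \<or> sgn \<kappa> = - 1" using \<kappa>(1) by (auto simp: sgn_if)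
    show "traverses_ccw bs Q F e u \<longleftrightarrow> u = sgn \<kappa> *\<^sub>R ccw_dir a b F e" if "e edge_of F" for e u
      by (rule traverses_ccw_frame[OF \<nu>(3) fr that out \<kappa>])
    show "traverses_ccw bs Q F' e u \<longleftrightarrow> u = - sgn \<kappa> *\<^sub>R ccw_dir a b F' e" if "e edge_of F'" for e u
      using traverses_ccw_frame[OF F'(2) fr[folded dirF'] that out' \<kappa>0 \<kappa>'(2)] by (simp add: sgn_minus)
  qed
qed

end

section \<open>Signed sums over edge-2-faces and the two implications\<close>

locale oriented_polytope = full_polytope +
  fixes \<omega> :: "'a set \<Rightarrow> 'a^3" and \<gamma> :: "'a set \<Rightarrow> 'a list"
  assumes choice: "orientation_choice P \<omega> \<gamma>"
begin

abbreviation "E2 \<equiv> edge_2_faces P"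

definition dir :: "'a set \<times> 'a set \<times> 'a set \<Rightarrow> 'a" where
  "dir t = (THE u. oriented_along P \<omega> \<gamma> t u)"

text \<open>The pair is unordered because compensating edge-2-faces may have \<open>F\<close> and
  \<open>F'\<close> exchanged.\<close>

definition pair_of :: "'a set \<times> 'a set \<times> 'a set \<Rightarrow> 'a set set" where
  "pair_of t = (case t of (e, F, F') \<Rightarrow> {F, F'})"

lemma visible_faces:
  assumes "simultaneously_visible P F F'"
  shows "two_face P F" "F \<noteq> {}" "F \<noteq> F'" "F' \<noteq> {} \<Longrightarrow> two_face P F'"
    "F' \<noteq> {} \<Longrightarrow> direction_space F' = direction_space F" "F' \<noteq> {} \<Longrightarrow> simultaneously_visible P F' F"
proof -
  show F: "two_face P F" "F \<noteq> {}" "F \<noteq> F'" "F' \<noteq> {} \<Longrightarrow> two_face P F'"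
    using assms by (auto simp: simultaneously_visible_def two_face_def split: if_splits)
  show d: "F' \<noteq> {} \<Longrightarrow> direction_space F' = direction_space F"
    using assms by (auto simp: simultaneously_visible_def parallel_faces_def)
  assume "F' \<noteq> {}"
  then have "face_class P F = face_class P F'" using F d face_class_eq_iff by metis
  then have "only_degenerating P W F \<longleftrightarrow> only_degenerating P W F'" for W
    by (simp add: only_degenerating_def)
  then show "simultaneously_visible P F' F"
    using assms F \<open>F' \<noteq> {}\<close> by (auto simp: simultaneously_visible_def parallel_faces_def)
qed

text \<open>Both kinds of edge-2-faces are treated alike: the arbitrary choices for a pair amount to
  one sign \<sigma>. For empty \<open>F'\<close> the last clause is vacuous, as the empty set has no
  edges.\<close>

lemma oriented:
  assumes vis: "simultaneously_visible P F F'" and fr: "frame a b (direction_space F)"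
  obtains \<sigma> :: real where "\<sigma> = 1 \<or> \<sigma> = - 1"
    "\<And>e u. e edge_of F \<Longrightarrow> oriented_along P \<omega> \<gamma> (e, F, F') u \<longleftrightarrow> u = \<sigma> *\<^sub>R ccw_dir a b F e"
    "\<And>e u. e edge_of F' \<Longrightarrow> oriented_along P \<omega> \<gamma> (e, F', F) u \<longleftrightarrow> u = - \<sigma> *\<^sub>R ccw_dir a b F' e"
proof (cases "F' = {}")
  case True
  note F = two_faceD[OF visible_faces(1)[OF vis]]
  have "boundary_cycle F (\<gamma> F)" using choice vis True by (auto simp: orientation_choice_def)
  then obtain \<sigma> :: real where \<sigma>: "\<sigma> = 1 \<or> \<sigma> = - 1"
    "\<And>e u. e edge_of F \<Longrightarrow> traverses_cyclically (\<gamma> F) e u \<longleftrightarrow> u = \<sigma> *\<^sub>R ccw_dir a b F e"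
    using boundary_cycle_ccw[OF F(1,6) fr] by blast
  show ?thesis
  proof (rule that[OF \<sigma>(1)])
    show "oriented_along P \<omega> \<gamma> (e, F, F') u \<longleftrightarrow> u = \<sigma> *\<^sub>R ccw_dir a b F e" if "e edge_of F" for e u
      using \<sigma>(2)[OF that] True by simp
    show "oriented_along P \<omega> \<gamma> (e, F', F) u \<longleftrightarrow> u = - \<sigma> *\<^sub>R ccw_dir a b F' e" if "e edge_of F'" for e u
      using that True by (auto simp: edge_of_def)
  qed
next
  case False
  have "ordered_basis (direction_space (affine hull (F \<union> F'))) (\<omega> (affine hull (F \<union> F')))"
    using choice vis False by (auto simp: orientation_choice_def)
  from oriented_pair[OF vis False fr this] obtain \<sigma> :: real where \<sigma>: "\<sigma> = 1 \<or> \<sigma> = - 1"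
    "\<And>e u. e edge_of F \<Longrightarrow> traverses_ccw (\<omega> (affine hull (F \<union> F'))) (P \<inter> affine hull (F \<union> F')) F e u \<longleftrightarrow> u = \<sigma> *\<^sub>R ccw_dir a b F e"
    "\<And>e u. e edge_of F' \<Longrightarrow> traverses_ccw (\<omega> (affine hull (F \<union> F'))) (P \<inter> affine hull (F \<union> F')) F' e u \<longleftrightarrow> u = - \<sigma> *\<^sub>R ccw_dir a b F' e"
    by blast
  show ?thesis
  proof (rule that[OF \<sigma>(1)])
    show "oriented_along P \<omega> \<gamma> (e, F, F') u \<longleftrightarrow> u = \<sigma> *\<^sub>R ccw_dir a b F e" if "e edge_of F" for e u
      using \<sigma>(2)[OF that] False by (simp add: Let_def)
    show "oriented_along P \<omega> \<gamma> (e, F', F) u \<longleftrightarrow> u = - \<sigma> *\<^sub>R ccw_dir a b F' e" if "e edge_of F'" for e u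
      using \<sigma>(3)[OF that] visible_faces(2)[OF vis] by (simp add: Let_def Un_commute)
  qed
qed

lemma visible_frame:
  assumes "simultaneously_visible P F F'"
  obtains a b where "frame a b (direction_space F)"
  using frame_exists[OF subspace_direction_space two_face_dim[OF visible_faces(1)[OF assms]]] .

lemma edge_2_faceD:
  assumes "(e, F, F') \<in> E2"
  shows "oriented_along P \<omega> \<gamma> (e, F, F') u \<longleftrightarrow> u = dir (e, F, F')"
    "dir (e, F, F') \<noteq> 0" "direction_space e = span {dir (e, F, F')}" "dir (e, F, F') \<in> direction_space F"
proof -
  have vis: "simultaneously_visible P F F'" and e: "e edge_of F" using assms by (auto simp: edge_2_faces_def)
  obtain a b where fr: "frame a b (direction_space F)" using visible_frame[OF vis] .
  obtain \<sigma> :: real where \<sigma>: "\<sigma> = 1 \<or> \<sigma> = - 1"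
    "\<And>u. oriented_along P \<omega> \<gamma> (e, F, F') u \<longleftrightarrow> u = \<sigma> *\<^sub>R ccw_dir a b F e"
    using oriented[OF vis fr] e by metis
  have d: "dir (e, F, F') = \<sigma> *\<^sub>R ccw_dir a b F e" unfolding dir_def by (rule the_equality) (use \<sigma>(2) in blast)+
  show "oriented_along P \<omega> \<gamma> (e, F, F') u \<longleftrightarrow> u = dir (e, F, F')" unfolding d \<sigma>(2) ..
  obtain p q where pq: "e = closed_segment p q" "p \<noteq> q" "p \<in> F" "q \<in> F" "ccw_dir a b F e = q - p"
    using ccw_eq(2)[OF two_faceD(1,6)[OF visible_faces(1)[OF vis]] fr e] by blast
  have d': "dir (e, F, F') = q - p \<or> dir (e, F, F') = - (q - p)" using \<sigma>(1) d pq(5) by auto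
  then show "dir (e, F, F') \<noteq> 0" using pq(2) by auto
  have "span {- (q - p)} = span {q - p}"
    using span_image_scale[of "{q - p}" "\<lambda>_. - 1"] by simp
  moreover have "direction_space e = span {q - p}" by (simp only: pq(1) direction_space_segment)
  ultimately show "direction_space e = span {dir (e, F, F')}" using d' by metis
  show "dir (e, F, F') \<in> direction_space F"
    unfolding d pq(5) using pq(3,4) by (intro subspace_scale subspace_direction_space diff_in_direction_space)
qed

lemma finite_edges: "two_face P F \<Longrightarrow> finite {e. e edge_of F}"
  by (rule finite_subset[OF _ finite_polytope_faces[of F]]) (auto simp: edge_of_def two_faceD)

lemma finite_E2: "finite E2"
proof -
  have fin: "finite (insert {} {F. F face_of P})" using finite_polytope_faces[OF poly] by simp
  have "E2 \<subseteq> insert {} {F. F face_of P} \<times> insert {} {F. F face_of P} \<times> insert {} {F. F face_of P}"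
  proof
    fix t assume t: "t \<in> E2"
    obtain e F F' where eF: "t = (e, F, F')" by (cases t) auto
    then have vis: "simultaneously_visible P F F'" and e: "e edge_of F" using t by (auto simp: edge_2_faces_def)
    have "F face_of P" using visible_faces(1)[OF vis] by (simp add: two_face_def)
    moreover have "F' = {} \<or> F' face_of P" using visible_faces(4)[OF vis] by (auto simp: two_face_def)
    moreover have "e face_of P" using e calculation(1) face_of_trans by (auto simp: edge_of_def)
    ultimately show "t \<in> insert {} {F. F face_of P} \<times> insert {} {F. F face_of P} \<times> insert {} {F. F face_of P}"
      using eF by auto
  qed
  then show ?thesis using fin by (meson finite_SigmaI finite_subset)
qed

text \<open>The edge-2-faces with pair \<open>{F, F'}\<close> are the oriented edges of
  \<open>F\<close> and of \<open>F'\<close>, so their signed count is, up to sign, the jump of the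
  vertex count at the crossing.\<close>

lemma group_sum:
  assumes vis: "simultaneously_visible P F F'" and fr: "frame a b (direction_space F)"
  obtains \<sigma> :: real where "\<sigma> = 1 \<or> \<sigma> = - 1"
    "\<And>k. (\<Sum>t | t \<in> E2 \<and> pair_of t = {F, F'}. sgn (area a b (dir t) k)) = \<sigma> * (edge_sum a b F k - edge_sum a b F' k)"
proof -
  obtain \<sigma> :: real where \<sigma>: "\<sigma> = 1 \<or> \<sigma> = - 1"
    "\<And>e u. e edge_of F \<Longrightarrow> oriented_along P \<omega> \<gamma> (e, F, F') u \<longleftrightarrow> u = \<sigma> *\<^sub>R ccw_dir a b F e"
    "\<And>e u. e edge_of F' \<Longrightarrow> oriented_along P \<omega> \<gamma> (e, F', F) u \<longleftrightarrow> u = - \<sigma> *\<^sub>R ccw_dir a b F' e"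
    by (rule oriented[OF vis fr]) blast
  let ?A = "(\<lambda>e. (e, F, F')) ` {e. e edge_of F}" and ?B = "(\<lambda>e. (e, F', F)) ` {e. e edge_of F'}"
  have empty: "\<not> e edge_of {}" for e :: "'a set" by (auto simp: edge_of_def)
  have T: "{t \<in> E2. pair_of t = {F, F'}} = ?A \<union> ?B"
  proof (intro equalityI subsetI)
    fix t assume t: "t \<in> {t \<in> E2. pair_of t = {F, F'}}"
    obtain e G G' where "t = (e, G, G')" by (cases t) auto
    then show "t \<in> ?A \<union> ?B"
      using t by (auto simp: pair_of_def doubleton_eq_iff edge_2_faces_def)
  next
    fix t assume "t \<in> ?A \<union> ?B"
    then show "t \<in> {t \<in> E2. pair_of t = {F, F'}}"
      using vis visible_faces(6)[OF vis] empty by (auto simp: pair_of_def edge_2_faces_def)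
  qed
  have sgs: "sgn \<sigma> = \<sigma>" using \<sigma>(1) by auto
  have fA: "finite {e. e edge_of F}" using finite_edges visible_faces(1)[OF vis] by blast
  have fB: "finite {e. e edge_of F'}"
    using finite_edges visible_faces(4)[OF vis] empty by (cases "F' = {}") auto
  have A: "(\<Sum>t\<in>?A. sgn (area a b (dir t) k)) = \<sigma> * edge_sum a b F k" for k
  proof -
    have "(\<Sum>t\<in>?A. sgn (area a b (dir t) k)) = (\<Sum>e | e edge_of F. sgn (area a b (dir (e, F, F')) k))"
      by (subst sum.reindex) (auto simp: inj_on_def)
    also have "\<dots> = (\<Sum>e | e edge_of F. \<sigma> * sgn (area a b (ccw_dir a b F e) k))"
    proof (rule sum.cong[OF refl])
      fix e assume "e \<in> {e. e edge_of F}"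
      then have "dir (e, F, F') = \<sigma> *\<^sub>R ccw_dir a b F e"
        unfolding dir_def by (intro the_equality) (use \<sigma>(2) in blast)+
      then show "sgn (area a b (dir (e, F, F')) k) = \<sigma> * sgn (area a b (ccw_dir a b F e) k)"
        by (simp add: area_scale_left sgn_mult sgs)
    qed
    also have "\<dots> = \<sigma> * edge_sum a b F k"
      using visible_faces(1)[OF vis] by (simp add: edge_sum_def sum_distrib_left)
    finally show ?thesis .
  qed
  have B: "(\<Sum>t\<in>?B. sgn (area a b (dir t) k)) = - \<sigma> * edge_sum a b F' k" for k
  proof (cases "F' = {}")
    case True
    then show ?thesis using empty by (simp add: edge_sum_def two_face_def)
  next
    case False
    have "(\<Sum>t\<in>?B. sgn (area a b (dir t) k)) = (\<Sum>e | e edge_of F'. sgn (area a b (dir (e, F', F)) k))"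
      by (subst sum.reindex) (auto simp: inj_on_def)
    also have "\<dots> = (\<Sum>e | e edge_of F'. - \<sigma> * sgn (area a b (ccw_dir a b F' e) k))"
    proof (rule sum.cong[OF refl])
      fix e assume "e \<in> {e. e edge_of F'}"
      then have "dir (e, F', F) = (- \<sigma>) *\<^sub>R ccw_dir a b F' e"
        unfolding dir_def by (intro the_equality) (use \<sigma>(3) in blast)+
      then have "sgn (area a b (dir (e, F', F)) k) = sgn (- \<sigma>) * sgn (area a b (ccw_dir a b F' e) k)"
        by (simp only: area_scale_left sgn_mult)
      then show "sgn (area a b (dir (e, F', F)) k) = - \<sigma> * sgn (area a b (ccw_dir a b F' e) k)"
        by (simp add: sgn_minus sgs)
    qed
    also have "\<dots> = - \<sigma> * edge_sum a b F' k"
      using visible_faces(4)[OF vis False] by (simp add: edge_sum_def sum_distrib_left sum_negf)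
    finally show ?thesis .
  qed
  have "?A \<inter> ?B = {}" using visible_faces(3)[OF vis] by auto
  then have "(\<Sum>t | t \<in> E2 \<and> pair_of t = {F, F'}. sgn (area a b (dir t) k)) = \<sigma> * (edge_sum a b F k - edge_sum a b F' k)" for k
    unfolding T using fA fB by (subst sum.union_disjoint) (auto simp: A B algebra_simps)
  then show ?thesis using that \<sigma>(1) by blast
qed

text \<open>Normalizing to unit vectors turns opposite orientations into an equation, from which
  parallelism and distinctness follow. Compensation thus depends only on \<open>pair_of\<close> and
  the unit vector, the two data matched by \<open>exists_pairing\<close>.\<close>

lemma compensate_iff:
  assumes s: "s \<in> E2" and t: "t \<in> E2"
  shows "compensate P \<omega> \<gamma> s t \<longleftrightarrow> pair_of s = pair_of t \<and> sgn (dir t) = - sgn (dir s)"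
proof -
  obtain e F F' where s': "s = (e, F, F')" by (cases s) auto
  obtain f G G' where t': "t = (f, G, G')" by (cases t) auto
  note S = edge_2_faceD[OF s[unfolded s'], folded s'] and T = edge_2_faceD[OF t[unfolded t'], folded t']
  have opp: "opposite_orientations P \<omega> \<gamma> s t \<longleftrightarrow> sgn (dir t) = - sgn (dir s)"
  proof
    assume "opposite_orientations P \<omega> \<gamma> s t"
    then obtain r where "r < 0" "dir t = r *\<^sub>R dir s"
      using S(1) T(1) by (auto simp: opposite_orientations_def)
    then show "sgn (dir t) = - sgn (dir s)" by (simp add: sgn_scaleR)
  next
    assume *: "sgn (dir t) = - sgn (dir s)"
    have "dir t = norm (dir t) *\<^sub>R sgn (dir t)" using T(2) by (simp add: sgn_div_norm)
    also have "\<dots> = (- (norm (dir t) / norm (dir s))) *\<^sub>R dir s"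
      unfolding * by (simp add: sgn_div_norm divide_inverse)
    finally have "dir t = (- (norm (dir t) / norm (dir s))) *\<^sub>R dir s" .
    moreover have "- (norm (dir t) / norm (dir s)) < 0" using S(2) T(2) by simp
    ultimately show "opposite_orientations P \<omega> \<gamma> s t"
      unfolding opposite_orientations_def S(1) T(1) by blast
  qed
  have par: "direction_space e = direction_space f" if "sgn (dir t) = - sgn (dir s)"
  proof -
    have sp: "span {sgn x} = span {x}" if "x \<noteq> 0" for x :: 'a
      using span_image_scale[of "{x}" "\<lambda>_. inverse (norm x)"] that by (simp add: sgn_div_norm)
    have neg: "span {- x} = span {x}" for x :: 'a
      using span_image_scale[of "{x}" "\<lambda>_. - 1"] by simp
    have "span {dir t} = span {- sgn (dir s)}" using sp[OF T(2)] that by simp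
    also have "\<dots> = span {dir s}" using neg sp[OF S(2)] by simp
    finally show ?thesis using S(3) T(3) by simp
  qed
  have ne: "s \<noteq> t" if "sgn (dir t) = - sgn (dir s)"
  proof
    assume "s = t"
    then have "sgn (dir s) + sgn (dir s) = 0" using that by (metis add.right_inverse)
    then have "2 *\<^sub>R sgn (dir s) = 0" by (simp add: scaleR_2)
    then show False using S(2) by (simp add: sgn_zero_iff)
  qed
  have "pair_of s = pair_of t \<longleftrightarrow> (F = G' \<and> F' = G \<or> F = G \<and> F' = G')"
    by (auto simp: s' t' pair_of_def doubleton_eq_iff)
  then show ?thesis using opp par ne unfolding s' t' compensate.simps by blast
qed

text \<open>Compensating edge-2-faces belong to the same group and contribute opposite signs for
  every \<open>k\<close>, so all group sums vanish and the polytope is balanced.\<close>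

lemma pairing_imp_equiprojective:
  assumes M: "partition_on E2 M" and comp: "\<forall>X\<in>M. \<exists>s t. X = {s, t} \<and> compensate P \<omega> \<gamma> s t"
  shows "equiprojective P"
proof -
  have "edge_sum a b F k = edge_sum a b F' k"
    if vis: "simultaneously_visible P F F'" and fr: "frame a b (direction_space F)" for F F' a b k
  proof -
    let ?T = "{t. t \<in> E2 \<and> pair_of t = {F, F'}}"
    obtain \<sigma> :: real where \<sigma>: "\<sigma> = 1 \<or> \<sigma> = - 1"
      "\<And>k. (\<Sum>t\<in>?T. sgn (area a b (dir t) k)) = \<sigma> * (edge_sum a b F k - edge_sum a b F' k)"
      by (rule group_sum[OF vis fr]) blast
    have "(\<Sum>t\<in>?T. sgn (area a b (dir t) k)) = 0"
    proof (rule zero_sum_if_paired[OF M finite_E2])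
      fix X assume X: "X \<in> M"
      then obtain s t where st: "X = {s, t}" "compensate P \<omega> \<gamma> s t" using comp by blast
      then have E: "s \<in> E2" "t \<in> E2" using X M by (auto simp: partition_on_def)
      then have c: "pair_of s = pair_of t" "sgn (dir t) = - sgn (dir s)"
        using st compensate_iff by auto
      have ne: "s \<noteq> t"
        using st(2) by (cases s; cases t) auto
      have area: "sgn (area a b x k) = sgn (area a b (sgn x) k)" if "x \<noteq> 0" for x
      proof -
        have "x = norm x *\<^sub>R sgn x" using that by (simp add: sgn_div_norm)
        then have "area a b x k = norm x * area a b (sgn x) k" by (metis area_scale_left)
        then show ?thesis using that by (simp add: sgn_mult)
      qed
      have nz: "dir s \<noteq> 0" "dir t \<noteq> 0" using edge_2_faceD(2) E by (metis prod_cases3)+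
      have "sgn (area a b (dir s) k) + sgn (area a b (dir t) k) = 0"
        unfolding area[OF nz(1)] area[OF nz(2)] c(2) by (simp add: area_minus_left sgn_minus)
      then show "\<exists>s t. X = {s, t} \<and> s \<noteq> t \<and> (s \<in> ?T \<longleftrightarrow> t \<in> ?T) \<and>
          (s \<in> ?T \<longrightarrow> sgn (area a b (dir s) k) + sgn (area a b (dir t) k) = 0)"
        using st(1) ne E c(1) by (intro exI[of _ s] exI[of _ t]) simp
    qed auto
    then show ?thesis using \<sigma>(1) \<sigma>(2)[of k] by auto
  qed
  then interpret balanced_polytope P by unfold_locales
  show ?thesis by (rule equiprojective_P)
qed

text \<open>Within each group the unit directions \<open>v\<close> and \<open>- v\<close> occur
  equally often by \<open>balanced_directions\<close>, and matching them group by group gives the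
  pairing.\<close>

lemma equiprojective_imp_pairing:
  assumes "equiprojective P"
  shows "\<exists>M. partition_on E2 M \<and> (\<forall>X\<in>M. \<exists>s t. X = {s, t} \<and> compensate P \<omega> \<gamma> s t)"
proof -
  have nz: "dir t \<noteq> 0" if "t \<in> E2" for t using edge_2_faceD(2) that by (metis prod_cases3)
  \<comment> \<open>Here \<kappa> and \<open>v\<close> are arbitrary; if one of the two sets has an
    element, it shows that \<kappa> comes from a visible pair and that \<open>v\<close> is a unit
    vector in its direction plane.\<close>
  have card: "card {t \<in> E2. pair_of t = \<kappa> \<and> sgn (dir t) = v} = card {t \<in> E2. pair_of t = \<kappa> \<and> sgn (dir t) = - v}"
    for \<kappa> v
  proof (cases "\<exists>t\<in>E2. pair_of t = \<kappa> \<and> (sgn (dir t) = v \<or> sgn (dir t) = - v)")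
    case False
    then have "{t \<in> E2. pair_of t = \<kappa> \<and> sgn (dir t) = v} = {}" "{t \<in> E2. pair_of t = \<kappa> \<and> sgn (dir t) = - v} = {}"
      by auto
    then show ?thesis by (metis (no_types, lifting))
  next
    case True
    then obtain t0 where t0: "t0 \<in> E2" "pair_of t0 = \<kappa>" "sgn (dir t0) = v \<or> sgn (dir t0) = - v" by blast
    obtain e F F' where eF: "t0 = (e, F, F')" by (cases t0) auto
    have vis: "simultaneously_visible P F F'" using t0 eF by (auto simp: edge_2_faces_def)
    have \<kappa>: "\<kappa> = {F, F'}" using t0 eF by (simp add: pair_of_def)
    obtain a b where fr: "frame a b (direction_space F)" using visible_frame[OF vis] .
    let ?T = "{t. t \<in> E2 \<and> pair_of t = {F, F'}}"
    obtain \<sigma> :: real where \<sigma>: "\<sigma> = 1 \<or> \<sigma> = - 1"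
      "\<And>k. (\<Sum>t\<in>?T. sgn (area a b (dir t) k)) = \<sigma> * (edge_sum a b F k - edge_sum a b F' k)"
      by (rule group_sum[OF vis fr]) blast
    obtain D where D: "finite D" "0 \<notin> D"
      "\<And>k. k \<in> direction_space F \<Longrightarrow> k \<noteq> 0 \<Longrightarrow> (\<And>d. d \<in> D \<Longrightarrow> d \<notin> span {k}) \<Longrightarrow>
        edge_sum a b F k = edge_sum a b F' k"
      by (rule equiprojective_edge_sum[OF assms vis fr]) blast
    have finT: "finite ?T" using finite_E2 by simp
    have inS: "dir t \<in> direction_space F" if tT: "t \<in> ?T" for t
    proof -
      obtain f G G' where t: "t = (f, G, G')" by (cases t) auto
      have G: "dir t \<in> direction_space G" using edge_2_faceD(4) tT t by blast
      have "G = F \<or> G = F'" using tT t by (auto simp: pair_of_def doubleton_eq_iff)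
      moreover have "G \<noteq> {}" using tT t visible_faces(2) by (auto simp: edge_2_faces_def)
      ultimately show ?thesis using G visible_faces(5)[OF vis] by auto
    qed
    have v: "v \<in> direction_space F" "norm v = 1"
    proof -
      have "t0 \<in> ?T" using t0 \<kappa> by simp
      then have "sgn (dir t0) \<in> direction_space F" using inS by (simp add: sgn_div_norm subspace_scale)
      then have "- sgn (dir t0) \<in> direction_space F" "sgn (dir t0) \<in> direction_space F" by (simp_all add: subspace_neg)
      then show "v \<in> direction_space F" using t0(3) by auto
      have "norm (sgn (dir t0)) = 1" using nz[OF t0(1)] by (simp add: norm_sgn)
      then show "norm v = 1" using t0(3) by auto
    qed
    have "card {t \<in> ?T. sgn (dir t) = v} = card {t \<in> ?T. sgn (dir t) = - v}"
    proof (rule balanced_directions[OF finT fr inS D(1,2) _ v])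
      fix k assume "k \<in> direction_space F" "k \<noteq> 0" "\<And>d. d \<in> D \<Longrightarrow> d \<notin> span {k}"
      then show "(\<Sum>t\<in>?T. sgn (area a b (dir t) k)) = 0" using D(3) \<sigma>(2) by simp
    qed
    then show ?thesis by (simp add: \<kappa>)
  qed
  obtain M where M: "partition_on E2 M"
    "\<And>X. X \<in> M \<Longrightarrow> \<exists>s t. X = {s, t} \<and> s \<in> E2 \<and> t \<in> E2 \<and> pair_of s = pair_of t \<and> sgn (dir t) = - sgn (dir s)"
    by (rule exists_pairing[OF finite_E2, of "\<lambda>t. sgn (dir t)" pair_of]) (use nz card in \<open>auto simp: sgn_zero_iff\<close>)
  have "\<exists>s t. X = {s, t} \<and> compensate P \<omega> \<gamma> s t" if "X \<in> M" for X
    using M(2)[OF that] compensate_iff by metis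
  then show ?thesis using M(1) by blast
qed

end

theorem theorem2:
  fixes P :: "'a::euclidean_space set"
    and \<omega> :: "'a set \<Rightarrow> 'a^3"
    and \<gamma> :: "'a set \<Rightarrow> 'a list"
  assumes "DIM('a) \<ge> 3"
    and "polytope P"
    and "aff_dim P = int (DIM('a))"
    and "orientation_choice P \<omega> \<gamma>"
  shows "equiprojective P \<longleftrightarrow>
    (\<exists>\<M>. partition_on (edge_2_faces P) \<M> \<and>
         (\<forall>X\<in>\<M>. \<exists>s t. X = {s, t} \<and> compensate P \<omega> \<gamma> s t))"
proof -
  interpret oriented_polytope P \<omega> \<gamma> using assms by unfold_locales auto
  show ?thesis using pairing_imp_equiprojective equiprojective_imp_pairing by blast
qed

end
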